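(* Let $r, k, n$ be integers with $0 \leq r \leq k \leq n$ and $k \geq 1$. The family of cells $\{ C_w : w \in \mathcal{W}_{n,k}^{(r)} \}$ induces an affine paving of the variety $X_{n,k}^{(r)}$.
   Context: The variety: $\mathbb{P}^{k-1}$ is the space of lines through the origin in $\mathbb{C}^k$, and $$X_{n,k}^{(r)} = \{ (\ell_1,\dots,\ell_n) \in (\mathbb{P}^{k-1})^n : \ell_1 + \cdots + \ell_n = \mathbb{C}^k \text{ and } \dim(\ell_1 + \cdots + \ell_r) = r \},$$ a Zariski open subset of $(\mathbb{P}^{k-1})^n$. Affine paving: for a smooth irreducible complex algebraic variety $X$, an affine paving of $X$ is an ordered partition $X = C_1 \sqcup \cdots \sqcup C_m$ such that for all $i$ the union $C_1 \sqcup \cdots \sqcup C_i$ is a closed subvariety of $X$ and $C_i$ is isomorphic as a variety to the affine space $\mathbb{C}^{n_i}$ for some integer $n_i$. A collection of subsets of $X$ induces an affine paving of $X$ if its members, in some total order, form an affine paving of $X$. Words: $[k] = \{1,\dots,k\}$. $\mathcal{W}_{n,k}^{(r)}$ is the set of words $w = w_1 \dots w_n \in [k]^n$ in which all of the letters $1,\dots,k$ appear and whose first $r$ letters $w_1,\dots,w_r$ are distinct. An index $j$ is initial in $w$ if $w_j$ is the first occurrence of its letter in $w$; $\mathrm{in}(w)$ is the set of initial indices. Cells: for $w \in [k]^n$ the $k \times n$ pattern matrix $\mathrm{PM}(w)$ has entries in $\{0,1,\star\}$ given by: $\mathrm{PM}(w)_{i,j} = 1$ if $w_j = i$; $\mathrm{PM}(w)_{i,j}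 = 0$ if the letter $i$ does not appear in $w$; otherwise (so $i \neq w_j$ and $i$ appears in $w$), if $j \in \mathrm{in}(w)$ then $\mathrm{PM}(w)_{i,j} = \star$ if $i < w_j$ and there exists $j' < j$ with $w_{j'} = i$, and $\mathrm{PM}(w)_{i,j} = 0$ otherwise; if $j \notin \mathrm{in}(w)$ then $\mathrm{PM}(w)_{i,j} = \star$ if the first $i$ in $w$ appears before the first $w_j$ in $w$, and $\mathrm{PM}(w)_{i,j} = 0$ otherwise. For example, $$\mathrm{PM}(242141) = \begin{pmatrix} 0 & 0 & 0 & 1 & 0 & 1 \\ 1 & \star & 1 & 0 & \star & \star \\ 0 & 0 & 0 & 0 & 0 & 0 \\ 0 & 1 & 0 & 0 & 1 & \star \end{pmatrix} \quad (k=4).$$ Let $\widehat{C_w}$ be the affine space of all complex matrices obtained by replacing the $\star$'s of $\mathrm{PM}(w)$ by complex numbers, and let $U \subset GL_k(\mathbb{C})$ be the group of lower triangular matrices with $1$'s on the diagonal. $C_w \subseteq (\mathbb{P}^{k-1})^n$ is the image of $U \cdot \widehat{C_w}$, where a $k \times n$ matrix without zero columns is sent to the $n$-tuple of lines spanned by its columns. *)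

theory Defs
  imports
    "Jordan_Normal_Form.VS_Connect"
    "HOL-Analysis.Abstract_Topology"
    "HOL-Library.Poly_Mapping"
begin

text \<open>
  Rows, columns, letters and positions are numbered from 0, as usual for vectors, matrices and
  lists: the alphabet \<open>[k]\<close> is \<open>{..<k}\<close>, and the \<open>j\<close>-th entry of an \<open>n\<close>-tuple has \<open>j < n\<close>.
\<close>


section \<open>Polynomials\<close>

type_synonym 'v cpoly = "('v \<Rightarrow>\<^sub>0 nat) \<Rightarrow>\<^sub>0 complex"

definition poly_eval :: "'v cpoly \<Rightarrow> ('v \<Rightarrow> complex) \<Rightarrow> complex" where
  "poly_eval p x =
     (\<Sum>m\<in>Poly_Mapping.keys p. Poly_Mapping.lookup p m *
        (\<Prod>v\<in>Poly_Mapping.keys m. x v ^ Poly_Mapping.lookup m v))"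

definition poly_vars :: "'v cpoly \<Rightarrow> 'v set" where
  "poly_vars p = (\<Union>m\<in>Poly_Mapping.keys p. Poly_Mapping.keys m)"

text \<open>The variable \<open>(i, j)\<close> is the \<open>i\<close>-th homogeneous coordinate on the \<open>j\<close>-th factor.\<close>

definition multihomogeneous :: "nat \<Rightarrow> nat \<Rightarrow> (nat \<Rightarrow> nat) \<Rightarrow> (nat \<times> nat) cpoly \<Rightarrow> bool" where
  "multihomogeneous k n d p \<longleftrightarrow> poly_vars p \<subseteq> {..<k} \<times> {..<n} \<and>
     (\<forall>m\<in>Poly_Mapping.keys p. \<forall>j<n. (\<Sum>i<k. Poly_Mapping.lookup m (i, j)) = d j)"

definition monom_eval :: "('v \<Rightarrow>\<^sub>0 nat) \<Rightarrow> ('v \<Rightarrow> complex) \<Rightarrow> complex" where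
  "monom_eval m x = (\<Prod>v\<in>Poly_Mapping.keys m. x v ^ Poly_Mapping.lookup m v)"

lemma monom_eval_superset:
  assumes "finite A" "Poly_Mapping.keys m \<subseteq> A"
  shows "monom_eval m x = (\<Prod>v\<in>A. x v ^ Poly_Mapping.lookup m v)"
  unfolding monom_eval_def
  by (rule prod.mono_neutral_left) (use assms in \<open>auto simp: in_keys_iff\<close>)

lemma monom_eval_add: "monom_eval (a + b) x = monom_eval a x * monom_eval b x"
proof -
  let ?A = "Poly_Mapping.keys a \<union> Poly_Mapping.keys b"
  have "Poly_Mapping.keys (a + b) \<subseteq> ?A" by (rule Poly_Mapping.keys_add)
  then show ?thesis
    by (simp add: monom_eval_superset[of ?A] lookup_add power_add prod.distrib)
qed

lemma poly_eval_monom: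
  "poly_eval p x = (\<Sum>m\<in>Poly_Mapping.keys p. Poly_Mapping.lookup p m * monom_eval m x)"
  by (simp add: poly_eval_def monom_eval_def)

lemma poly_eval_add: "poly_eval (p + q) x = poly_eval p x + poly_eval q x"
  unfolding poly_eval_monom by (rule setsum_keys_plus_distrib) (auto simp: algebra_simps)

lemma poly_eval_zero: "poly_eval 0 x = 0"
  by (simp add: poly_eval_def)

lemma poly_eval_sum: "poly_eval (\<Sum>i\<in>I. f i) x = (\<Sum>i\<in>I. poly_eval (f i) x)"
  by (induction I rule: infinite_finite_induct) (auto simp: poly_eval_add poly_eval_zero)

lemma poly_eval_single: "poly_eval (Poly_Mapping.single m c) x = c * monom_eval m x"
  by (simp add: poly_eval_monom)

lemma poly_sum_singles:
  "p = (\<Sum>m\<in>Poly_Mapping.keys p. Poly_Mapping.single m (Poly_Mapping.lookup p m))"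
  by (rule poly_mapping_eqI)
     (auto simp: lookup_sum lookup_single when_def sum.delta in_keys_iff)

lemma poly_eval_mult: "poly_eval (p * q) x = poly_eval p x * poly_eval q x"
proof -
  let ?s = "\<lambda>p m. Poly_Mapping.single m (Poly_Mapping.lookup p m)"
  have "p * q = (\<Sum>a\<in>Poly_Mapping.keys p. \<Sum>b\<in>Poly_Mapping.keys q. ?s p a * ?s q b)"
    by (subst (1) poly_sum_singles[of p], subst (1) poly_sum_singles[of q])
       (simp add: sum_product)
  then have "poly_eval (p * q) x = (\<Sum>a\<in>Poly_Mapping.keys p. \<Sum>b\<in>Poly_Mapping.keys q.
      (Poly_Mapping.lookup p a * monom_eval a x) * (Poly_Mapping.lookup q b * monom_eval b x))"
    by (simp add: poly_eval_sum mult_single poly_eval_single monom_eval_add mult_ac)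
  then show ?thesis by (simp add: poly_eval_monom sum_product)
qed

lemma poly_vars_mult: "poly_vars (p * q) \<subseteq> poly_vars p \<union> poly_vars q"
proof
  fix v assume "v \<in> poly_vars (p * q)"
  then obtain m where "m \<in> Poly_Mapping.keys (p * q)" "v \<in> Poly_Mapping.keys m"
    by (auto simp: poly_vars_def)
  moreover then obtain a b where "m = a + b" "a \<in> Poly_Mapping.keys p" "b \<in> Poly_Mapping.keys q"
    using keys_mult[of p q] by blast
  ultimately show "v \<in> poly_vars p \<union> poly_vars q"
    using Poly_Mapping.keys_add[of a b] by (auto simp: poly_vars_def)
qed

lemma multihomogeneous_mult:
  assumes "multihomogeneous k n d p" "multihomogeneous k n e q"
  shows "multihomogeneous k n (\<lambda>j. d j + e j) (p * q)"
  unfolding multihomogeneous_def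
proof (intro conjI ballI allI impI)
  show "poly_vars (p * q) \<subseteq> {..<k} \<times> {..<n}"
    using poly_vars_mult[of p q] assms by (auto simp: multihomogeneous_def)
next
  fix m j assume m: "m \<in> Poly_Mapping.keys (p * q)" and j: "j < n"
  then obtain a b where "m = a + b" "a \<in> Poly_Mapping.keys p" "b \<in> Poly_Mapping.keys q"
    using keys_mult[of p q] by blast
  then show "(\<Sum>i<k. Poly_Mapping.lookup m (i, j)) = d j + e j"
    using assms j by (simp add: multihomogeneous_def lookup_add sum.distrib)
qed

lemma multihomogeneous_scale:
  assumes "multihomogeneous k n d p"
    and y: "\<And>i j. i < k \<Longrightarrow> j < n \<Longrightarrow> y (i, j) = c j * x (i, j)"
  shows "poly_eval p y = (\<Prod>j<n. c j ^ d j) * poly_eval p x"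
proof -
  let ?A = "{..<k} \<times> {..<n}"
  have "monom_eval m y = (\<Prod>j<n. c j ^ d j) * monom_eval m x" if m: "m \<in> Poly_Mapping.keys p" for m
  proof -
    have sub: "Poly_Mapping.keys m \<subseteq> ?A" and deg: "\<And>j. j < n \<Longrightarrow> (\<Sum>i<k. Poly_Mapping.lookup m (i, j)) = d j"
      using assms(1) m by (auto simp: multihomogeneous_def poly_vars_def)
    have "monom_eval m y = (\<Prod>v\<in>?A. y v ^ Poly_Mapping.lookup m v)"
      using sub by (intro monom_eval_superset) auto
    also have "\<dots> = (\<Prod>v\<in>?A. c (snd v) ^ Poly_Mapping.lookup m v * x v ^ Poly_Mapping.lookup m v)"
      by (intro prod.cong refl) (auto simp: y power_mult_distrib)
    also have "\<dots> = (\<Prod>v\<in>?A. c (snd v) ^ Poly_Mapping.lookup m v) * monom_eval m x"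
      using sub by (simp add: prod.distrib monom_eval_superset[of ?A])
    also have "(\<Prod>v\<in>?A. c (snd v) ^ Poly_Mapping.lookup m v) =
        (\<Prod>i<k. \<Prod>j<n. c j ^ Poly_Mapping.lookup m (i, j))"
      by (subst prod.cartesian_product) (auto intro: prod.cong)
    also have "\<dots> = (\<Prod>j<n. c j ^ (\<Sum>i<k. Poly_Mapping.lookup m (i, j)))"
      by (subst prod.swap) (simp add: power_sum)
    also have "\<dots> = (\<Prod>j<n. c j ^ d j)" by (simp add: deg)
    finally show ?thesis .
  qed
  then show ?thesis by (simp add: poly_eval_monom sum_distrib_left mult_ac)
qed

lemma one_poly: "poly_vars 1 = {}" "poly_eval 1 x = 1" "multihomogeneous k n (\<lambda>_. 0) 1"
  by (auto simp: poly_vars_def poly_eval_def multihomogeneous_def)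


section \<open>Varieties as spaces with functions\<close>

text \<open>
  A variety is given by its Zariski topology and, for each open set, the regular functions on it.
  Only the values on \<open>U\<close> of a member of \<open>regular X U\<close> matter.
\<close>

record 'a variety =
  zariski :: "'a topology"
  regular :: "'a set \<Rightarrow> ('a \<Rightarrow> complex) set"

definition morphism :: "'a variety \<Rightarrow> 'b variety \<Rightarrow> ('a \<Rightarrow> 'b) \<Rightarrow> bool" where
  "morphism X Y \<phi> \<longleftrightarrow> continuous_map (zariski X) (zariski Y) \<phi> \<and>
     (\<forall>V f. openin (zariski Y) V \<longrightarrow> f \<in> regular Y V \<longrightarrow>
        f \<circ> \<phi> \<in> regular X {x \<in> topspace (zariski X). \<phi> x \<in> V})"

definition isomorphic :: "'a variety \<Rightarrow> 'b variety \<Rightarrow> bool" where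
  "isomorphic X Y \<longleftrightarrow> (\<exists>\<phi> \<psi>. morphism X Y \<phi> \<and> morphism Y X \<psi> \<and>
     (\<forall>x\<in>topspace (zariski X). \<psi> (\<phi> x) = x) \<and> (\<forall>y\<in>topspace (zariski Y). \<phi> (\<psi> y) = y))"

text \<open>The induced (reduced) structure on a locally closed subset \<open>Z\<close>.\<close>

definition subvariety :: "'a variety \<Rightarrow> 'a set \<Rightarrow> 'a variety" where
  "subvariety X Z = \<lparr>
     zariski = subtopology (zariski X) Z,
     regular = (\<lambda>U. {f. \<forall>p\<in>U. \<exists>W g. openin (zariski X) W \<and> p \<in> W \<inter> Z \<and> W \<inter> Z \<subseteq> U \<and>
                           g \<in> regular X W \<and> (\<forall>q\<in>W \<inter> Z. f q = g q)})\<rparr>"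

definition affine_zeros :: "nat \<Rightarrow> nat cpoly set \<Rightarrow> complex vec set" where
  "affine_zeros m S = {x \<in> carrier_vec m. \<forall>p\<in>S. poly_eval p (\<lambda>i. x $ i) = 0}"

definition affine_topology :: "nat \<Rightarrow> complex vec topology" where
  "affine_topology m = topology (\<lambda>U. U \<subseteq> carrier_vec m \<and>
     (\<exists>S. (\<forall>p\<in>S. poly_vars p \<subseteq> {..<m}) \<and> carrier_vec m - U = affine_zeros m S))"

lemma istopology_zero_loci:
  assumes mult: "\<And>p q. p \<in> R \<Longrightarrow> q \<in> R \<Longrightarrow>
      \<exists>pq\<in>R. \<forall>x\<in>X. van pq x \<longleftrightarrow> van p x \<or> van q x"
  shows "istopology (\<lambda>U. U \<subseteq> X \<and> (\<exists>S\<subseteq>R. X - U = {x \<in> X. \<forall>p\<in>S. van p x}))"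
  unfolding istopology_def
proof (intro conjI allI impI)
  fix U V
  assume U: "U \<subseteq> X \<and> (\<exists>S\<subseteq>R. X - U = {x \<in> X. \<forall>p\<in>S. van p x})"
    and V: "V \<subseteq> X \<and> (\<exists>S\<subseteq>R. X - V = {x \<in> X. \<forall>p\<in>S. van p x})"
  obtain S T where S: "S \<subseteq> R" "X - U = {x \<in> X. \<forall>p\<in>S. van p x}"
    and T: "T \<subseteq> R" "X - V = {x \<in> X. \<forall>p\<in>T. van p x}" using U V by blast
  obtain m where m: "\<And>p q. p \<in> R \<Longrightarrow> q \<in> R \<Longrightarrow> m p q \<in> R"
    "\<And>p q x. p \<in> R \<Longrightarrow> q \<in> R \<Longrightarrow> x \<in> X \<Longrightarrow> van (m p q) x \<longleftrightarrow> van p x \<or> van q x"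
    using mult by metis
  let ?M = "{m p q | p q. p \<in> S \<and> q \<in> T}"
  show "U \<inter> V \<subseteq> X" using U by blast
  have "(\<forall>p\<in>?M. van p x) \<longleftrightarrow> (\<forall>p\<in>S. van p x) \<or> (\<forall>q\<in>T. van q x)" if "x \<in> X" for x
  proof -
    have "(\<forall>p\<in>?M. van p x) \<longleftrightarrow> (\<forall>p\<in>S. \<forall>q\<in>T. van (m p q) x)" by blast
    also have "\<dots> \<longleftrightarrow> (\<forall>p\<in>S. \<forall>q\<in>T. van p x \<or> van q x)"
      using m(2) that S(1) T(1) by (meson subsetD)
    finally show ?thesis by blast
  qed
  then have "{x \<in> X. \<forall>p\<in>?M. van p x} = (X - U) \<union> (X - V)"
    unfolding S(2) T(2) by (simp add: Collect_disj_eq[symmetric] cong: conj_cong) blast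
  then have "X - U \<inter> V = {x \<in> X. \<forall>p\<in>?M. van p x}" by blast
  moreover have "?M \<subseteq> R" using m(1) S(1) T(1) by blast
  ultimately show "\<exists>S\<subseteq>R. X - U \<inter> V = {x \<in> X. \<forall>p\<in>S. van p x}" by blast
next
  fix K assume "\<forall>U\<in>K. U \<subseteq> X \<and> (\<exists>S\<subseteq>R. X - U = {x \<in> X. \<forall>p\<in>S. van p x})"
  then have sub: "\<And>U. U \<in> K \<Longrightarrow> U \<subseteq> X"
    and ex: "\<forall>U\<in>K. \<exists>S\<subseteq>R. X - U = {x \<in> X. \<forall>p\<in>S. van p x}" by auto
  show "\<Union>K \<subseteq> X" using sub by blast
  obtain S where "\<forall>U\<in>K. S U \<subseteq> R \<and> X - U = {x \<in> X. \<forall>p\<in>S U. van p x}"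
    using bchoice[OF ex] by blast
  then have S: "\<And>U. U \<in> K \<Longrightarrow> S U \<subseteq> R"
    "\<And>U. U \<in> K \<Longrightarrow> X - U = {x \<in> X. \<forall>p\<in>S U. van p x}" by simp_all
  have "X - \<Union>K = {x \<in> X. \<forall>U\<in>K. x \<in> X - U}" by blast
  also have "\<dots> = {x \<in> X. \<forall>U\<in>K. \<forall>p\<in>S U. van p x}" using S(2) by auto
  also have "\<dots> = {x \<in> X. \<forall>p\<in>\<Union>(S ` K). van p x}" by simp
  finally have "X - \<Union>K = {x \<in> X. \<forall>p\<in>\<Union>(S ` K). van p x}" .
  moreover have "\<Union>(S ` K) \<subseteq> R" using S(1) by blast
  ultimately show "\<exists>S\<subseteq>R. X - \<Union>K = {x \<in> X. \<forall>p\<in>S. van p x}" by blast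
qed

lemma openin_affine_topology:
  "openin (affine_topology m) U \<longleftrightarrow> U \<subseteq> carrier_vec m \<and>
     (\<exists>S. (\<forall>p\<in>S. poly_vars p \<subseteq> {..<m}) \<and> carrier_vec m - U = affine_zeros m S)"
proof -
  let ?R = "{p. poly_vars p \<subseteq> {..<m}}"
  let ?van = "\<lambda>p x. poly_eval p (\<lambda>i. x $ i) = 0"
  have "\<exists>pq\<in>?R. \<forall>x\<in>carrier_vec m. ?van pq x \<longleftrightarrow> ?van p x \<or> ?van q x"
    if "p \<in> ?R" "q \<in> ?R" for p q
  proof (intro bexI[of _ "p * q"])
    show "p * q \<in> ?R" using that poly_vars_mult[of p q] by blast
  qed (simp add: poly_eval_mult)
  from istopology_zero_loci[OF this] show ?thesis
    by (simp add: affine_topology_def affine_zeros_def subset_eq)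
qed

lemma topspace_affine_topology: "topspace (affine_topology m) = carrier_vec m"
proof (rule antisym)
  show "topspace (affine_topology m) \<subseteq> carrier_vec m"
    by (metis openin_affine_topology openin_topspace)
  have "openin (affine_topology m) (carrier_vec m)"
    unfolding openin_affine_topology
    by (auto intro!: exI[of _ "{1}"] simp: one_poly affine_zeros_def)
  then show "carrier_vec m \<subseteq> topspace (affine_topology m)" by (rule openin_subset)
qed

definition affine_space :: "nat \<Rightarrow> complex vec variety" where
  "affine_space m = \<lparr>
     zariski = affine_topology m,
     regular = (\<lambda>U. {f. \<forall>p\<in>U. \<exists>W g h. openin (affine_topology m) W \<and> p \<in> W \<and> W \<subseteq> U \<and>
                           poly_vars g \<subseteq> {..<m} \<and> poly_vars h \<subseteq> {..<m} \<and>
                           (\<forall>q\<in>W. poly_eval h (\<lambda>i. q $ i) \<noteq> 0 \<and>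
                              f q = poly_eval g (\<lambda>i. q $ i) / poly_eval h (\<lambda>i. q $ i))})\<rparr>"

text \<open>The ordered partition is the list \<open>Cs\<close>; its parts are nonempty, being affine spaces.\<close>

definition affine_paving :: "'a variety \<Rightarrow> 'a set list \<Rightarrow> bool" where
  "affine_paving X Cs \<longleftrightarrow>
     \<Union> (set Cs) = topspace (zariski X) \<and>
     (\<forall>i<length Cs. \<forall>j<length Cs. i \<noteq> j \<longrightarrow> Cs ! i \<inter> Cs ! j = {}) \<and>
     (\<forall>i<length Cs. closedin (zariski X) (\<Union>j\<le>i. Cs ! j)) \<and>
     (\<forall>i<length Cs. \<exists>m. isomorphic (subvariety X (Cs ! i)) (affine_space m))"

text \<open>For an indexed family: distinct indices give distinct, indeed disjoint, cells.\<close>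

definition induces_affine_paving :: "'a variety \<Rightarrow> 'i set \<Rightarrow> ('i \<Rightarrow> 'a set) \<Rightarrow> bool" where
  "induces_affine_paving X I C \<longleftrightarrow>
     (\<exists>is. distinct is \<and> set is = I \<and> affine_paving X (map C is))"


section \<open>Products of projective spaces\<close>

abbreviation cspan :: "nat \<Rightarrow> complex vec set \<Rightarrow> complex vec set" where
  "cspan k \<equiv> LinearCombinations.module.span class_ring (module_vec TYPE(complex) k)"

abbreviation cdim :: "nat \<Rightarrow> complex vec set \<Rightarrow> nat" where
  "cdim k W \<equiv> vectorspace.dim class_ring ((module_vec TYPE(complex) k)\<lparr>carrier := W\<rparr>)"

definition proj_space :: "nat \<Rightarrow> complex vec set set" where
  "proj_space k = {cspan k {v} | v. v \<in> carrier_vec k \<and> v \<noteq> 0\<^sub>v k}"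

definition mproj_points :: "nat \<Rightarrow> nat \<Rightarrow> (nat \<Rightarrow> complex vec set) set" where
  "mproj_points k n = (\<Pi>\<^sub>E j\<in>{..<n}. proj_space k)"

definition lines_of :: "nat \<Rightarrow> nat \<Rightarrow> complex mat \<Rightarrow> (nat \<Rightarrow> complex vec set)" where
  "lines_of k n A = (\<lambda>j\<in>{..<n}. cspan k {col A j})"

text \<open>The columns of \<open>A \<in> coords k n P\<close> are homogeneous coordinates for the entries of \<open>P\<close>.\<close>

definition coords :: "nat \<Rightarrow> nat \<Rightarrow> (nat \<Rightarrow> complex vec set) \<Rightarrow> complex mat set" where
  "coords k n P = {A \<in> carrier_mat k n. (\<forall>j<n. col A j \<noteq> 0\<^sub>v k) \<and> lines_of k n A = P}"

definition mproj_zeros ::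
    "nat \<Rightarrow> nat \<Rightarrow> (nat \<times> nat) cpoly set \<Rightarrow> (nat \<Rightarrow> complex vec set) set" where
  "mproj_zeros k n S =
     {P \<in> mproj_points k n. \<forall>p\<in>S. \<forall>A\<in>coords k n P. poly_eval p (\<lambda>ij. A $$ ij) = 0}"

lemma cspan_singletonD:
  assumes "v \<in> carrier_vec k" "x \<in> cspan k {v}"
  shows "\<exists>c. x = c \<cdot>\<^sub>v v"
proof -
  interpret V: vec_space "TYPE(complex)" k .
  obtain a A where x: "x = V.lincomb a A" and A: "A \<subseteq> {v}"
    using V.in_spanE[OF assms(2)] by blast
  consider "A = {}" | "A = {v}" using A by blast
  then show ?thesis
  proof cases
    case 1
    then have "x = 0 \<cdot>\<^sub>v v" using x assms(1) by (auto simp: V.lincomb_def)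
    then show ?thesis ..
  next
    case 2
    then have "x = a v \<cdot>\<^sub>v v" using x assms(1) by (auto simp: V.lincomb_def)
    then show ?thesis ..
  qed
qed

text \<open>Vanishing and quotients do not depend on the choice of homogeneous coordinates.\<close>

lemma coords_scale:
  assumes A: "A \<in> coords k n P" and B: "B \<in> coords k n P"
  obtains c where "\<And>j. j < n \<Longrightarrow> c j \<noteq> 0" "\<And>i j. i < k \<Longrightarrow> j < n \<Longrightarrow> B $$ (i, j) = c j * A $$ (i, j)"
proof -
  interpret V: vec_space "TYPE(complex)" k .
  have "\<exists>c. c \<noteq> 0 \<and> col B j = c \<cdot>\<^sub>v col A j" if j: "j < n" for j
  proof -
    have carr: "col A j \<in> carrier_vec k" "col B j \<in> carrier_vec k"
      using A B by (auto simp: coords_def)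
    have "lines_of k n A j = lines_of k n B j" using A B by (simp add: coords_def)
    then have "cspan k {col A j} = cspan k {col B j}" using j by (simp add: lines_of_def)
    moreover have "col B j \<in> cspan k {col B j}"
      by (rule subsetD[OF V.in_own_span]) (use carr in auto)
    ultimately obtain c where c: "col B j = c \<cdot>\<^sub>v col A j"
      using cspan_singletonD[OF carr(1)] by metis
    moreover have "c \<noteq> 0"
    proof
      assume "c = 0"
      then have "col B j = 0\<^sub>v k" using c carr by auto
      then show False using B j by (auto simp: coords_def)
    qed
    ultimately show ?thesis by blast
  qed
  then obtain c where c: "\<And>j. j < n \<Longrightarrow> c j \<noteq> 0 \<and> col B j = c j \<cdot>\<^sub>v col A j" by metis
  show ?thesis
  proof (rule that)
    show "c j \<noteq> 0" if "j < n" for j using c that by blast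
    show "B $$ (i, j) = c j * A $$ (i, j)" if "i < k" "j < n" for i j
    proof -
      have "col B j $ i = (c j \<cdot>\<^sub>v col A j) $ i" using c that by simp
      then show ?thesis using A B that by (auto simp: coords_def)
    qed
  qed
qed

lemma multihomogeneous_zero_iff:
  assumes "multihomogeneous k n d p" "A \<in> coords k n P" "B \<in> coords k n P"
  shows "poly_eval p (\<lambda>ij. A $$ ij) = 0 \<longleftrightarrow> poly_eval p (\<lambda>ij. B $$ ij) = 0"
proof -
  obtain c where c: "\<And>j. j < n \<Longrightarrow> c j \<noteq> 0"
    and B: "\<And>i j. i < k \<Longrightarrow> j < n \<Longrightarrow> B $$ (i, j) = c j * A $$ (i, j)"
    using coords_scale[OF assms(2,3)] by metis
  have "poly_eval p (\<lambda>ij. B $$ ij) = (\<Prod>j<n. c j ^ d j) * poly_eval p (\<lambda>ij. A $$ ij)"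
    by (rule multihomogeneous_scale[OF assms(1)]) (rule B)
  moreover have "(\<Prod>j<n. c j ^ d j) \<noteq> 0" using c by (simp add: prod_zero_iff)
  ultimately show ?thesis by (simp del: prod_zero_iff)
qed

definition mproj_topology :: "nat \<Rightarrow> nat \<Rightarrow> (nat \<Rightarrow> complex vec set) topology" where
  "mproj_topology k n = topology (\<lambda>U. U \<subseteq> mproj_points k n \<and>
     (\<exists>S. (\<forall>p\<in>S. \<exists>d. multihomogeneous k n d p) \<and>
          mproj_points k n - U = mproj_zeros k n S))"

lemma openin_mproj_topology:
  "openin (mproj_topology k n) U \<longleftrightarrow> U \<subseteq> mproj_points k n \<and>
     (\<exists>S. (\<forall>p\<in>S. \<exists>d. multihomogeneous k n d p) \<and>
          mproj_points k n - U = mproj_zeros k n S)"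
proof -
  let ?R = "{p. \<exists>d. multihomogeneous k n d p}"
  let ?van = "\<lambda>p P. \<forall>A\<in>coords k n P. poly_eval p (\<lambda>ij. A $$ ij) = 0"
  have "\<exists>pq\<in>?R. \<forall>P\<in>mproj_points k n. ?van pq P \<longleftrightarrow> ?van p P \<or> ?van q P"
    if "p \<in> ?R" "q \<in> ?R" for p q
  proof (intro bexI[of _ "p * q"] ballI)
    show "p * q \<in> ?R" using that multihomogeneous_mult by blast
    fix P
    show "?van (p * q) P \<longleftrightarrow> ?van p P \<or> ?van q P"
      using that by (auto simp: poly_eval_mult) (metis multihomogeneous_zero_iff)
  qed
  from istopology_zero_loci[OF this] show ?thesis
    by (simp add: mproj_topology_def mproj_zeros_def subset_eq)
qed

lemma coords_nonempty:
  assumes "P \<in> mproj_points k n"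
  shows "coords k n P \<noteq> {}"
proof -
  have "\<forall>j<n. \<exists>v. v \<in> carrier_vec k \<and> v \<noteq> 0\<^sub>v k \<and> P j = cspan k {v}"
    using assms by (force simp: mproj_points_def proj_space_def PiE_iff)
  then obtain v where v: "\<And>j. j < n \<Longrightarrow> v j \<in> carrier_vec k \<and> v j \<noteq> 0\<^sub>v k \<and> P j = cspan k {v j}"
    by metis
  define A where "A = mat_of_cols k (map v [0..<n])"
  have A: "A \<in> carrier_mat k n" by (simp add: A_def mat_of_cols_def)
  have colA: "col A j = v j" if "j < n" for j
    using v[OF that] that by (simp add: A_def)
  have "lines_of k n A = P"
  proof
    fix j show "lines_of k n A j = P j"
      using assms v colA by (cases "j < n") (auto simp: lines_of_def mproj_points_def PiE_def extensional_def)
  qed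
  then have "A \<in> coords k n P" using A colA v by (simp add: coords_def)
  then show ?thesis by blast
qed

lemma topspace_mproj_topology: "topspace (mproj_topology k n) = mproj_points k n"
proof (rule antisym)
  show "topspace (mproj_topology k n) \<subseteq> mproj_points k n"
    by (metis openin_mproj_topology openin_topspace)
  have "openin (mproj_topology k n) (mproj_points k n)"
    unfolding openin_mproj_topology
    using coords_nonempty[of _ k n]
    by (auto intro!: exI[of _ "{1}"] exI[of _ "\<lambda>_. 0"] simp: one_poly mproj_zeros_def ex_in_conv)
  then show "mproj_points k n \<subseteq> topspace (mproj_topology k n)" by (rule openin_subset)
qed

definition mproj :: "nat \<Rightarrow> nat \<Rightarrow> (nat \<Rightarrow> complex vec set) variety" where
  "mproj k n = \<lparr>
     zariski = mproj_topology k n,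
     regular = (\<lambda>U. {f. \<forall>P\<in>U. \<exists>W d g h. openin (mproj_topology k n) W \<and> P \<in> W \<and> W \<subseteq> U \<and>
                           multihomogeneous k n d g \<and> multihomogeneous k n d h \<and>
                           (\<forall>Q\<in>W. \<forall>A\<in>coords k n Q. poly_eval h (\<lambda>ij. A $$ ij) \<noteq> 0 \<and>
                              f Q = poly_eval g (\<lambda>ij. A $$ ij) / poly_eval h (\<lambda>ij. A $$ ij))})\<rparr>"

text \<open>A sum of lines is the span of their union.\<close>

definition X_points :: "nat \<Rightarrow> nat \<Rightarrow> nat \<Rightarrow> (nat \<Rightarrow> complex vec set) set" where
  "X_points n k r = {P \<in> mproj_points k n.
     cspan k (\<Union>j<n. P j) = carrier_vec k \<and> cdim k (cspan k (\<Union>j<r. P j)) = r}"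

definition X_variety :: "nat \<Rightarrow> nat \<Rightarrow> nat \<Rightarrow> (nat \<Rightarrow> complex vec set) variety" where
  "X_variety n k r = subvariety (mproj k n) (X_points n k r)"

lemma X_points_subset: "X_points n k r \<subseteq> mproj_points k n"
  by (auto simp: X_points_def)

lemma topspace_X_variety: "topspace (zariski (X_variety n k r)) = X_points n k r"
  using X_points_subset by (auto simp: X_variety_def subvariety_def mproj_def topspace_mproj_topology)


section \<open>Words and cells\<close>

definition words :: "nat \<Rightarrow> nat \<Rightarrow> nat \<Rightarrow> nat list set" where
  "words n k r = {w. length w = n \<and> set w = {..<k} \<and> distinct (take r w)}"

definition initial_indices :: "nat list \<Rightarrow> nat set" where
  "initial_indices w = {j. j < length w \<and> w ! j \<notin> set (take j w)}"

definition first_index :: "nat list \<Rightarrow> nat \<Rightarrow> nat" where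
  "first_index w a = (LEAST j. j < length w \<and> w ! j = a)"

datatype pattern_symbol = Zero_Symbol | One_Symbol | Star_Symbol

definition pattern_entry :: "nat list \<Rightarrow> nat \<Rightarrow> nat \<Rightarrow> pattern_symbol" where
  "pattern_entry w i j =
     (if w ! j = i then One_Symbol
      else if i \<notin> set w then Zero_Symbol
      else if j \<in> initial_indices w then
        (if i < w ! j \<and> (\<exists>j'<j. w ! j' = i) then Star_Symbol else Zero_Symbol)
      else
        (if first_index w i < first_index w (w ! j) then Star_Symbol else Zero_Symbol))"

definition PM :: "nat \<Rightarrow> nat list \<Rightarrow> pattern_symbol mat" where
  "PM k w = mat k (length w) (\<lambda>(i, j). pattern_entry w i j)"

text \<open>\<open>PM(242141)\<close> for \<open>k = 4\<close>, in 0-based letters.\<close>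

lemma pattern_entry_example:
  "map (\<lambda>i. map (pattern_entry [1, 3, 1, 0, 3, 0] i) [0..<6]) [0..<4] =
    (let o' = Zero_Symbol; I = One_Symbol; S = Star_Symbol in
     [[o', o', o', I, o', I],
      [I, S, I, o', S, S],
      [o', o', o', o', o', o'],
      [o', I, o', o', I, S]])"
proof -
  let ?w = "[1, 3, 1, 0, 3, 0::nat]"
  have *: "initial_indices ?w = {0, 1, 3}"
    by (auto simp: initial_indices_def less_Suc_eq numeral_eq_Suc)
  have **: "first_index ?w 0 = 3" "first_index ?w 1 = 0" "first_index ?w 3 = 1" 
    unfolding first_index_def
    by (rule Least_equality; auto simp: numeral_eq_Suc less_Suc_eq nth_Cons' split: if_splits)+
  show ?thesis using ** unfolding pattern_entry_def *
    by (simp add: upt_rec Let_def numeral_eq_Suc less_Suc_eq ex_disj_distrib)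
qed

fun matches :: "pattern_symbol \<Rightarrow> complex \<Rightarrow> bool" where
  "matches Zero_Symbol c \<longleftrightarrow> c = 0"
| "matches One_Symbol c \<longleftrightarrow> c = 1"
| "matches Star_Symbol c \<longleftrightarrow> True"

definition C_hat :: "nat \<Rightarrow> nat list \<Rightarrow> complex mat set" where
  "C_hat k w = {A \<in> carrier_mat k (length w).
     \<forall>i<k. \<forall>j<length w. matches (PM k w $$ (i, j)) (A $$ (i, j))}"

definition lower_unitriangular :: "nat \<Rightarrow> complex mat set" where
  "lower_unitriangular k = {A \<in> carrier_mat k k.
     (\<forall>i<k. A $$ (i, i) = 1) \<and> (\<forall>i<k. \<forall>j<k. i < j \<longrightarrow> A $$ (i, j) = 0)}"

definition cell :: "nat \<Rightarrow> nat list \<Rightarrow> (nat \<Rightarrow> complex vec set) set" where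
  "cell k w = {lines_of k (length w) (u * A) | u A. u \<in> lower_unitriangular k \<and> A \<in> C_hat k w}"

end

theory Submission
  imports Defs "Jordan_Normal_Form.DL_Rank"
begin

text \<open>
  A point of the cell of \<open>w\<close> has homogeneous coordinates \<open>M = L A D\<close> with \<open>L\<close> lower unitriangular,
  \<open>A\<close> matching the pattern of \<open>w\<close> and \<open>D\<close> an invertible diagonal matrix. The initial columns form the
  greedy basis of the column space from the left, and on them the factorization is an LDU decomposition
  in permuted form. Solving it recursively expresses the entries of \<open>L\<close> and \<open>A\<close> as quotients of
  multihomogeneous polynomials of equal multidegree in \<open>M\<close>, so the free entries of \<open>L\<close> and \<open>A\<close> are
  affine coordinates on the cell. Eliminating column by column shows that the cells of all words cover
  all tuples of lines; the spanning and independence conditions are read off the letters of the word.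

  For the order, each of the following is determined by the word, grows with it only if some minor
  becomes nonzero, and together they determine the word: the ranks of the initial sets of columns and,
  once these agree, the position of the first occurrence of each letter \<open>w ! j\<close> and the ranks of the
  upper left corners. Ordering the words by the sum of the first kind of ranks, then by the sum of the
  other numbers, gives for \<open>w\<close> before \<open>w'\<close> a minor that vanishes on the cell of \<open>w\<close> and nowhere on the
  cell of \<open>w'\<close>. This yields disjointness and closedness at once.
\<close>

section \<open>Polynomial functions\<close>

text \<open>The corner ranks that order Schubert cells see only the sets of letters in the prefixes
  of a word. They cannot separate words that differ in repeated letters, such as 121 and 122, so the
  first occurrence of each \<open>w ! j\<close> is compared as well. The proof that the minor for
  this comparison vanishes on the earlier cell uses that the initial sets of columns have equal
  ranks in both cells; hence the two levels of the order. Points of a cell carry no preferred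
  matrix: homogeneous coordinates are fixed only up to a nonzero scalar per column. A formula for a
  point therefore has to be a quotient of multidegree 0. In \<open>M = L A D\<close> the entries of
  \<open>L\<close> have degree 0, while those of \<open>A D\<close> have degree 1 in their column;
  the recursion is run for \<open>L\<close> and \<open>A D\<close>, and \<open>D\<close> is divided
  out at the end. Uniqueness of the factors is not proved separately: the quotient formulas read the
  free entries off \<open>M\<close>, which makes the parametrization injective.\<close>

lemma poly_vars_add: "poly_vars (p + q) \<subseteq> poly_vars p \<union> poly_vars q"
  using Poly_Mapping.keys_add[of p q] by (auto simp: poly_vars_def)

text \<open>Stated for functions, not polynomials, so that closure under sums, products and
  substitution composes without naming the polynomials. \<open>mhom\<close> serves the same end for
  functions of a matrix.\<close>

definition polyfun :: "nat \<Rightarrow> (complex vec \<Rightarrow> complex) \<Rightarrow> bool" where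
  "polyfun m f \<longleftrightarrow>
     (\<exists>p. poly_vars p \<subseteq> {..<m} \<and> (\<forall>x\<in>carrier_vec m. f x = poly_eval p (\<lambda>i. x $ i)))"

lemma polyfunE:
  assumes "polyfun m f"
  obtains p where "poly_vars p \<subseteq> {..<m}" "\<And>x. x \<in> carrier_vec m \<Longrightarrow> f x = poly_eval p (\<lambda>i. x $ i)"
  using assms by (auto simp: polyfun_def)

lemma polyfun_const: "polyfun m (\<lambda>_. c)"
  unfolding polyfun_def
  by (rule exI[of _ "Poly_Mapping.single 0 c"]) (auto simp: poly_vars_def poly_eval_single monom_eval_def)

lemma polyfun_coord:
  assumes "i < m"
  shows "polyfun m (\<lambda>x. x $ i)"
  unfolding polyfun_def using assms
  by (intro exI[of _ "Poly_Mapping.single (Poly_Mapping.single i 1) 1"])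
     (auto simp: poly_vars_def poly_eval_single monom_eval_def)

lemma polyfun_add:
  assumes "polyfun m f" "polyfun m g"
  shows "polyfun m (\<lambda>x. f x + g x)"
proof -
  obtain p q where "poly_vars p \<subseteq> {..<m}" "\<And>x. x \<in> carrier_vec m \<Longrightarrow> f x = poly_eval p (\<lambda>i. x $ i)"
    "poly_vars q \<subseteq> {..<m}" "\<And>x. x \<in> carrier_vec m \<Longrightarrow> g x = poly_eval q (\<lambda>i. x $ i)"
    using assms by (metis polyfunE)
  then show ?thesis unfolding polyfun_def
    using poly_vars_add[of p q] by (intro exI[of _ "p + q"]) (auto simp: poly_eval_add)
qed

lemma polyfun_mult:
  assumes "polyfun m f" "polyfun m g"
  shows "polyfun m (\<lambda>x. f x * g x)"
proof -
  obtain p q where "poly_vars p \<subseteq> {..<m}" "\<And>x. x \<in> carrier_vec m \<Longrightarrow> f x = poly_eval p (\<lambda>i. x $ i)"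
    "poly_vars q \<subseteq> {..<m}" "\<And>x. x \<in> carrier_vec m \<Longrightarrow> g x = poly_eval q (\<lambda>i. x $ i)"
    using assms by (metis polyfunE)
  then show ?thesis unfolding polyfun_def
    using poly_vars_mult[of p q] by (intro exI[of _ "p * q"]) (auto simp: poly_eval_mult)
qed

lemma polyfun_sum:
  "(\<And>i. i \<in> I \<Longrightarrow> polyfun m (f i)) \<Longrightarrow> polyfun m (\<lambda>x. \<Sum>i\<in>I. f i x)"
  by (induction I rule: infinite_finite_induct) (auto intro: polyfun_const polyfun_add)

lemma polyfun_prod:
  "(\<And>i. i \<in> I \<Longrightarrow> polyfun m (f i)) \<Longrightarrow> polyfun m (\<lambda>x. \<Prod>i\<in>I. f i x)"
  by (induction I rule: infinite_finite_induct) (auto intro: polyfun_const polyfun_mult)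

lemma polyfun_power: "polyfun m f \<Longrightarrow> polyfun m (\<lambda>x. f x ^ e)"
  by (induction e) (auto intro: polyfun_const polyfun_mult)

lemma polyfun_poly_eval:
  assumes "\<And>v. v \<in> poly_vars p \<Longrightarrow> polyfun m (\<lambda>x. y x v)"
  shows "polyfun m (\<lambda>x. poly_eval p (y x))"
  unfolding poly_eval_def
  by (intro polyfun_sum polyfun_mult polyfun_prod polyfun_power polyfun_const assms)
     (auto simp: poly_vars_def)

lemma openin_affine_nonvanishing:
  assumes "\<And>f. f \<in> F \<Longrightarrow> polyfun m f"
  shows "openin (affine_topology m) {x \<in> carrier_vec m. \<exists>f\<in>F. f x \<noteq> 0}"
proof -
  have "\<forall>f\<in>F. \<exists>p. poly_vars p \<subseteq> {..<m} \<and> (\<forall>x\<in>carrier_vec m. f x = poly_eval p (\<lambda>i. x $ i))"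
    using assms by (auto simp: polyfun_def)
  then obtain p where p: "\<And>f. f \<in> F \<Longrightarrow> poly_vars (p f) \<subseteq> {..<m}"
    "\<And>f x. f \<in> F \<Longrightarrow> x \<in> carrier_vec m \<Longrightarrow> f x = poly_eval (p f) (\<lambda>i. x $ i)"
    by metis
  show ?thesis unfolding openin_affine_topology
    using p by (intro conjI exI[of _ "p ` F"]) (auto simp: affine_zeros_def)
qed

section \<open>Multihomogeneous functions of a matrix\<close>

definition mhom :: "nat \<Rightarrow> nat \<Rightarrow> (nat \<Rightarrow> nat) \<Rightarrow> (complex mat \<Rightarrow> complex) \<Rightarrow> bool" where
  "mhom k n d F \<longleftrightarrow> (\<exists>p. multihomogeneous k n d p \<and> (\<forall>A. F A = poly_eval p (\<lambda>ij. A $$ ij)))"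

lemma mhom_cong: "(\<And>j. j < n \<Longrightarrow> d j = d' j) \<Longrightarrow> mhom k n d F \<Longrightarrow> mhom k n d' F"
  by (auto simp: mhom_def multihomogeneous_def)

lemma mhom_zero: "mhom k n d (\<lambda>_. 0)"
  unfolding mhom_def
  by (rule exI[of _ 0]) (auto simp: multihomogeneous_def poly_vars_def poly_eval_zero)

lemma mhom_const: "mhom k n (\<lambda>_. 0) (\<lambda>_. c)"
  unfolding mhom_def
  by (rule exI[of _ "Poly_Mapping.single 0 c"])
     (auto simp: multihomogeneous_def poly_vars_def poly_eval_single monom_eval_def)

lemma mhom_entry:
  assumes "i < k" "j < n"
  shows "mhom k n (\<lambda>l. if l = j then 1 else 0) (\<lambda>A. A $$ (i, j))"
  unfolding mhom_def using assms
  by (intro exI[of _ "Poly_Mapping.single (Poly_Mapping.single (i, j) 1) 1"])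
     (auto simp: multihomogeneous_def poly_vars_def poly_eval_single monom_eval_def
        lookup_single when_def sum.delta)

lemma mhom_add:
  assumes "mhom k n d F" "mhom k n d G"
  shows "mhom k n d (\<lambda>A. F A + G A)"
proof -
  obtain p q where p: "multihomogeneous k n d p" "\<And>A. F A = poly_eval p (\<lambda>ij. A $$ ij)"
    and q: "multihomogeneous k n d q" "\<And>A. G A = poly_eval q (\<lambda>ij. A $$ ij)"
    using assms by (auto simp: mhom_def)
  have "multihomogeneous k n d (p + q)"
    unfolding multihomogeneous_def
  proof (intro conjI ballI allI impI)
    show "poly_vars (p + q) \<subseteq> {..<k} \<times> {..<n}"
      using poly_vars_add[of p q] p(1) q(1) by (auto simp: multihomogeneous_def)
  next
    fix m j assume "m \<in> Poly_Mapping.keys (p + q)" "j < n"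
    then show "(\<Sum>i<k. Poly_Mapping.lookup m (i, j)) = d j"
      using Poly_Mapping.keys_add[of p q] p(1) q(1) unfolding multihomogeneous_def by blast
  qed
  then show ?thesis unfolding mhom_def using p(2) q(2) by (auto simp: poly_eval_add)
qed

lemma mhom_mult:
  assumes "mhom k n d F" "mhom k n e G"
  shows "mhom k n (\<lambda>j. d j + e j) (\<lambda>A. F A * G A)"
proof -
  obtain p q where p: "multihomogeneous k n d p" "\<And>A. F A = poly_eval p (\<lambda>ij. A $$ ij)"
    and q: "multihomogeneous k n e q" "\<And>A. G A = poly_eval q (\<lambda>ij. A $$ ij)"
    using assms by (auto simp: mhom_def)
  show ?thesis unfolding mhom_def
    by (rule exI[of _ "p * q"]) (simp add: p q poly_eval_mult multihomogeneous_mult)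
qed

lemma mhom_sum:
  "(\<And>i. i \<in> I \<Longrightarrow> mhom k n d (F i)) \<Longrightarrow> mhom k n d (\<lambda>A. \<Sum>i\<in>I. F i A)"
  by (induction I rule: infinite_finite_induct) (auto intro: mhom_zero mhom_add)

lemma mhom_prod:
  assumes "finite I" "\<And>i. i \<in> I \<Longrightarrow> mhom k n (d i) (F i)"
  shows "mhom k n (\<lambda>j. \<Sum>i\<in>I. d i j) (\<lambda>A. \<Prod>i\<in>I. F i A)"
  using assms
proof (induction I rule: finite_induct)
  case empty
  show ?case using mhom_const[of k n 1] by simp
next
  case (insert i I)
  have "mhom k n (\<lambda>j. d i j + (\<Sum>i\<in>I. d i j)) (\<lambda>A. F i A * (\<Prod>i\<in>I. F i A))"
    by (rule mhom_mult) (use insert in auto)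
  then show ?case using insert.hyps by simp
qed

text \<open>When the permutation in the Leibniz expansion acts on the rows, every term takes exactly
  one factor from each chosen column \<open>J i\<close>, so all terms share one multidegree.\<close>

lemma mhom_minor:
  assumes "\<And>i. i < q \<Longrightarrow> R i < k" "\<And>i. i < q \<Longrightarrow> J i < n"
  shows "mhom k n (\<lambda>j. card {i. i < q \<and> J i = j}) (\<lambda>A. det (mat q q (\<lambda>(a, b). A $$ (R a, J b))))"
proof -
  let ?U = "{0..<q}"
  \<comment> \<open>\<open>det_def'\<close> permutes the column index; passing to the transpose
    moves the permutation to the rows.\<close>
  let ?T = "\<lambda>A. mat q q (\<lambda>(a, b). A $$ (R b, J a))"
  have "det (mat q q (\<lambda>(a, b). A $$ (R a, J b))) =
      (\<Sum>p | p permutes ?U. signof p * (\<Prod>i\<in>?U. A $$ (R (p i), J i)))" for A :: "complex mat"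
  proof -
    have "det (mat q q (\<lambda>(a, b). A $$ (R a, J b))) = det (transpose_mat (?T A))"
      by (rule arg_cong[of _ _ det]) (rule eq_matI, auto)
    also have "\<dots> = det (?T A)" by (rule det_transpose[of _ q]) simp
    also have "\<dots> = (\<Sum>p | p permutes ?U. signof p * (\<Prod>i\<in>?U. A $$ (R (p i), J i)))"
      unfolding det_def'[of "?T A" q, simplified]
      by (intro sum.cong refl arg_cong2[of _ _ _ _ "(*)"] prod.cong)
    finally show ?thesis .
  qed
  moreover have "mhom k n (\<lambda>j. card {i. i < q \<and> J i = j})
     (\<lambda>A. signof p * (\<Prod>i\<in>?U. A $$ (R (p i), J i)))" if p: "p permutes ?U" for p
  proof -
    have "mhom k n (\<lambda>j. 0 + (\<Sum>i\<in>?U. if j = J i then 1 else 0))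
       (\<lambda>A. signof p * (\<Prod>i\<in>?U. A $$ (R (p i), J i)))"
      using p assms permutes_in_image[OF p]
      by (intro mhom_mult[OF mhom_const] mhom_prod mhom_entry) auto
    moreover have "(\<Sum>i\<in>?U. if j = J i then 1 else 0) = card {i. i < q \<and> J i = j}" for j
      by (subst sum.inter_filter[symmetric]) (auto intro!: arg_cong[of _ _ card])
    ultimately show ?thesis by simp
  qed
  ultimately show ?thesis
    by (simp only:) (rule mhom_sum, simp)
qed

section \<open>Quotients of multihomogeneous functions, graded by the difference of
  multidegrees\<close>

text \<open>Only differences of multidegrees matter for quotients, so they are integer valued.\<close>

definition hrat :: "nat \<Rightarrow> nat \<Rightarrow> 'p set \<Rightarrow> ('p \<Rightarrow> complex mat) \<Rightarrow> (nat \<Rightarrow> int) \<Rightarrow> ('p \<Rightarrow> complex) \<Rightarrow> bool" where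
  "hrat k n D M \<delta> F \<longleftrightarrow> (\<exists>g h d e. mhom k n d g \<and> mhom k n e h \<and>
     (\<forall>j<n. int (d j) = int (e j) + \<delta> j) \<and> (\<forall>p\<in>D. h (M p) \<noteq> 0 \<and> F p = g (M p) / h (M p)))"

lemma hratI:
  assumes "mhom k n d g" "mhom k n e h" "\<And>j. j < n \<Longrightarrow> int (d j) = int (e j) + \<delta> j"
    "\<And>p. p \<in> D \<Longrightarrow> h (M p) \<noteq> 0" "\<And>p. p \<in> D \<Longrightarrow> F p = g (M p) / h (M p)"
  shows "hrat k n D M \<delta> F"
  using assms unfolding hrat_def by blast

lemma hratE:
  assumes "hrat k n D M \<delta> F"
  obtains g h d e where "mhom k n d g" "mhom k n e h" "\<And>j. j < n \<Longrightarrow> int (d j) = int (e j) + \<delta> j"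
    "\<And>p. p \<in> D \<Longrightarrow> h (M p) \<noteq> 0" "\<And>p. p \<in> D \<Longrightarrow> F p = g (M p) / h (M p)"
  using assms unfolding hrat_def by blast

lemma hrat_cong:
  assumes "hrat k n D M \<delta> F" "\<And>p. p \<in> D \<Longrightarrow> F p = G p" "\<And>j. j < n \<Longrightarrow> \<delta> j = \<epsilon> j"
  shows "hrat k n D M \<epsilon> G"
  using assms unfolding hrat_def by auto

text \<open>The zero polynomial has every multidegree, so \<open>nat (\<delta> j)\<close> can be
  prescribed for the numerator over the denominator 1.\<close>

lemma hrat_zero:
  assumes "\<And>j. \<delta> j \<ge> 0"
  shows "hrat k n D M \<delta> (\<lambda>_. 0)"
  by (rule hratI[OF mhom_zero[of _ _ "\<lambda>j. nat (\<delta> j)"] mhom_const[of _ _ 1]]) (use assms in auto)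

lemma hrat_const: "hrat k n D M (\<lambda>_. 0) (\<lambda>_. c)"
  by (rule hratI[OF mhom_const[of _ _ c] mhom_const[of _ _ 1]]) auto

lemma hrat_entry:
  assumes "i < k" "j < n"
  shows "hrat k n D M (\<lambda>l. if l = j then 1 else 0) (\<lambda>p. M p $$ (i, j))"
  by (rule hratI[OF mhom_entry[OF assms] mhom_const[of _ _ 1]]) auto

lemma hrat_mult:
  assumes "hrat k n D M \<delta> F" "hrat k n D M \<epsilon> G"
  shows "hrat k n D M (\<lambda>j. \<delta> j + \<epsilon> j) (\<lambda>p. F p * G p)"
proof -
  obtain g h d e where 1: "mhom k n d g" "mhom k n e h" "\<And>j. j < n \<Longrightarrow> int (d j) = int (e j) + \<delta> j"
    "\<And>p. p \<in> D \<Longrightarrow> h (M p) \<noteq> 0" "\<And>p. p \<in> D \<Longrightarrow> F p = g (M p) / h (M p)"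
    using hratE[OF assms(1)] by metis
  obtain g' h' d' e' where 2: "mhom k n d' g'" "mhom k n e' h'" "\<And>j. j < n \<Longrightarrow> int (d' j) = int (e' j) + \<epsilon> j"
    "\<And>p. p \<in> D \<Longrightarrow> h' (M p) \<noteq> 0" "\<And>p. p \<in> D \<Longrightarrow> G p = g' (M p) / h' (M p)"
    using hratE[OF assms(2)] by metis
  show ?thesis
    by (rule hratI[OF mhom_mult[OF 1(1) 2(1)] mhom_mult[OF 1(2) 2(2)]]) (auto simp: 1 2)
qed

lemma hrat_add:
  assumes "hrat k n D M \<delta> F" "hrat k n D M \<delta> G"
  shows "hrat k n D M \<delta> (\<lambda>p. F p + G p)"
proof -
  obtain g h d e where 1: "mhom k n d g" "mhom k n e h" "\<And>j. j < n \<Longrightarrow> int (d j) = int (e j) + \<delta> j"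
    "\<And>p. p \<in> D \<Longrightarrow> h (M p) \<noteq> 0" "\<And>p. p \<in> D \<Longrightarrow> F p = g (M p) / h (M p)"
    using hratE[OF assms(1)] by metis
  obtain g' h' d' e' where 2: "mhom k n d' g'" "mhom k n e' h'" "\<And>j. j < n \<Longrightarrow> int (d' j) = int (e' j) + \<delta> j"
    "\<And>p. p \<in> D \<Longrightarrow> h' (M p) \<noteq> 0" "\<And>p. p \<in> D \<Longrightarrow> G p = g' (M p) / h' (M p)"
    using hratE[OF assms(2)] by metis
  \<comment> \<open>Over the common denominator the cross products of \<open>g\<close> with
    \<open>h'\<close> and of \<open>h\<close> with \<open>g'\<close> have the same multidegree,
    because both quotients have degree \<delta>.\<close>
  have "mhom k n (\<lambda>j. e j + d' j) (\<lambda>A. g A * h' A)"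
  proof (rule mhom_cong[OF _ mhom_mult[OF 1(1) 2(2)]])
    show "d j + e' j = e j + d' j" if "j < n" for j using 1(3)[OF that] 2(3)[OF that] by linarith
  qed
  from mhom_add[OF this mhom_mult[OF 1(2) 2(1)]]
  have "mhom k n (\<lambda>j. e j + d' j) (\<lambda>A. g A * h' A + h A * g' A)" .
  then show ?thesis
    by (rule hratI[OF _ mhom_mult[OF 1(2) 2(2)]]) (auto simp: 1 2 field_simps)
qed

lemma hrat_minus: "hrat k n D M \<delta> F \<Longrightarrow> hrat k n D M \<delta> (\<lambda>p. - F p)"
  by (rule hrat_cong[OF hrat_mult[OF hrat_const[of _ _ _ _ "-1"]]]) auto

lemma hrat_diff:
  "hrat k n D M \<delta> F \<Longrightarrow> hrat k n D M \<delta> G \<Longrightarrow> hrat k n D M \<delta> (\<lambda>p. F p - G p)"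
  using hrat_add[OF _ hrat_minus] by fastforce

lemma hrat_divide:
  assumes "hrat k n D M \<delta> F" "hrat k n D M \<epsilon> G" "\<And>p. p \<in> D \<Longrightarrow> G p \<noteq> 0"
  shows "hrat k n D M (\<lambda>j. \<delta> j - \<epsilon> j) (\<lambda>p. F p / G p)"
proof -
  obtain g h d e where 1: "mhom k n d g" "mhom k n e h" "\<And>j. j < n \<Longrightarrow> int (d j) = int (e j) + \<delta> j"
    "\<And>p. p \<in> D \<Longrightarrow> h (M p) \<noteq> 0" "\<And>p. p \<in> D \<Longrightarrow> F p = g (M p) / h (M p)"
    using hratE[OF assms(1)] by metis
  obtain g' h' d' e' where 2: "mhom k n d' g'" "mhom k n e' h'" "\<And>j. j < n \<Longrightarrow> int (d' j) = int (e' j) + \<epsilon> j"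
    "\<And>p. p \<in> D \<Longrightarrow> h' (M p) \<noteq> 0" "\<And>p. p \<in> D \<Longrightarrow> G p = g' (M p) / h' (M p)"
    using hratE[OF assms(2)] by metis
  have "g' (M p) \<noteq> 0" if "p \<in> D" for p using assms(3)[OF that] 2(5)[OF that] by auto
  then show ?thesis
    by (intro hratI[OF mhom_mult[OF 1(1) 2(2)] mhom_mult[OF 1(2) 2(1)]]) (auto simp: 1 2)
qed

lemma hrat_sum:
  assumes "\<And>j. \<delta> j \<ge> 0" "\<And>i. i \<in> I \<Longrightarrow> hrat k n D M \<delta> (F i)"
  shows "hrat k n D M \<delta> (\<lambda>p. \<Sum>i\<in>I. F i p)"
  using assms(2) by (induction I rule: infinite_finite_induct) (auto intro: hrat_zero assms(1) hrat_add)

lemma hrat_mult0: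
  "hrat k n D M (\<lambda>_. 0) F \<Longrightarrow> hrat k n D M (\<lambda>_. 0) G \<Longrightarrow> hrat k n D M (\<lambda>_. 0) (\<lambda>p. F p * G p)"
  using hrat_mult by fastforce

lemma hrat_prod0:
  "(\<And>i. i \<in> I \<Longrightarrow> hrat k n D M (\<lambda>_. 0) (F i)) \<Longrightarrow> hrat k n D M (\<lambda>_. 0) (\<lambda>p. \<Prod>i\<in>I. F i p)"
  by (induction I rule: infinite_finite_induct) (auto intro: hrat_const hrat_mult0)

lemma hrat_power0: "hrat k n D M (\<lambda>_. 0) F \<Longrightarrow> hrat k n D M (\<lambda>_. 0) (\<lambda>p. F p ^ e)"
  by (induction e) (auto intro: hrat_const hrat_mult0)

text \<open>In degree 0 all monomials of a polynomial keep the same degree after substitution, so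
  even an inhomogeneous polynomial can be evaluated at such quotients.\<close>

lemma hrat_poly_eval:
  assumes "\<And>v. v \<in> poly_vars q \<Longrightarrow> hrat k n D M (\<lambda>_. 0) (\<lambda>p. y p v)"
  shows "hrat k n D M (\<lambda>_. 0) (\<lambda>p. poly_eval q (y p))"
  unfolding poly_eval_def
  by (intro hrat_sum hrat_mult0 hrat_prod0 hrat_power0 hrat_const assms) (auto simp: poly_vars_def)

section \<open>Regular functions and isomorphisms with affine space\<close>

lemma mhom_zero_iff:
  assumes "mhom k n d F" "A \<in> coords k n P" "B \<in> coords k n P"
  shows "F A = 0 \<longleftrightarrow> F B = 0"
proof -
  obtain p where p: "multihomogeneous k n d p" "\<And>A. F A = poly_eval p (\<lambda>ij. A $$ ij)"
    using assms(1) by (auto simp: mhom_def)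
  show ?thesis unfolding p(2) by (rule multihomogeneous_zero_iff[OF p(1) assms(2,3)])
qed

text \<open>A change of coordinates multiplies numerator and denominator by the same nonzero product
  of powers of the column scalars.\<close>

lemma mhom_ratio:
  assumes F: "mhom k n d F" and G: "mhom k n d G" and AB: "A \<in> coords k n P" "B \<in> coords k n P"
  shows "F A / G A = F B / G B"
proof -
  obtain c where c: "\<And>j. j < n \<Longrightarrow> c j \<noteq> 0"
    and B: "\<And>i j. i < k \<Longrightarrow> j < n \<Longrightarrow> B $$ (i, j) = c j * A $$ (i, j)"
    using coords_scale[OF AB] by metis
  have scale: "H B = (\<Prod>j<n. c j ^ d j) * H A" if H: "mhom k n d H" for H
  proof -
    obtain p where p: "multihomogeneous k n d p" "\<And>A. H A = poly_eval p (\<lambda>ij. A $$ ij)"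
      using H by (auto simp: mhom_def)
    show ?thesis unfolding p(2) by (rule multihomogeneous_scale[OF p(1)]) (rule B)
  qed
  have "(\<Prod>j<n. c j ^ d j) \<noteq> 0" using c by (simp add: prod_zero_iff)
  then show ?thesis unfolding scale[OF F] scale[OF G] by (simp del: prod_zero_iff)
qed

lemma hrat0E:
  assumes "hrat k n D M (\<lambda>_. 0) F"
  obtains d g h where "mhom k n d g" "mhom k n d h" "\<forall>p\<in>D. h (M p) \<noteq> 0 \<and> F p = g (M p) / h (M p)"
proof -
  obtain g h d e where 1: "mhom k n d g" "mhom k n e h" "\<And>j. j < n \<Longrightarrow> int (d j) = int (e j) + 0"
    "\<And>p. p \<in> D \<Longrightarrow> h (M p) \<noteq> 0" "\<And>p. p \<in> D \<Longrightarrow> F p = g (M p) / h (M p)"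
    using hratE[OF assms] by metis
  have "mhom k n d h"
  proof (rule mhom_cong[OF _ 1(2)])
    show "e j = d j" if "j < n" for j using 1(3)[OF that] by simp
  qed
  then show ?thesis using that[OF 1(1)] 1(4,5) by blast
qed

lemma hrat_subset: "hrat k n D M \<delta> F \<Longrightarrow> D' \<subseteq> D \<Longrightarrow> hrat k n D' M \<delta> F"
  unfolding hrat_def by blast

lemma openin_mproj_nonvanishing:
  assumes "\<And>f. f \<in> F \<Longrightarrow> \<exists>d. mhom k n d f"
  shows "openin (mproj_topology k n) {P \<in> mproj_points k n. \<exists>f\<in>F. \<exists>A\<in>coords k n P. f A \<noteq> 0}"
proof -
  have "\<forall>f\<in>F. \<exists>p. (\<exists>d. multihomogeneous k n d p) \<and> (\<forall>A. f A = poly_eval p (\<lambda>ij. A $$ ij))"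
    using assms unfolding mhom_def by meson
  then obtain p where p: "\<And>f. f \<in> F \<Longrightarrow> \<exists>d. multihomogeneous k n d (p f)"
    "\<And>f A. f \<in> F \<Longrightarrow> f A = poly_eval (p f) (\<lambda>ij. A $$ ij)"
    using bchoice[of F "\<lambda>f p. (\<exists>d. multihomogeneous k n d p) \<and> (\<forall>A. f A = poly_eval p (\<lambda>ij. A $$ ij))"]
    by blast
  show ?thesis unfolding openin_mproj_topology
    using p by (intro conjI exI[of _ "p ` F"]) (auto simp: mproj_zeros_def)
qed

lemma openin_mproj_nonvanishing1:
  assumes "mhom k n d f"
  shows "openin (mproj_topology k n) {P \<in> mproj_points k n. \<forall>A\<in>coords k n P. f A \<noteq> 0}"
proof -
  have "{P \<in> mproj_points k n. \<forall>A\<in>coords k n P. f A \<noteq> 0} =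
        {P \<in> mproj_points k n. \<exists>f\<in>{f}. \<exists>A\<in>coords k n P. f A \<noteq> 0}"
  proof -
    have "(\<forall>A\<in>coords k n P. f A \<noteq> 0) \<longleftrightarrow> (\<exists>A\<in>coords k n P. f A \<noteq> 0)" if "P \<in> mproj_points k n" for P
      using coords_nonempty[OF that] mhom_zero_iff[OF assms, of _ P] by blast
    then show ?thesis by auto
  qed
  then show ?thesis using openin_mproj_nonvanishing[of "{f}" k n] assms by auto
qed

lemma regular_mproj_iff:
  "f \<in> regular (mproj k n) U \<longleftrightarrow> (\<forall>P\<in>U. \<exists>W d g h. openin (mproj_topology k n) W \<and> P \<in> W \<and> W \<subseteq> U \<and>
     mhom k n d g \<and> mhom k n d h \<and> (\<forall>Q\<in>W. \<forall>A\<in>coords k n Q. h A \<noteq> 0 \<and> f Q = g A / h A))"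
    (is "_ \<longleftrightarrow> (\<forall>P\<in>U. ?R P)")
proof -
  have "?R P \<longleftrightarrow> (\<exists>W d g h. openin (mproj_topology k n) W \<and> P \<in> W \<and> W \<subseteq> U \<and>
     multihomogeneous k n d g \<and> multihomogeneous k n d h \<and>
     (\<forall>Q\<in>W. \<forall>A\<in>coords k n Q. poly_eval h (\<lambda>ij. A $$ ij) \<noteq> 0 \<and>
        f Q = poly_eval g (\<lambda>ij. A $$ ij) / poly_eval h (\<lambda>ij. A $$ ij)))" (is "_ \<longleftrightarrow> ?L P") for P
  proof
    assume "?R P"
    then obtain W d g h where W: "openin (mproj_topology k n) W" "P \<in> W" "W \<subseteq> U"
      and "mhom k n d g" "mhom k n d h"
      and f: "\<And>Q A. Q \<in> W \<Longrightarrow> A \<in> coords k n Q \<Longrightarrow> h A \<noteq> 0 \<and> f Q = g A / h A" by blast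
    then obtain p q where p: "multihomogeneous k n d p" "\<And>A. g A = poly_eval p (\<lambda>ij. A $$ ij)"
      and q: "multihomogeneous k n d q" "\<And>A. h A = poly_eval q (\<lambda>ij. A $$ ij)"
      unfolding mhom_def by blast
    show "?L P" using W p(1) q(1) f[unfolded p(2) q(2)]
      by (intro exI[of _ W] exI[of _ d] exI[of _ p] exI[of _ q] conjI) auto
  next
    assume "?L P"
    then obtain W d g h where W: "openin (mproj_topology k n) W" "P \<in> W" "W \<subseteq> U"
      and gh: "multihomogeneous k n d g" "multihomogeneous k n d h"
      and f: "\<And>Q A. Q \<in> W \<Longrightarrow> A \<in> coords k n Q \<Longrightarrow> poly_eval h (\<lambda>ij. A $$ ij) \<noteq> 0 \<and>
        f Q = poly_eval g (\<lambda>ij. A $$ ij) / poly_eval h (\<lambda>ij. A $$ ij)" by blast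
    have "mhom k n d (\<lambda>A. poly_eval g (\<lambda>ij. A $$ ij))" "mhom k n d (\<lambda>A. poly_eval h (\<lambda>ij. A $$ ij))"
      using gh by (auto simp: mhom_def)
    then show "?R P" using W f
      by (intro exI[of _ W] exI[of _ d] exI[of _ "\<lambda>A. poly_eval g (\<lambda>ij. A $$ ij)"]
          exI[of _ "\<lambda>A. poly_eval h (\<lambda>ij. A $$ ij)"] conjI) auto
  qed
  then show ?thesis by (simp add: mproj_def)
qed

lemma regular_affine_iff:
  "f \<in> regular (affine_space m) U \<longleftrightarrow> (\<forall>x\<in>U. \<exists>W g h. openin (affine_topology m) W \<and> x \<in> W \<and> W \<subseteq> U \<and>
     polyfun m g \<and> polyfun m h \<and> (\<forall>q\<in>W. h q \<noteq> 0 \<and> f q = g q / h q))"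
    (is "_ \<longleftrightarrow> (\<forall>x\<in>U. ?R x)")
proof -
  have "?R x \<longleftrightarrow> (\<exists>W g h. openin (affine_topology m) W \<and> x \<in> W \<and> W \<subseteq> U \<and>
     poly_vars g \<subseteq> {..<m} \<and> poly_vars h \<subseteq> {..<m} \<and>
     (\<forall>q\<in>W. poly_eval h (\<lambda>i. q $ i) \<noteq> 0 \<and>
        f q = poly_eval g (\<lambda>i. q $ i) / poly_eval h (\<lambda>i. q $ i)))" (is "_ \<longleftrightarrow> ?L x") for x
  proof
    assume "?R x"
    then obtain W g h where W: "openin (affine_topology m) W" "x \<in> W" "W \<subseteq> U"
      and "polyfun m g" "polyfun m h" and f: "\<And>q. q \<in> W \<Longrightarrow> h q \<noteq> 0 \<and> f q = g q / h q" by blast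
    then obtain p p' where p: "poly_vars p \<subseteq> {..<m}" "\<And>x. x \<in> carrier_vec m \<Longrightarrow> g x = poly_eval p (\<lambda>i. x $ i)"
      and p': "poly_vars p' \<subseteq> {..<m}" "\<And>x. x \<in> carrier_vec m \<Longrightarrow> h x = poly_eval p' (\<lambda>i. x $ i)"
      unfolding polyfun_def by blast
    have "W \<subseteq> carrier_vec m" using W(1) by (simp add: openin_affine_topology)
    then have "poly_eval p' (\<lambda>i. q $ i) \<noteq> 0 \<and> f q = poly_eval p (\<lambda>i. q $ i) / poly_eval p' (\<lambda>i. q $ i)"
      if "q \<in> W" for q using f[OF that] p(2)[of q] p'(2)[of q] that by auto
    then show "?L x" using W p(1) p'(1) by (intro exI[of _ W] exI[of _ p] exI[of _ p'] conjI) auto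
  next
    assume "?L x"
    then obtain W g h where W: "openin (affine_topology m) W" "x \<in> W" "W \<subseteq> U"
      and gh: "poly_vars g \<subseteq> {..<m}" "poly_vars h \<subseteq> {..<m}"
      and f: "\<And>q. q \<in> W \<Longrightarrow> poly_eval h (\<lambda>i. q $ i) \<noteq> 0 \<and>
        f q = poly_eval g (\<lambda>i. q $ i) / poly_eval h (\<lambda>i. q $ i)" by blast
    have "polyfun m (\<lambda>x. poly_eval g (\<lambda>i. x $ i))" "polyfun m (\<lambda>x. poly_eval h (\<lambda>i. x $ i))"
      using gh by (auto simp: polyfun_def)
    then show "?R x" using W f
      by (intro exI[of _ W] exI[of _ "\<lambda>x. poly_eval g (\<lambda>i. x $ i)"]
          exI[of _ "\<lambda>x. poly_eval h (\<lambda>i. x $ i)"] conjI) auto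
  qed
  then show ?thesis by (simp add: affine_space_def)
qed

lemma regular_mprojE:
  assumes "f \<in> regular (mproj k n) U" "P \<in> U"
  obtains W d g h where "openin (mproj_topology k n) W" "P \<in> W" "W \<subseteq> U" "mhom k n d g" "mhom k n d h"
    "\<forall>Q\<in>W. \<forall>A\<in>coords k n Q. h A \<noteq> 0 \<and> f Q = g A / h A"
  using bspec[OF assms(1)[unfolded regular_mproj_iff] assms(2)] by (elim exE conjE)

lemma regular_affineE:
  assumes "f \<in> regular (affine_space m) U" "x \<in> U"
  obtains W g h where "openin (affine_topology m) W" "x \<in> W" "W \<subseteq> U" "polyfun m g" "polyfun m h"
    "\<forall>q\<in>W. h q \<noteq> 0 \<and> f q = g q / h q"
  using bspec[OF assms(1)[unfolded regular_affine_iff] assms(2)] by (elim exE conjE)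

text \<open>Turns a quotient of functions of the matrix into a function of the point. Any choice of
  coordinates serves, since \<open>mhom_ratio\<close> makes the value independent of it.\<close>

lemma regular_mproj_quotient:
  assumes "openin (mproj_topology k n) W" "mhom k n d g" "mhom k n d h"
    and h: "\<And>P A. P \<in> W \<Longrightarrow> A \<in> coords k n P \<Longrightarrow> h A \<noteq> 0"
  obtains f where "f \<in> regular (mproj k n) W" "\<forall>P. \<forall>A\<in>coords k n P. f P = g A / h A"
proof -
  define f where "f = (\<lambda>P. let A = (SOME A. A \<in> coords k n P) in g A / h A)"
  have f: "f P = g A / h A" if "A \<in> coords k n P" for P A
    unfolding f_def Let_def using someI[of "\<lambda>A. A \<in> coords k n P", OF that] that
    by (intro mhom_ratio[OF assms(2,3)]) auto
  moreover have "f \<in> regular (mproj k n) W"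
    unfolding regular_mproj_iff using assms f by blast
  ultimately show ?thesis using that by blast
qed

lemma zariski_subvariety: "zariski (subvariety X Z) = subtopology (zariski X) Z"
  by (simp add: subvariety_def)

lemma regular_subvariety_iff:
  "f \<in> regular (subvariety X Z) U \<longleftrightarrow> (\<forall>p\<in>U. \<exists>W g. openin (zariski X) W \<and> p \<in> W \<inter> Z \<and>
     W \<inter> Z \<subseteq> U \<and> g \<in> regular X W \<and> (\<forall>q\<in>W \<inter> Z. f q = g q))"
  by (simp add: subvariety_def)

lemma regular_subvarietyE:
  assumes "f \<in> regular (subvariety X Z) U" "p \<in> U"
  obtains W g where "openin (zariski X) W" "p \<in> W \<inter> Z" "W \<inter> Z \<subseteq> U" "g \<in> regular X W"
    "\<forall>q\<in>W \<inter> Z. f q = g q"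
  using bspec[OF assms(1)[unfolded regular_subvariety_iff] assms(2)] by (elim exE conjE)

text \<open>A criterion for isomorphism with affine space: the parametrization lifts to a matrix
  \<open>M\<close> of polynomials, and each coordinate of the inverse is a single degree 0 quotient
  valid over all of \<open>Z\<close>. The quotients live on pairs \<open>(P, A)\<close> because they
  are evaluated at any coordinate matrix \<open>A\<close> of the point, while \<phi> depends on the
  point alone.\<close>

locale affine_chart =
  fixes k n m :: nat and X Z :: "(nat \<Rightarrow> complex vec set) set"
    and \<psi> :: "complex vec \<Rightarrow> (nat \<Rightarrow> complex vec set)" and \<phi> :: "(nat \<Rightarrow> complex vec set) \<Rightarrow> complex vec"
    and M :: "complex vec \<Rightarrow> complex mat"
  assumes Z_X: "Z \<subseteq> X" and X_points: "X \<subseteq> mproj_points k n"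
    and \<psi>: "x \<in> carrier_vec m \<Longrightarrow> \<psi> x \<in> Z"
    and \<phi>: "P \<in> Z \<Longrightarrow> \<phi> P \<in> carrier_vec m"
    and \<phi>\<psi>: "x \<in> carrier_vec m \<Longrightarrow> \<phi> (\<psi> x) = x"
    and \<psi>\<phi>: "P \<in> Z \<Longrightarrow> \<psi> (\<phi> P) = P"
    and M: "x \<in> carrier_vec m \<Longrightarrow> M x \<in> coords k n (\<psi> x)"
    and polyfun_M: "i < k \<Longrightarrow> j < n \<Longrightarrow> polyfun m (\<lambda>x. M x $$ (i, j))"
    and hrat_\<phi>: "i < m \<Longrightarrow> hrat k n (Sigma Z (coords k n)) snd (\<lambda>_. 0) (\<lambda>(P, A). \<phi> P $ i)"
begin

abbreviation "C \<equiv> subvariety (subvariety (mproj k n) X) Z"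

lemma zariski_C: "zariski C = subtopology (mproj_topology k n) Z"
  using Z_X by (simp add: zariski_subvariety subtopology_subtopology mproj_def inf_absorb2)

lemma topspace_C: "topspace (zariski C) = Z"
  using Z_X X_points by (auto simp: zariski_C topspace_mproj_topology)

lemma zariski_affine: "zariski (affine_space m) = affine_topology m"
  by (simp add: affine_space_def)

lemma polyfun_mhom:
  assumes "mhom k n d g"
  shows "polyfun m (\<lambda>x. g (M x))"
proof -
  obtain p where p: "multihomogeneous k n d p" "\<And>A. g A = poly_eval p (\<lambda>ij. A $$ ij)"
    using assms by (auto simp: mhom_def)
  show ?thesis unfolding p(2)
    using p(1) by (intro polyfun_poly_eval) (auto simp: multihomogeneous_def intro: polyfun_M)
qed

lemma hrat_polyfun:
  assumes "polyfun m g"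
  shows "hrat k n (Sigma Z (coords k n)) snd (\<lambda>_. 0) (\<lambda>(P, A). g (\<phi> P))"
proof -
  obtain p where p: "poly_vars p \<subseteq> {..<m}" "\<And>x. x \<in> carrier_vec m \<Longrightarrow> g x = poly_eval p (\<lambda>i. x $ i)"
    using polyfunE[OF assms] by metis
  have "hrat k n (Sigma Z (coords k n)) snd (\<lambda>_. 0) (\<lambda>a. poly_eval p (\<lambda>i. \<phi> (fst a) $ i))"
    using p(1) hrat_\<phi> by (intro hrat_poly_eval) (auto simp: case_prod_unfold)
  then show ?thesis by (rule hrat_cong) (auto simp: p(2) \<phi>)
qed

text \<open>A polynomial in the coordinates of \<phi> equals a quotient whose denominator is nonzero
  over all of \<open>Z\<close>, so its zeros in \<open>Z\<close> are those of the multihomogeneous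
  numerator.\<close>

lemma continuous_\<phi>: "continuous_map (zariski C) (affine_topology m) \<phi>"
  unfolding continuous_map topspace_C topspace_affine_topology
proof (intro conjI allI impI)
  show "\<phi> ` Z \<subseteq> carrier_vec m" using \<phi> by auto
  fix V assume "openin (affine_topology m) V"
  then obtain S where V: "V \<subseteq> carrier_vec m" and S: "\<And>p. p \<in> S \<Longrightarrow> poly_vars p \<subseteq> {..<m}"
    and VS: "carrier_vec m - V = affine_zeros m S" by (auto simp: openin_affine_topology)
  have "\<exists>f. (\<exists>d. mhom k n d f) \<and> (\<forall>P\<in>Z. \<forall>A\<in>coords k n P. poly_eval p (\<lambda>i. \<phi> P $ i) = 0 \<longleftrightarrow> f A = 0)"
    if p: "p \<in> S" for p
  proof -
    have "polyfun m (\<lambda>x. poly_eval p (\<lambda>i. x $ i))" using S[OF p] by (auto simp: polyfun_def)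
    then obtain d g h where g: "mhom k n d g" "mhom k n d h"
      and h: "\<forall>a\<in>Sigma Z (coords k n). h (snd a) \<noteq> 0 \<and>
        (case a of (P, A) \<Rightarrow> poly_eval p (\<lambda>i. \<phi> P $ i)) = g (snd a) / h (snd a)"
      by (rule hrat0E[OF hrat_polyfun])
    have "poly_eval p (\<lambda>i. \<phi> P $ i) = 0 \<longleftrightarrow> g A = 0" if "P \<in> Z" "A \<in> coords k n P" for P A
      using bspec[OF h, of "(P, A)"] that by auto
    with g(1) show ?thesis by (intro exI[of _ g] conjI exI[of _ d] ballI)
  qed
  then have "\<forall>p\<in>S. \<exists>f. (\<exists>d. mhom k n d f) \<and>
      (\<forall>P\<in>Z. \<forall>A\<in>coords k n P. poly_eval p (\<lambda>i. \<phi> P $ i) = 0 \<longleftrightarrow> f A = 0)" ..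
  from bchoice[OF this] obtain f where f': "\<forall>p\<in>S. (\<exists>d. mhom k n d (f p)) \<and>
      (\<forall>P\<in>Z. \<forall>A\<in>coords k n P. poly_eval p (\<lambda>i. \<phi> P $ i) = 0 \<longleftrightarrow> f p A = 0)" ..
  have f: "\<And>p. p \<in> S \<Longrightarrow> \<exists>d. mhom k n d (f p)"
    "\<And>p P A. p \<in> S \<Longrightarrow> P \<in> Z \<Longrightarrow> A \<in> coords k n P \<Longrightarrow> poly_eval p (\<lambda>i. \<phi> P $ i) = 0 \<longleftrightarrow> f p A = 0"
    using f' by simp_all
  let ?O = "{P \<in> mproj_points k n. \<exists>g\<in>f ` S. \<exists>A\<in>coords k n P. g A \<noteq> 0}"
  have O: "openin (mproj_topology k n) ?O" by (rule openin_mproj_nonvanishing) (use f in auto)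
  have "{P \<in> Z. \<phi> P \<in> V} = ?O \<inter> Z"
  proof -
    have "\<phi> P \<in> V \<longleftrightarrow> P \<in> ?O" if P: "P \<in> Z" for P
    proof -
      have Pp: "P \<in> mproj_points k n" using P Z_X X_points by auto
      then obtain A where A: "A \<in> coords k n P" using coords_nonempty by blast
      have "\<phi> P \<in> V \<longleftrightarrow> \<phi> P \<notin> affine_zeros m S" using VS \<phi>[OF P] by blast
      also have "\<dots> \<longleftrightarrow> (\<exists>p\<in>S. poly_eval p (\<lambda>i. \<phi> P $ i) \<noteq> 0)"
        using \<phi>[OF P] by (auto simp: affine_zeros_def)
      also have "\<dots> \<longleftrightarrow> (\<exists>p\<in>S. \<exists>A\<in>coords k n P. f p A \<noteq> 0)"
        using f(2)[OF _ P] A by blast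
      also have "\<dots> \<longleftrightarrow> P \<in> ?O" using Pp by simp
      finally show ?thesis .
    qed
    then show ?thesis by blast
  qed
  then show "openin (zariski C) {P \<in> Z. \<phi> P \<in> V}"
    unfolding zariski_C openin_subtopology using O by blast
qed

lemma morphism_\<phi>: "morphism C (affine_space m) \<phi>"
  unfolding morphism_def zariski_affine topspace_C
proof (intro conjI allI impI)
  show "continuous_map (zariski C) (affine_topology m) \<phi>" by (rule continuous_\<phi>)
  fix V f assume V: "openin (affine_topology m) V" and f: "f \<in> regular (affine_space m) V"
  show "f \<circ> \<phi> \<in> regular C {P \<in> Z. \<phi> P \<in> V}"
    unfolding regular_subvariety_iff[of _ _ Z]
  proof
    fix P assume P: "P \<in> {P \<in> Z. \<phi> P \<in> V}"
    then have "\<phi> P \<in> V" by simp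
    with f obtain W g h where W: "openin (affine_topology m) W" "\<phi> P \<in> W" "W \<subseteq> V"
      and gh: "polyfun m g" "polyfun m h"
      and fW: "\<forall>q\<in>W. h q \<noteq> 0 \<and> f q = g q / h q"
      by (rule regular_affineE)
    have "openin (zariski C) {P \<in> Z. \<phi> P \<in> W}"
      using openin_continuous_map_preimage[OF continuous_\<phi> W(1)] by (simp only: topspace_C)
    then obtain T where T: "openin (mproj_topology k n) T" "{P \<in> Z. \<phi> P \<in> W} = T \<inter> Z"
      by (auto simp only: zariski_C openin_subtopology)
    \<comment> \<open>The denominator of \<open>f\<close> is known to be nonzero only on
      \<open>W\<close>, so the quotient is formed over the part of \<open>Z\<close> that \<phi> maps
      into \<open>W\<close>.\<close>
    let ?D = "Sigma (T \<inter> Z) (coords k n)"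
    have D: "?D \<subseteq> Sigma Z (coords k n)" by auto
    have TW: "\<phi> Q \<in> W" if "Q \<in> T \<inter> Z" for Q using that T(2) by blast
    have "hrat k n ?D snd (\<lambda>j. 0 - 0) (\<lambda>a. (case a of (P, A) \<Rightarrow> g (\<phi> P)) / (case a of (P, A) \<Rightarrow> h (\<phi> P)))"
      by (intro hrat_divide hrat_subset[OF hrat_polyfun D] gh) (use fW TW in auto)
    then have "hrat k n ?D snd (\<lambda>j. 0) (\<lambda>a. f (\<phi> (fst a)))"
      by (rule hrat_cong) (use fW TW in auto)
    then obtain d g' h' where g': "mhom k n d g'" "mhom k n d h'"
      and h': "\<forall>a\<in>?D. h' (snd a) \<noteq> 0 \<and> f (\<phi> (fst a)) = g' (snd a) / h' (snd a)"
      by (rule hrat0E)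
    \<comment> \<open>Regularity on a subvariety asks for a regular function on an open set of the
      ambient space, where \<open>h'\<close> may vanish. Removing its zeros from \<open>T\<close>
      loses no point of \<open>Z\<close>.\<close>
    define W1 where "W1 = T \<inter> {P \<in> mproj_points k n. \<forall>A\<in>coords k n P. h' A \<noteq> 0}"
    have W1: "openin (mproj_topology k n) W1"
      unfolding W1_def by (intro openin_Int T(1) openin_mproj_nonvanishing1[OF g'(2)])
    have "h' A \<noteq> 0" if "P \<in> W1" "A \<in> coords k n P" for P A
      using that by (simp add: W1_def)
    then obtain F where F: "F \<in> regular (mproj k n) W1"
      "\<forall>P. \<forall>A\<in>coords k n P. F P = g' A / h' A"
      by (rule regular_mproj_quotient[OF W1 g'])
    have Zp: "Q \<in> mproj_points k n" if "Q \<in> Z" for Q using that Z_X X_points by auto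
    have F\<phi>: "f (\<phi> Q) = F Q" if Q: "Q \<in> T \<inter> Z" for Q
    proof -
      obtain A where "A \<in> coords k n Q" using Q Zp coords_nonempty by blast
      then show ?thesis using bspec[OF h', of "(Q, A)"] F(2) Q by simp
    qed
    have W1Z: "W1 \<inter> Z = T \<inter> Z" using h' Zp by (auto simp: W1_def)
    have P': "P \<in> T \<inter> Z" using P W(2) T(2) by blast
    have "openin (zariski (subvariety (mproj k n) X)) (W1 \<inter> X)"
      using W1 by (auto simp: zariski_subvariety mproj_def openin_subtopology)
    moreover have "F \<in> regular (subvariety (mproj k n) X) (W1 \<inter> X)"
      unfolding regular_subvariety_iff using F(1) W1 by (auto simp: mproj_def)
    moreover have "W1 \<inter> X \<inter> Z = T \<inter> Z" using W1Z Z_X by blast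
    moreover have "T \<inter> Z \<subseteq> {P \<in> Z. \<phi> P \<in> V}" using TW W(3) by blast
    ultimately show "\<exists>W g. openin (zariski (subvariety (mproj k n) X)) W \<and> P \<in> W \<inter> Z \<and>
        W \<inter> Z \<subseteq> {P \<in> Z. \<phi> P \<in> V} \<and> g \<in> regular (subvariety (mproj k n) X) W \<and>
        (\<forall>q\<in>W \<inter> Z. (f \<circ> \<phi>) q = g q)"
      using P' F\<phi> by (intro exI[of _ "W1 \<inter> X"] exI[of _ F] conjI) simp_all
  qed
qed

text \<open>Membership in \<open>W\<close> can be tested on the one matrix \<open>M x\<close>, whose
  entries are polynomials in \<open>x\<close>.\<close>

lemma openin_\<psi>_preimage:
  assumes "openin (mproj_topology k n) W"
  shows "openin (affine_topology m) {x \<in> carrier_vec m. \<psi> x \<in> W}"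
proof -
  obtain S where S: "\<And>p. p \<in> S \<Longrightarrow> \<exists>d. multihomogeneous k n d p"
    and W: "mproj_points k n - W = mproj_zeros k n S"
    using assms unfolding openin_mproj_topology by blast
  have "\<psi> x \<in> W \<longleftrightarrow> (\<exists>p\<in>S. poly_eval p (\<lambda>ij. M x $$ ij) \<noteq> 0)" if x: "x \<in> carrier_vec m" for x
  proof -
    have "\<psi> x \<in> mproj_points k n" using \<psi>[OF x] Z_X X_points by auto
    then have "\<psi> x \<in> W \<longleftrightarrow> (\<exists>p\<in>S. \<exists>A\<in>coords k n (\<psi> x). poly_eval p (\<lambda>ij. A $$ ij) \<noteq> 0)"
      using W by (auto simp: mproj_zeros_def)
    also have "\<dots> \<longleftrightarrow> (\<exists>p\<in>S. poly_eval p (\<lambda>ij. M x $$ ij) \<noteq> 0)"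
      using S M[OF x] by (blast dest: multihomogeneous_zero_iff[OF _ M[OF x]])
    finally show ?thesis .
  qed
  then have "{x \<in> carrier_vec m. \<psi> x \<in> W} =
      {x \<in> carrier_vec m. \<exists>f\<in>(\<lambda>p x. poly_eval p (\<lambda>ij. M x $$ ij)) ` S. f x \<noteq> 0}" by auto
  moreover have "openin (affine_topology m) \<dots>"
  proof (rule openin_affine_nonvanishing)
    fix f assume "f \<in> (\<lambda>p x. poly_eval p (\<lambda>ij. M x $$ ij)) ` S"
    then obtain p d where p: "multihomogeneous k n d p" "f = (\<lambda>x. poly_eval p (\<lambda>ij. M x $$ ij))"
      using S by blast
    then have "mhom k n d (\<lambda>A. poly_eval p (\<lambda>ij. A $$ ij))" by (auto simp: mhom_def)
    from polyfun_mhom[OF this] show "polyfun m f" by (simp add: p(2))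
  qed
  ultimately show ?thesis by simp
qed

lemma morphism_\<psi>: "morphism (affine_space m) C \<psi>"
  unfolding morphism_def zariski_affine topspace_affine_topology
proof (intro conjI allI impI)
  show "continuous_map (affine_topology m) (zariski C) \<psi>"
    unfolding continuous_map topspace_C topspace_affine_topology
  proof (intro conjI allI impI)
    show "\<psi> ` carrier_vec m \<subseteq> Z" using \<psi> by auto
    fix V assume "openin (zariski C) V"
    then obtain W where "openin (mproj_topology k n) W" "V = W \<inter> Z"
      unfolding zariski_C openin_subtopology by blast
    moreover from this have "{x \<in> carrier_vec m. \<psi> x \<in> V} = {x \<in> carrier_vec m. \<psi> x \<in> W}"
      using \<psi> by auto
    ultimately show "openin (affine_topology m) {x \<in> carrier_vec m. \<psi> x \<in> V}"
      using openin_\<psi>_preimage by simp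
  qed
  fix V f assume "openin (zariski C) V" and f: "f \<in> regular C V"
  show "f \<circ> \<psi> \<in> regular (affine_space m) {x \<in> carrier_vec m. \<psi> x \<in> V}"
    unfolding regular_affine_iff
  proof
    fix x assume x: "x \<in> {x \<in> carrier_vec m. \<psi> x \<in> V}"
    then have "\<psi> x \<in> V" by simp
    \<comment> \<open>A regular function on \<open>C\<close> is unwound in three layers: from
      \<open>Z\<close> to \<open>X\<close>, from \<open>X\<close> to the product of projective
      spaces, and there to a local quotient. Only this quotient is pulled back along
      \<open>M\<close>.\<close>
    with f obtain W G where W: "openin (zariski (subvariety (mproj k n) X)) W" "\<psi> x \<in> W \<inter> Z" "W \<inter> Z \<subseteq> V"
      and G: "G \<in> regular (subvariety (mproj k n) X) W" "\<forall>q\<in>W \<inter> Z. f q = G q"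
      by (rule regular_subvarietyE)
    have "\<psi> x \<in> W" using W(2) by simp
    with G(1) obtain W' G' where W': "openin (zariski (mproj k n)) W'" "\<psi> x \<in> W' \<inter> X" "W' \<inter> X \<subseteq> W"
      and G': "G' \<in> regular (mproj k n) W'" "\<forall>q\<in>W' \<inter> X. G q = G' q"
      by (rule regular_subvarietyE)
    have "\<psi> x \<in> W'" using W'(2) by simp
    with G'(1) obtain W'' d g h where W'': "openin (mproj_topology k n) W''" "\<psi> x \<in> W''" "W'' \<subseteq> W'"
      and gh: "mhom k n d g" "mhom k n d h"
      and q: "\<forall>Q\<in>W''. \<forall>A\<in>coords k n Q. h A \<noteq> 0 \<and> G' Q = g A / h A"
      by (rule regular_mprojE)
    let ?O = "{x \<in> carrier_vec m. \<psi> x \<in> W''}"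
    have "openin (affine_topology m) ?O" by (rule openin_\<psi>_preimage[OF W''(1)])
    moreover have "polyfun m (\<lambda>x. g (M x))" "polyfun m (\<lambda>x. h (M x))"
      using gh by (auto intro: polyfun_mhom)
    moreover have "h (M y) \<noteq> 0 \<and> f (\<psi> y) = g (M y) / h (M y) \<and> \<psi> y \<in> V" if y: "y \<in> ?O" for y
    proof -
      have yX: "\<psi> y \<in> W' \<inter> X" "\<psi> y \<in> Z" using y \<psi> W''(3) Z_X by auto
      then have yW: "\<psi> y \<in> W \<inter> Z" using W'(3) by blast
      then have "f (\<psi> y) = G' (\<psi> y)" using G(2) G'(2) yX by simp
      moreover have "M y \<in> coords k n (\<psi> y)" "\<psi> y \<in> W''" using y M by auto
      ultimately show ?thesis using q yW W(3) by auto
    qed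
    ultimately show "\<exists>W g h. openin (affine_topology m) W \<and> x \<in> W \<and> W \<subseteq> {x \<in> carrier_vec m. \<psi> x \<in> V} \<and>
        polyfun m g \<and> polyfun m h \<and> (\<forall>q\<in>W. h q \<noteq> 0 \<and> (f \<circ> \<psi>) q = g q / h q)"
      using x W''(2)
      by (intro exI[of _ ?O] exI[of _ "\<lambda>x. g (M x)"] exI[of _ "\<lambda>x. h (M x)"] conjI) auto
  qed
qed

lemma isomorphic_affine: "isomorphic C (affine_space m)"
  unfolding isomorphic_def topspace_C zariski_affine topspace_affine_topology
  using morphism_\<phi> morphism_\<psi> \<phi>\<psi> \<psi>\<phi> by blast

end

section \<open>Words and pattern matrices\<close>

lemma first_index:
  assumes "a \<in> set w"
  shows "first_index w a < length w" "w ! first_index w a = a"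
proof -
  have "\<exists>j. j < length w \<and> w ! j = a" using assms by (auto simp: in_set_conv_nth)
  from LeastI_ex[OF this] show "first_index w a < length w" "w ! first_index w a = a"
    by (simp_all add: first_index_def)
qed

lemma first_index_le: "j < length w \<Longrightarrow> first_index w (w ! j) \<le> j"
  unfolding first_index_def by (rule Least_le) simp

lemma set_take_iff: "a \<in> set (take p w) \<longleftrightarrow> a \<in> set w \<and> first_index w a < p"
proof
  assume "a \<in> set (take p w)"
  then obtain j where "j < length w" "j < p" "w ! j = a" by (auto simp: in_set_conv_nth)
  then show "a \<in> set w \<and> first_index w a < p" using first_index_le[of j w] by auto
next
  assume "a \<in> set w \<and> first_index w a < p"
  then show "a \<in> set (take p w)" using first_index[of a w] by (force simp: in_set_conv_nth)
qed

lemma first_index_inj: "a \<in> set w \<Longrightarrow> b \<in> set w \<Longrightarrow> first_index w a = first_index w b \<Longrightarrow> a = b"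
  by (metis first_index(2))

lemma mem_initial_iff: "j < length w \<Longrightarrow> j \<in> initial_indices w \<longleftrightarrow> first_index w (w ! j) = j"
  using first_index_le[of j w] by (auto simp: initial_indices_def set_take_iff)

lemma first_index_append:
  assumes "a \<in> set w"
  shows "first_index (w @ xs) a = first_index w a"
proof (rule antisym)
  have 1: "first_index w a < length w" "w ! first_index w a = a" using first_index[OF assms] by auto
  have 2: "first_index (w @ xs) a < length (w @ xs)" "(w @ xs) ! first_index (w @ xs) a = a"
    using first_index[of a "w @ xs"] assms by auto
  show le: "first_index (w @ xs) a \<le> first_index w a"
    using first_index_le[of "first_index w a" "w @ xs"] 1 by (simp add: nth_append)
  show "first_index w a \<le> first_index (w @ xs) a"
    using first_index_le[of "first_index (w @ xs) a" w] 1 2 le by (simp add: nth_append)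
qed

lemma first_index_snoc_new:
  assumes "a \<notin> set w"
  shows "first_index (w @ [a]) a = length w"
proof -
  have "first_index (w @ [a]) a \<le> length w"
    using first_index_le[of "length w" "w @ [a]"] by simp
  moreover have "\<not> first_index (w @ [a]) a < length w"
    using first_index[of a "w @ [a]"] assms by (auto simp: nth_append dest: nth_mem split: if_splits)
  ultimately show ?thesis by simp
qed

text \<open>Merges the two star clauses of \<open>pattern_entry\<close>. In both the first
  \<open>i\<close> precedes the first \<open>w ! j\<close>, since an initial column is itself the
  first occurrence of its letter; an initial column also requires the row to lie above row
  \<open>w ! j\<close>.\<close>

definition star_pos :: "nat list \<Rightarrow> nat \<Rightarrow> nat \<Rightarrow> bool" where
  "star_pos w i j \<longleftrightarrow> i \<in> set w \<and> first_index w i < first_index w (w ! j) \<and>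
     (first_index w (w ! j) = j \<longrightarrow> i < w ! j)"

lemma star_pos_neq: "star_pos w i j \<Longrightarrow> i \<noteq> w ! j"
  by (auto simp: star_pos_def)

lemma pattern_entry_star:
  assumes "j < length w"
  shows "pattern_entry w i j =
    (if w ! j = i then One_Symbol else if star_pos w i j then Star_Symbol else Zero_Symbol)"
proof -
  have "(\<exists>j'<j. w ! j' = i) \<longleftrightarrow> first_index w i < j" if i: "i \<in> set w"
    using set_take_iff[of i j w] i assms by (auto simp: in_set_conv_nth)
  then show ?thesis using mem_initial_iff[OF assms]
    by (auto simp: pattern_entry_def star_pos_def)
qed

lemma mem_C_hat:
  "A \<in> C_hat k w \<longleftrightarrow> A \<in> carrier_mat k (length w) \<and>
     (\<forall>i<k. \<forall>j<length w. (i = w ! j \<longrightarrow> A $$ (i, j) = 1) \<and>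
        (i \<noteq> w ! j \<and> \<not> star_pos w i j \<longrightarrow> A $$ (i, j) = 0))"
  by (auto simp: C_hat_def PM_def pattern_entry_star)

lemma C_hat_one: "A \<in> C_hat k w \<Longrightarrow> j < length w \<Longrightarrow> w ! j < k \<Longrightarrow> A $$ (w ! j, j) = 1"
  by (simp add: mem_C_hat)

lemma C_hat_nonzero:
  assumes "A \<in> C_hat k w" "j < length w" "i < k" "A $$ (i, j) \<noteq> 0"
  shows "i = w ! j \<or> star_pos w i j"
  using assms by (auto simp: mem_C_hat)



lemma C_hat_support:
  assumes "A \<in> C_hat k w" "j < length w" "i < k" "A $$ (i, j) \<noteq> 0"
  shows "i \<in> set (take (Suc j) w)"
  using C_hat_nonzero[OF assms] first_index_le[OF assms(2)] assms(2)
  by (auto simp: set_take_iff star_pos_def)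

text \<open>The stars of a column involve only letters that have occurred by then, and a new letter
  gets its first occurrence after all earlier columns.\<close>

lemma star_pos_snoc:
  assumes "j < length w"
  shows "star_pos (w @ [a]) i j \<longleftrightarrow> star_pos w i j"
proof -
  have *: "first_index (w @ [a]) (w ! j) = first_index w (w ! j)"
    by (rule first_index_append) (use assms in simp)
  show ?thesis
  proof (cases "i \<in> set w")
    case True
    then show ?thesis using assms * by (simp add: star_pos_def nth_append first_index_append)
  next
    case False
    then show ?thesis
      using assms * first_index_le[OF assms] by (auto simp: star_pos_def nth_append first_index_snoc_new)
  qed
qed

section \<open>Every tuple of lines lies in a cell\<close>

lemma lower_unitriangular_carrier: "L \<in> lower_unitriangular k \<Longrightarrow> L \<in> carrier_mat k k"
  by (simp add: lower_unitriangular_def)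

lemma det_lower_unitriangular:
  assumes "L \<in> lower_unitriangular k"
  shows "det L = 1"
proof -
  have L: "L \<in> carrier_mat k k" by (rule lower_unitriangular_carrier[OF assms])
  have "det L = prod_list (diag_mat L)"
    by (rule det_lower_triangular[OF _ L]) (use assms in \<open>auto simp: lower_unitriangular_def\<close>)
  also have "\<dots> = 1" using assms L by (auto simp: prod_list_diag_prod lower_unitriangular_def)
  finally show ?thesis .
qed

lemma mat_mult_entry:
  fixes X Y :: "'a :: semiring_0 mat"
  assumes "X \<in> carrier_mat p q" "Y \<in> carrier_mat q m" "i < p" "j < m"
  shows "(X * Y) $$ (i, j) = (\<Sum>t<q. X $$ (i, t) * Y $$ (t, j))"
  using assms by (simp add: scalar_prod_def lessThan_atLeast0)

lemma one_lower_unitriangular: "1\<^sub>m k \<in> lower_unitriangular k"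
  by (auto simp: lower_unitriangular_def)

lemma lower_unitriangular_mult:
  assumes "L \<in> lower_unitriangular k" "E \<in> lower_unitriangular k"
  shows "L * E \<in> lower_unitriangular k"
proof -
  have c: "L \<in> carrier_mat k k" "E \<in> carrier_mat k k" using assms by (auto simp: lower_unitriangular_def)
  have e: "(L * E) $$ (i, j) = (\<Sum>t<k. L $$ (i, t) * E $$ (t, j))" if "i < k" "j < k" for i j
    by (rule mat_mult_entry[OF c that])
  have z: "L $$ (i, t) * E $$ (t, j) = 0" if "i < k" "j < k" "t < k" "i < t \<or> t < j" for i j t
    using that assms by (auto simp: lower_unitriangular_def)
  have "(L * E) $$ (i, j) = 0" if "i < k" "j < k" "i < j" for i j
    unfolding e[OF that(1,2)] using that by (intro sum.neutral ballI z) auto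
  moreover have "(L * E) $$ (i, i) = 1" if i: "i < k" for i
  proof -
    have "(\<Sum>t<k. L $$ (i, t) * E $$ (t, i)) = (\<Sum>t\<in>{i}. L $$ (i, t) * E $$ (t, i))"
      using i by (intro sum.mono_neutral_right ballI z[OF i i]) auto
    then show ?thesis using e[OF i i] i assms by (simp add: lower_unitriangular_def)
  qed
  ultimately show ?thesis using c by (simp add: lower_unitriangular_def)
qed

lemma lower_unitriangular_solve:
  assumes "L \<in> lower_unitriangular k" "v \<in> carrier_vec k"
  obtains x where "x \<in> carrier_vec k" "L *\<^sub>v x = v"
proof -
  have L: "L \<in> carrier_mat k k" by (rule lower_unitriangular_carrier[OF assms(1)])
  have "det L \<noteq> 0" using det_lower_unitriangular[OF assms(1)] by simp
  then obtain B where B: "B \<in> carrier_mat k k" "L * B = 1\<^sub>m k"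
    using det_non_zero_imp_unit[OF L] by (auto simp: Units_def ring_mat_def)
  have "L *\<^sub>v (B *\<^sub>v v) = (L * B) *\<^sub>v v" by (rule assoc_mult_mat_vec[symmetric, OF L B(1) assms(2)])
  also have "\<dots> = v" using B(2) assms(2) by simp
  finally show ?thesis using that[of "B *\<^sub>v v"] B(1) assms(2) mult_mat_vec_carrier by blast
qed

lemma cell_decomposition_snoc:
  assumes w: "set w \<subseteq> {..<k}" and L: "L \<in> lower_unitriangular k" and A: "A \<in> C_hat k w"
    and v: "v \<in> carrier_vec k" "v \<noteq> 0\<^sub>v k"
  shows "\<exists>a L' b c. a < k \<and> L' \<in> lower_unitriangular k \<and> b \<in> carrier_vec k \<and> c \<noteq> 0 \<and>
    v = c \<cdot>\<^sub>v (L' *\<^sub>v b) \<and> (\<forall>j<length w. L' *\<^sub>v col A j = L *\<^sub>v col A j) \<and> b $ a = 1 \<and>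
    (\<forall>i<k. b $ i \<noteq> 0 \<longrightarrow> i = a \<or> star_pos (w @ [a]) i (length w))"
proof -
  have Lc: "L \<in> carrier_mat k k" by (rule lower_unitriangular_carrier[OF L])
  obtain x where x: "x \<in> carrier_vec k" "L *\<^sub>v x = v" using lower_unitriangular_solve[OF L v(1)] .
  have x0: "\<exists>i<k. x $ i \<noteq> 0"
  proof (rule ccontr)
    assume "\<not> ?thesis"
    then have "x = 0\<^sub>v k" using x(1) by (intro eq_vecI) auto
    then show False using x(2) v(2) Lc by auto
  qed
  have Acol: "col A j \<in> carrier_vec k" for j using A by (auto simp: mem_C_hat)
  show ?thesis
  proof (cases "\<exists>i<k. x $ i \<noteq> 0 \<and> i \<notin> set w")
    case False
    let ?S = "{i. i < k \<and> x $ i \<noteq> 0}"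
    have "finite ?S" "?S \<noteq> {}" using x0 by auto
    \<comment> \<open>Among the letters in the support of \<open>x\<close> the one that occurs last
      for the first time is chosen; all others then stand at stars of the repeated letter
      \<open>a\<close>.\<close>
    then obtain a where a: "a \<in> ?S" "Max (first_index w ` ?S) = first_index w a"
      using Max_in[of "first_index w ` ?S"] by blast
    have amax: "first_index w i \<le> first_index w a" if "i \<in> ?S" for i
      using that \<open>finite ?S\<close> unfolding a(2)[symmetric] by (intro Max_ge) auto
    define b where "b = (1 / x $ a) \<cdot>\<^sub>v x"
    have "a \<in> set w" using a(1) False by auto
    have "i = a \<or> star_pos (w @ [a]) i (length w)" if "i < k" "b $ i \<noteq> 0" for i
    proof -
      have i: "i \<in> ?S" using that x(1) by (auto simp: b_def)
      then have "i \<in> set w" using False by auto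
      moreover have "first_index w a < length w" by (rule first_index(1)[OF \<open>a \<in> set w\<close>])
      ultimately show ?thesis using amax[OF i] first_index_inj[OF \<open>i \<in> set w\<close> \<open>a \<in> set w\<close>] \<open>a \<in> set w\<close>
        by (cases "i = a") (auto simp: star_pos_def first_index_append le_less)
    qed
    moreover have "v = x $ a \<cdot>\<^sub>v (L *\<^sub>v b)"
      using a(1) x Lc by (simp add: b_def mult_mat_vec[of L k k] smult_smult_assoc)
    ultimately show ?thesis using a(1) x(1) L
      by (intro exI[of _ a] exI[of _ L] exI[of _ b] exI[of _ "x $ a"]) (auto simp: b_def)
  next
    case True
    let ?Q = "\<lambda>i. i < k \<and> x $ i \<noteq> 0 \<and> i \<notin> set w"
    define a where "a = (LEAST i. ?Q i)"
    have a: "a < k" "x $ a \<noteq> 0" "a \<notin> set w" using LeastI_ex[of ?Q] True by (auto simp: a_def)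
    have amin: "i \<in> set w" if "i < a" "x $ i \<noteq> 0" for i
      using not_less_Least[of i ?Q] that a(1) by (auto simp: a_def)
    \<comment> \<open>Column \<open>a\<close> of \<open>E\<close> carries the part of
      \<open>x / x $ a\<close> below row \<open>a\<close>, and \<open>b\<close> keeps the part down
      to row \<open>a\<close>; since \<open>b $ a = 1\<close>, applying \<open>E\<close> to
      \<open>b\<close> restores \<open>x / x $ a\<close>. Above row \<open>a\<close> the support of
      \<open>b\<close> consists of old letters by minimality of \<open>a\<close>, which are the
      stars of an initial column.\<close>
    define E where "E = mat k k (\<lambda>(i, j). if i = j then 1 else if j = a \<and> a < i then x $ i / x $ a else 0)"
    define b where "b = vec k (\<lambda>i. if i \<le> a then x $ i / x $ a else 0)"
    have E: "E \<in> lower_unitriangular k" by (auto simp: lower_unitriangular_def E_def)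
    have Ec: "E \<in> carrier_mat k k" by (simp add: E_def)
    have Ey: "(E *\<^sub>v y) $ i = y $ i + (if a < i then x $ i / x $ a * y $ a else 0)"
      if y: "y \<in> carrier_vec k" and i: "i < k" for y i
    proof -
      have "(E *\<^sub>v y) $ i = (\<Sum>j<k. E $$ (i, j) * y $ j)"
        using y i Ec by (simp add: scalar_prod_def lessThan_atLeast0)
      also have "\<dots> = (\<Sum>j<k. (if j = i then y $ i else 0) +
          (if j = a then if a < i then x $ i / x $ a * y $ a else 0 else 0))"
        using i by (intro sum.cong refl) (auto simp: E_def)
      also have "\<dots> = y $ i + (if a < i then x $ i / x $ a * y $ a else 0)"
        using i a(1) by (simp add: sum.distrib)
      finally show ?thesis .
    qed
    have "x = x $ a \<cdot>\<^sub>v (E *\<^sub>v b)"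
    proof (rule eq_vecI)
      have "b \<in> carrier_vec k" by (simp add: b_def)
      then show "x $ i = (x $ a \<cdot>\<^sub>v (E *\<^sub>v b)) $ i" if "i < dim_vec (x $ a \<cdot>\<^sub>v (E *\<^sub>v b))" for i
        using that Ec a Ey[of b i] by (simp add: b_def)
    qed (use x(1) Ec in simp)
    then have "v = L *\<^sub>v (x $ a \<cdot>\<^sub>v (E *\<^sub>v b))" using x(2) by simp
    also have "\<dots> = x $ a \<cdot>\<^sub>v (L *\<^sub>v (E *\<^sub>v b))"
      using Ec by (intro mult_mat_vec[OF Lc]) (simp add: b_def)
    also have "L *\<^sub>v (E *\<^sub>v b) = (L * E) *\<^sub>v b"
      by (rule assoc_mult_mat_vec[symmetric, OF Lc Ec]) (simp add: b_def)
    finally have veq: "v = x $ a \<cdot>\<^sub>v ((L * E) *\<^sub>v b)" .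
    have cols: "(L * E) *\<^sub>v col A j = L *\<^sub>v col A j" if j: "j < length w" for j
    proof -
      \<comment> \<open>Row \<open>a\<close> vanishes in the earlier columns because the letter
        \<open>a\<close> has not occurred, so \<open>E\<close> fixes these columns.\<close>
      have "a \<noteq> w ! j" using a(3) j by auto
      then have "A $$ (a, j) = 0"
        using a(1,3) j A by (auto simp: mem_C_hat star_pos_def)
      then have "col A j $ a = 0" using A a(1) j by (auto simp: mem_C_hat)
      then have "E *\<^sub>v col A j = col A j"
        using Acol[of j] Ec A by (intro eq_vecI) (auto simp: Ey[OF Acol] mem_C_hat)
      then show ?thesis using assoc_mult_mat_vec[OF Lc Ec Acol] by simp
    qed
    have "i = a \<or> star_pos (w @ [a]) i (length w)" if "i < k" "b $ i \<noteq> 0" for i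
    proof (cases "i = a")
      case False
      then have "i < a" "x $ i \<noteq> 0" using that by (auto simp: b_def split: if_splits)
      then have "i \<in> set w" using amin by simp
      then show ?thesis using \<open>i < a\<close> a(3) first_index[of i w]
        by (simp add: star_pos_def first_index_append first_index_snoc_new)
    qed simp
    then show ?thesis using a lower_unitriangular_mult[OF L E] veq cols
      by (intro exI[of _ a] exI[of _ "L * E"] exI[of _ b] exI[of _ "x $ a"] conjI) (auto simp: b_def)
  qed
qed

text \<open>The unitriangular factor may change at every step, but its action on the columns already
  treated does not.\<close>

lemma cell_decomposition:
  assumes "\<And>j. j < p \<Longrightarrow> v j \<in> carrier_vec k \<and> v j \<noteq> 0\<^sub>v k"
  shows "\<exists>w L A c. length w = p \<and> set w \<subseteq> {..<k} \<and> L \<in> lower_unitriangular k \<and> A \<in> C_hat k w \<and>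
    (\<forall>j<p. c j \<noteq> 0 \<and> v j = c j \<cdot>\<^sub>v (L *\<^sub>v col A j))"
  using assms
proof (induction p)
  case 0
  show ?case
    using one_lower_unitriangular[of k]
    by (intro exI[of _ "[]"] exI[of _ "1\<^sub>m k"] exI[of _ "0\<^sub>m k 0"] exI[of _ "\<lambda>_. 0"]) (auto simp: mem_C_hat)
next
  case (Suc p)
  then obtain w L A c where w: "length w = p" "set w \<subseteq> {..<k}" and L: "L \<in> lower_unitriangular k"
    and A: "A \<in> C_hat k w" and c: "\<And>j. j < p \<Longrightarrow> c j \<noteq> 0 \<and> v j = c j \<cdot>\<^sub>v (L *\<^sub>v col A j)"
    by (metis less_SucI)
  from cell_decomposition_snoc[OF w(2) L A, of "v p"] Suc.prems[of p]
  obtain a L' b c' where a: "a < k" and L': "L' \<in> lower_unitriangular k"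
    and b: "b \<in> carrier_vec k" and c': "c' \<noteq> 0" "v p = c' \<cdot>\<^sub>v (L' *\<^sub>v b)"
    and LL': "\<And>j. j < length w \<Longrightarrow> L' *\<^sub>v col A j = L *\<^sub>v col A j" and ba: "b $ a = 1"
    and star: "\<And>i. i < k \<Longrightarrow> b $ i \<noteq> 0 \<Longrightarrow> i = a \<or> star_pos (w @ [a]) i (length w)"
    by auto
  define A' where "A' = mat k (Suc p) (\<lambda>(i, j). if j < p then A $$ (i, j) else b $ i)"
  have "A' \<in> C_hat k (w @ [a])"
    using A ba star w(1) by (auto simp: mem_C_hat A'_def nth_append star_pos_snoc less_Suc_eq)
  moreover have "col A' j = col A j" if "j < p" for j
    using that A w(1) by (intro eq_vecI) (auto simp: A'_def mem_C_hat)
  moreover have "col A' p = b" using b by (intro eq_vecI) (auto simp: A'_def)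
  ultimately show ?case using w a L' c c' LL'
    by (intro exI[of _ "w @ [a]"] exI[of _ L'] exI[of _ A'] exI[of _ "c(p := c')"])
       (auto simp: less_Suc_eq)
qed

section \<open>The variety is the union of the cells\<close>

lemma cspan_smult:
  assumes "u \<in> carrier_vec k" "c \<noteq> 0"
  shows "cspan k {c \<cdot>\<^sub>v u} = cspan k {u}"
proof -
  interpret V: vec_space "TYPE(complex)" k .
  have "c \<cdot>\<^sub>v u \<in> cspan k {u}" using assms V.smult_in_span[of "{u}" u] V.span_mem[of "{u}" u] by auto
  moreover have "(1 / c) \<cdot>\<^sub>v (c \<cdot>\<^sub>v u) \<in> cspan k {c \<cdot>\<^sub>v u}"
    using assms V.smult_in_span[of "{c \<cdot>\<^sub>v u}"] V.span_mem[of "{c \<cdot>\<^sub>v u}"] by auto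
  ultimately show ?thesis
    using assms by (intro antisym V.span_subsetI) (auto simp: smult_smult_assoc)
qed

lemma mult_mat_zero_vec:
  assumes "(L :: complex mat) \<in> carrier_mat m k"
  shows "L *\<^sub>v 0\<^sub>v k = 0\<^sub>v m"
  using assms by (intro eq_vecI) auto

lemma mult_mat_unit_vec:
  assumes "(L :: complex mat) \<in> carrier_mat m k" "t < k"
  shows "L *\<^sub>v unit_vec k t = col L t"
  using assms by (intro eq_vecI) auto

lemma nth_less: "set w \<subseteq> {..<k} \<Longrightarrow> j < length w \<Longrightarrow> w ! j < k"
  by (meson lessThan_iff nth_mem subset_iff)

definition supported :: "nat \<Rightarrow> nat set \<Rightarrow> complex vec set" where
  "supported k S = {x \<in> carrier_vec k. \<forall>t<k. x $ t \<noteq> 0 \<longrightarrow> t \<in> S}"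

text \<open>Each new vector \<open>a p\<close> adds at most the coordinate \<open>w ! p\<close>,
  where it is 1, so the coordinates are peeled off from the last position backwards. The vectors are
  kept general so that the lemma covers the columns of a pattern matrix as well as unit
  vectors.\<close>

lemma supported_span:
  assumes L: "L \<in> carrier_mat k k" and w: "set w \<subseteq> {..<k}" and p: "p \<le> length w"
    and a: "\<And>j. j < length w \<Longrightarrow> a j \<in> supported k (set (take (Suc j) w))"
    and a1: "\<And>j. j < length w \<Longrightarrow> a j $ (w ! j) = 1"
  shows "(*\<^sub>v) L ` supported k (set (take p w)) = cspan k ((\<lambda>j. L *\<^sub>v a j) ` {..<p})" (is "?V p = ?C p")
proof
  interpret V: vec_space "TYPE(complex)" k .
  have ac: "a j \<in> carrier_vec k" if "j < length w" for j using a[OF that] by (simp add: supported_def)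
  have sub: "(\<lambda>j. L *\<^sub>v a j) ` {..<q} \<subseteq> carrier_vec k" if "q \<le> length w" for q
  proof clarify
    fix j assume "j < q"
    then have "a j \<in> carrier_vec k" using ac[of j] that by simp
    then show "L *\<^sub>v a j \<in> carrier_vec k" using mult_mat_vec_carrier[OF L] by blast
  qed
  have "L *\<^sub>v x \<in> ?C p" if "x \<in> supported k (set (take p w))" for x
    using that p
  proof (induction p arbitrary: x)
    case 0
    then have "x = 0\<^sub>v k" by (intro eq_vecI) (auto simp: supported_def)
    then have "L *\<^sub>v x = 0\<^sub>v k" using mult_mat_zero_vec[OF L] by simp
    then show ?case by (simp add: V.span_empty)
  next
    case (Suc p)
    let ?c = "x $ (w ! p)"
    \<comment> \<open>Subtracting this multiple makes the coordinate \<open>w ! p\<close> zero,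
      which leaves only letters of the shorter prefix.\<close>
    let ?y = "x - ?c \<cdot>\<^sub>v a p"
    have pw: "p < length w" using Suc.prems by simp
    have wp: "w ! p < k" by (rule nth_less[OF w pw])
    have xc: "x \<in> carrier_vec k" using Suc.prems(1) by (simp add: supported_def)
    have take: "set (take (Suc p) w) = insert (w ! p) (set (take p w))"
      using pw by (simp add: take_Suc_conv_app_nth)
    have "?y \<in> supported k (set (take p w))"
      unfolding supported_def
    proof (intro CollectI conjI allI impI)
      show "?y \<in> carrier_vec k" using xc ac[OF pw] by simp
      fix t assume t: "t < k" "?y $ t \<noteq> 0"
      then have "t \<noteq> w ! p" using a1[OF pw] xc ac[OF pw] wp by auto
      moreover have "x $ t \<noteq> 0 \<or> a p $ t \<noteq> 0" using t xc ac[OF pw] by auto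
      ultimately show "t \<in> set (take p w)"
        using t(1) Suc.prems(1) a[OF pw] take by (auto simp: supported_def)
    qed
    then have IH: "L *\<^sub>v ?y \<in> ?C p" using Suc.IH pw by simp
    have "L *\<^sub>v ?y \<in> ?C (Suc p)" by (rule subsetD[OF V.span_is_monotone IH]) auto
    moreover have "?c \<cdot>\<^sub>v (L *\<^sub>v a p) \<in> ?C (Suc p)"
      by (rule V.smult_in_span[OF sub V.span_mem[OF sub]]) (use pw in auto)
    ultimately have "L *\<^sub>v ?y + ?c \<cdot>\<^sub>v (L *\<^sub>v a p) \<in> ?C (Suc p)"
      by (rule V.span_add1[OF sub, rotated]) (use pw in simp)
    moreover have "L *\<^sub>v ?y + ?c \<cdot>\<^sub>v (L *\<^sub>v a p) = L *\<^sub>v x"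
    proof -
      have "L *\<^sub>v ?y + ?c \<cdot>\<^sub>v (L *\<^sub>v a p) = L *\<^sub>v ?y + L *\<^sub>v (?c \<cdot>\<^sub>v a p)"
        using mult_mat_vec[OF L ac[OF pw]] by simp
      also have "\<dots> = L *\<^sub>v (?y + ?c \<cdot>\<^sub>v a p)"
        by (rule mult_add_distrib_mat_vec[symmetric, OF L]) (use xc ac[OF pw] in auto)
      also have "?y + ?c \<cdot>\<^sub>v a p = x" using xc ac[OF pw] by (intro eq_vecI) auto
      finally show ?thesis .
    qed
    ultimately show ?case by simp
  qed
  then show "?V p \<subseteq> ?C p" by blast
  have "LinearCombinations.submodule class_ring (?V p) V.V"
    unfolding LinearCombinations.submodule_def
  proof (intro conjI allI impI)
    show "Module.module class_ring V.V" by (rule V.module_axioms)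
    show "?V p \<subseteq> carrier V.V" using mult_mat_vec_carrier[OF L] by (auto simp: supported_def)
    have "0\<^sub>v k \<in> supported k (set (take p w))" by (simp add: supported_def)
    from imageI[OF this, of "(*\<^sub>v) L"] show "\<zero>\<^bsub>V.V\<^esub> \<in> ?V p"
      by (simp only: mult_mat_zero_vec[OF L] module_vec_simps)
  next
    fix u v assume "u \<in> ?V p" "v \<in> ?V p"
    then obtain x y where xy: "x \<in> supported k (set (take p w))" "u = L *\<^sub>v x"
      "y \<in> supported k (set (take p w))" "v = L *\<^sub>v y" by blast
    have c: "x \<in> carrier_vec k" "y \<in> carrier_vec k" using xy by (auto simp: supported_def)
    have "u + v = L *\<^sub>v (x + y)" unfolding xy by (rule mult_add_distrib_mat_vec[symmetric, OF L c])
    moreover have "x + y \<in> supported k (set (take p w))" using xy by (fastforce simp: supported_def)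
    ultimately show "u \<oplus>\<^bsub>V.V\<^esub> v \<in> ?V p" by simp
  next
    fix c u assume "u \<in> ?V p"
    then obtain x where x: "x \<in> supported k (set (take p w))" "u = L *\<^sub>v x" by blast
    have xc: "x \<in> carrier_vec k" using x by (auto simp: supported_def)
    have "c \<cdot>\<^sub>v u = L *\<^sub>v (c \<cdot>\<^sub>v x)" unfolding x by (rule mult_mat_vec[symmetric, OF L xc])
    moreover have "c \<cdot>\<^sub>v x \<in> supported k (set (take p w))" using x by (auto simp: supported_def)
    ultimately show "c \<odot>\<^bsub>V.V\<^esub> u \<in> ?V p" by simp
  qed
  moreover have "L *\<^sub>v a j \<in> ?V p" if "j < p" for j
  proof -
    have "set (take (Suc j) w) \<subseteq> set (take p w)" using that set_take_subset_set_take[of "Suc j" p w] by simp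
    then show ?thesis using a[of j] that p by (auto simp: supported_def)
  qed
  ultimately show "?C p \<subseteq> ?V p" by (intro V.span_is_subset) auto
qed

text \<open>With the elements of \<open>S\<close> as a word and unit vectors as columns,
  \<open>supported_span\<close> presents the image as the span of the columns of \<open>L\<close>
  indexed by \<open>S\<close>. These are distinct and independent because \<open>L\<close> is
  invertible.\<close>

lemma dim_supported:
  assumes L: "L \<in> carrier_mat k k" "det L \<noteq> 0" and S: "S \<subseteq> {..<k}"
  shows "cdim k ((*\<^sub>v) L ` supported k S) = card S"
proof -
  interpret V: vec_space "TYPE(complex)" k .
  have fS: "finite S" using S finite_subset by blast
  let ?xs = "sorted_list_of_set S"
  have lt: "?xs ! j < k" if "j < length ?xs" for j
  proof -
    have "?xs ! j \<in> S" using nth_mem[OF that] fS by simp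
    then show ?thesis using S by auto
  qed
  have mem: "unit_vec k (?xs ! j) \<in> supported k (set (take (Suc j) ?xs))" if "j < length ?xs" for j
    using that lt by (auto simp: supported_def take_Suc_conv_app_nth split: if_splits)
  have "(*\<^sub>v) L ` supported k S = cspan k ((\<lambda>j. L *\<^sub>v unit_vec k (?xs ! j)) ` {..<length ?xs})"
    using supported_span[OF L(1), of ?xs "length ?xs" "\<lambda>j. unit_vec k (?xs ! j)"] mem lt fS S by simp
  also have "(\<lambda>j. L *\<^sub>v unit_vec k (?xs ! j)) ` {..<length ?xs} = (\<lambda>t. col L t) ` S"
  proof -
    have "(\<lambda>j. L *\<^sub>v unit_vec k (?xs ! j)) ` {..<length ?xs} = (\<lambda>t. L *\<^sub>v unit_vec k t) ` (\<lambda>j. ?xs ! j) ` {..<length ?xs}"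
      by (simp add: image_image)
    also have "(\<lambda>j. ?xs ! j) ` {..<length ?xs} = S"
      using fS set_conv_nth[of ?xs] by auto
    also have "(\<lambda>t. L *\<^sub>v unit_vec k t) ` S = (\<lambda>t. col L t) ` S"
      using S by (intro image_cong refl mult_mat_unit_vec[OF L(1)]) auto
    finally show ?thesis .
  qed
  finally have V: "(*\<^sub>v) L ` supported k S = cspan k (col L ` S)" .
  have rank: "V.rank L = k" using V.det_rank_iff[OF L(1)] L(2) by simp
  have dist: "distinct (cols L)" using V.non_distinct_low_rank[OF L(1)] rank by auto
  have "V.lin_indpt (set (cols L))" by (rule V.full_rank_lin_indpt[OF L(1) rank dist])
  moreover have sub: "col L ` S \<subseteq> set (cols L)" using S L(1) by (auto simp: cols_def)
  ultimately have indpt: "V.lin_indpt (col L ` S)" by (rule V.subset_li_is_li)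
  have inj: "inj_on (col L) S"
  proof (rule inj_onI)
    fix s t assume st: "s \<in> S" "t \<in> S" "col L s = col L t"
    have "s < dim_col L" "t < dim_col L" using st S L(1) by auto
    then have "cols L ! s = cols L ! t" using st(3) by (simp only: cols_nth)
    then show "s = t" using dist \<open>s < dim_col L\<close> \<open>t < dim_col L\<close>
      by (simp only: nth_eq_iff_index_eq cols_length)
  qed
  have "cdim k (cspan k (col L ` S)) = card (col L ` S)"
    using fS indpt L(1) by (intro V.dim_span) (auto simp: maximal_def)
  then show ?thesis using V card_image[OF inj] by simp
qed

lemma cspan_Union_lines:
  assumes "B \<in> carrier_mat k n" "p \<le> n"
  shows "cspan k (\<Union>j<p. lines_of k n B j) = cspan k (col B ` {..<p})"
proof -
  interpret V: vec_space "TYPE(complex)" k .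
  have c: "col B j \<in> carrier_vec k" for j using assms(1) by auto
  then have sub: "col B ` {..<p} \<subseteq> carrier_vec k" by auto
  have U: "(\<Union>j<p. lines_of k n B j) = (\<Union>j<p. cspan k {col B j})" using assms(2) by (auto simp: lines_of_def)
  have sub': "(\<Union>j<p. cspan k {col B j}) \<subseteq> carrier_vec k" using V.span_closed[of "{col B _}"] c by blast
  show ?thesis unfolding U
  proof (intro antisym V.span_subsetI sub sub')
    show "(\<Union>j<p. cspan k {col B j}) \<subseteq> cspan k (col B ` {..<p})"
      by (intro UN_least V.span_is_monotone) auto
    have "col B j \<in> cspan k {col B j}" for j using V.span_mem[of "{col B j}"] c by blast
    then have "col B ` {..<p} \<subseteq> (\<Union>j<p. cspan k {col B j})" by blast
    also have "\<dots> \<subseteq> cspan k (\<Union>j<p. cspan k {col B j})" by (rule V.in_own_span[OF sub'])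
    finally show "col B ` {..<p} \<subseteq> cspan k (\<Union>j<p. cspan k {col B j})" .
  qed
qed

lemma C_hat_col_supported:
  assumes "A \<in> C_hat k w" "j < length w"
  shows "col A j \<in> supported k (set (take (Suc j) w))"
  using C_hat_support[OF assms] assms by (auto simp: supported_def mem_C_hat)

text \<open>A zero column of the product would put a column of \<open>A\<close>, which has an entry
  1, into the kernel of the invertible \<open>L\<close>.\<close>

lemma cell_coords:
  assumes L: "L \<in> lower_unitriangular k" and A: "A \<in> C_hat k w" and w: "set w \<subseteq> {..<k}"
  shows "L * A \<in> coords k (length w) (lines_of k (length w) (L * A))"
proof -
  have Lc: "L \<in> carrier_mat k k" by (rule lower_unitriangular_carrier[OF L])
  have Ac: "A \<in> carrier_mat k (length w)" using A by (simp add: mem_C_hat)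
  have "col (L * A) j \<noteq> 0\<^sub>v k" if j: "j < length w" for j
  proof
    assume 0: "col (L * A) j = 0\<^sub>v k"
    have "w ! j < k" by (rule nth_less[OF w j])
    then have "col A j $ (w ! j) = 1" using C_hat_one[OF A j] Ac j by simp
    then have "col A j \<noteq> 0\<^sub>v k" using \<open>w ! j < k\<close> by auto
    moreover have "L *\<^sub>v col A j = 0\<^sub>v k" using 0 col_mult2[OF Lc Ac j] by simp
    moreover have "col A j \<in> carrier_vec k" using Ac j by simp
    ultimately have "det L = 0" using det_0_iff_vec_prod_zero_field[OF Lc] by blast
    then show False using det_lower_unitriangular[OF L] by simp
  qed
  then show ?thesis using Lc Ac by (simp add: coords_def)
qed

lemma coords_mproj_points:
  assumes "B \<in> coords k n P"
  shows "P \<in> mproj_points k n"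
proof -
  have P: "P = lines_of k n B" and B: "B \<in> carrier_mat k n" "\<And>j. j < n \<Longrightarrow> col B j \<noteq> 0\<^sub>v k"
    using assms by (auto simp: coords_def)
  have "cspan k {col B j} \<in> proj_space k" if "j < n" for j
    unfolding proj_space_def using B that by (intro CollectI exI[of _ "col B j"]) auto
  then show ?thesis unfolding P mproj_points_def lines_of_def by auto
qed

lemma cspan_cell:
  assumes L: "L \<in> lower_unitriangular k" and A: "A \<in> C_hat k w" and w: "set w \<subseteq> {..<k}"
    and p: "p \<le> length w"
  shows "cspan k (\<Union>j<p. lines_of k (length w) (L * A) j) = (*\<^sub>v) L ` supported k (set (take p w))"
proof -
  have Lc: "L \<in> carrier_mat k k" by (rule lower_unitriangular_carrier[OF L])
  have Ac: "A \<in> carrier_mat k (length w)" using A by (simp add: mem_C_hat)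
  have "cspan k (\<Union>j<p. lines_of k (length w) (L * A) j) = cspan k (col (L * A) ` {..<p})"
    using Lc Ac p by (intro cspan_Union_lines) auto
  also have "col (L * A) ` {..<p} = (\<lambda>j. L *\<^sub>v col A j) ` {..<p}"
    using p by (intro image_cong refl col_mult2[OF Lc Ac]) auto
  also have "cspan k \<dots> = (*\<^sub>v) L ` supported k (set (take p w))"
  proof (rule supported_span[symmetric, OF Lc w p])
    show "col A j $ (w ! j) = 1" if "j < length w" for j
      using C_hat_one[OF A that] nth_less[OF w that] that Ac by simp
  qed (rule C_hat_col_supported[OF A])
  finally show ?thesis .
qed

text \<open>By \<open>cspan_cell\<close> the first \<open>p\<close> lines span the image under
  \<open>L\<close> of the coordinate subspace of the first \<open>p\<close> letters. The cases
  \<open>p = length w\<close> and \<open>p = r\<close> yield the two conditions.\<close>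

lemma lines_of_mem_X_points_iff:
  assumes L: "L \<in> lower_unitriangular k" and A: "A \<in> C_hat k w" and w: "set w \<subseteq> {..<k}"
    and r: "r \<le> length w"
  shows "lines_of k (length w) (L * A) \<in> X_points (length w) k r \<longleftrightarrow> set w = {..<k} \<and> distinct (take r w)"
proof -
  interpret V: vec_space "TYPE(complex)" k .
  let ?P = "lines_of k (length w) (L * A)"
  have Lc: "L \<in> carrier_mat k k" by (rule lower_unitriangular_carrier[OF L])
  have det: "det L \<noteq> 0" using det_lower_unitriangular[OF L] by simp
  have "cspan k (\<Union>j<length w. ?P j) = (*\<^sub>v) L ` supported k (set w)"
    using cspan_cell[OF L A w, of "length w"] by simp
  moreover have "(*\<^sub>v) L ` supported k (set w) = carrier_vec k \<longleftrightarrow> set w = {..<k}"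
  proof
    assume eq: "(*\<^sub>v) L ` supported k (set w) = carrier_vec k"
    have "card (set w) = cdim k (carrier_vec k)" using dim_supported[OF Lc det w] eq by simp
    also have "\<dots> = k"
    proof -
      have "(module_vec TYPE(complex) k)\<lparr>carrier := carrier_vec k\<rparr> = module_vec TYPE(complex) k"
        by (simp add: module_vec_def)
      then show ?thesis by (simp only: V.dim_is_n)
    qed
    finally show "set w = {..<k}" using card_subset_eq[OF _ w] by simp
  next
    assume w: "set w = {..<k}"
    show "(*\<^sub>v) L ` supported k (set w) = carrier_vec k"
    proof
      show "(*\<^sub>v) L ` supported k (set w) \<subseteq> carrier_vec k"
        using mult_mat_vec_carrier[OF Lc] by (auto simp: supported_def)
      show "carrier_vec k \<subseteq> (*\<^sub>v) L ` supported k (set w)"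
      proof
        fix v :: "complex vec" assume "v \<in> carrier_vec k"
        then obtain x where "x \<in> carrier_vec k" "L *\<^sub>v x = v" using lower_unitriangular_solve[OF L] by blast
        then show "v \<in> (*\<^sub>v) L ` supported k (set w)" using w by (force simp: supported_def)
      qed
    qed
  qed
  moreover have "cdim k (cspan k (\<Union>j<r. ?P j)) = card (set (take r w))"
    unfolding cspan_cell[OF L A w r] using w set_take_subset[of r w]
    by (intro dim_supported[OF Lc det]) auto
  moreover have "card (set (take r w)) = r \<longleftrightarrow> distinct (take r w)"
    using r card_distinct[of "take r w"] distinct_card[of "take r w"] by auto
  moreover have "?P \<in> mproj_points k (length w)" by (rule coords_mproj_points[OF cell_coords[OF L A w]])
  ultimately show ?thesis by (simp add: X_points_def)
qed

lemma words_props: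
  assumes "w \<in> words n k r"
  shows "length w = n" "set w = {..<k}" "distinct (take r w)"
  using assms by (auto simp: words_def)

lemma X_points_eq_Union_cells:
  assumes "r \<le> n"
  shows "X_points n k r = (\<Union>w\<in>words n k r. cell k w)"
proof
  show "(\<Union>w\<in>words n k r. cell k w) \<subseteq> X_points n k r"
    using lines_of_mem_X_points_iff assms by (fastforce simp: cell_def words_def)
  show "X_points n k r \<subseteq> (\<Union>w\<in>words n k r. cell k w)"
  proof
    fix P assume P: "P \<in> X_points n k r"
    then obtain B where "B \<in> coords k n P" using coords_nonempty X_points_subset by blast
    then have PB: "P = lines_of k n B" and B: "B \<in> carrier_mat k n" "\<And>j. j < n \<Longrightarrow> col B j \<noteq> 0\<^sub>v k"
      by (auto simp: coords_def)
    have "\<And>j. j < n \<Longrightarrow> col B j \<in> carrier_vec k \<and> col B j \<noteq> 0\<^sub>v k" using B by auto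
    from cell_decomposition[of n "col B" k, OF this] obtain w L A c where w: "length w = n" "set w \<subseteq> {..<k}"
      and L: "L \<in> lower_unitriangular k" and A: "A \<in> C_hat k w"
      and c: "\<forall>j<n. c j \<noteq> 0 \<and> col B j = c j \<cdot>\<^sub>v (L *\<^sub>v col A j)" by blast
    have Lc: "L \<in> carrier_mat k k" by (rule lower_unitriangular_carrier[OF L])
    have Ac: "A \<in> carrier_mat k n" using A w by (simp add: mem_C_hat)
    have "cspan k {col B j} = cspan k {col (L * A) j}" if j: "j < n" for j
    proof -
      have "L *\<^sub>v col A j \<in> carrier_vec k" using mult_mat_vec_carrier[OF Lc] Ac j by auto
      then show ?thesis using c j cspan_smult[of "L *\<^sub>v col A j" k "c j"] col_mult2[OF Lc Ac j] by simp
    qed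
    then have P': "P = lines_of k (length w) (L * A)"
      unfolding PB lines_of_def w(1) by (intro restrict_ext) auto
    \<comment> \<open>The elimination yields some word over the alphabet; that \<open>P\<close> lies
      in the variety now forces it into \<open>words n k r\<close>.\<close>
    then have "w \<in> words n k r"
      using lines_of_mem_X_points_iff[OF L A w(2), of r] P w(1) assms by (simp add: words_def)
    moreover have "P \<in> cell k w" using P' L A by (auto simp: cell_def)
    ultimately show "P \<in> (\<Union>w\<in>words n k r. cell k w)" by blast
  qed
qed

section \<open>Separating cells by minors\<close>

text \<open>Gaussian elimination: an equation with a nonzero coefficient removes one unknown and
  itself, so the excess of unknowns persists.\<close>

lemma homogeneous_system:
  fixes Y :: "'s \<Rightarrow> 't \<Rightarrow> 'a :: field"
  assumes "finite S" "finite T" "card S < card T"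
  shows "\<exists>u. (\<exists>b\<in>T. u b \<noteq> 0) \<and> (\<forall>s\<in>S. (\<Sum>b\<in>T. Y s b * u b) = 0)"
  using assms
proof (induction S arbitrary: T Y rule: finite_induct)
  case empty
  then have "T \<noteq> {}" by auto
  then show ?case by (intro exI[of _ "\<lambda>_. 1"]) auto
next
  case (insert s S)
  show ?case
  proof (cases "\<forall>b\<in>T. Y s b = 0")
    case True
    have "card S < card T" using insert.prems(2) insert.hyps by simp
    from insert.IH[OF insert.prems(1) this, of Y]
    obtain u where u: "\<exists>b\<in>T. u b \<noteq> 0" "\<forall>s\<in>S. (\<Sum>b\<in>T. Y s b * u b) = 0" by (elim exE conjE)
    have "(\<Sum>b\<in>T. Y s b * u b) = 0" by (rule sum.neutral) (simp add: True)
    with u show ?thesis by blast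
  next
    case False
    then obtain b0 where b0: "b0 \<in> T" "Y s b0 \<noteq> 0" by blast
    define T' where "T' = T - {b0}"
    have T': "T = insert b0 T'" "b0 \<notin> T'" "finite T'" using b0 insert.prems by (auto simp: T'_def)
    define Y' where "Y' = (\<lambda>s' b. Y s' b - Y s' b0 * Y s b / Y s b0)"
    have "card S < card T'" using insert.prems(2) insert.hyps T' by simp
    from insert.IH[OF T'(3) this, of Y']
    obtain u where u: "\<exists>b\<in>T'. u b \<noteq> 0" "\<forall>s\<in>S. (\<Sum>b\<in>T'. Y' s b * u b) = 0" by (elim exE conjE)
    \<comment> \<open>The value at \<open>b0\<close> is dictated by equation \<open>s\<close>;
      \<open>Y'\<close> is the system left after substituting it.\<close>
    define v where "v = u(b0 := - (\<Sum>b\<in>T'. Y s b * u b) / Y s b0)"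
    have v: "v b = u b" if "b \<in> T'" for b using that T'(2) by (auto simp: v_def)
    have sum: "(\<Sum>b\<in>T. Y s' b * v b) = (\<Sum>b\<in>T'. Y' s' b * u b)" for s'
    proof -
      have "(\<Sum>b\<in>T. Y s' b * v b) = Y s' b0 * v b0 + (\<Sum>b\<in>T'. Y s' b * u b)"
        unfolding T'(1) using T'(2,3) by (simp add: v)
      also have "Y s' b0 * v b0 = - (\<Sum>b\<in>T'. Y s' b0 * Y s b / Y s b0 * u b)"
        by (simp add: v_def sum_distrib_left sum_divide_distrib mult.assoc)
      finally show ?thesis by (simp add: Y'_def left_diff_distrib sum_subtractf)
    qed
    have "Y' s b = 0" for b using b0(2) by (simp add: Y'_def)
    then have "\<forall>s'\<in>insert s S. (\<Sum>b\<in>T. Y s' b * v b) = 0" using u(2) by (simp add: sum)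
    moreover have "\<exists>b\<in>T. v b \<noteq> 0" using u(1) v T'(1) by auto
    ultimately show ?thesis by blast
  qed
qed

text \<open>The hypothesis on \<open>h\<close> makes \<open>B\<close> triangular after a simultaneous permutation of its rows and
  columns.\<close>

lemma det_acyclic_nonzero:
  fixes B :: "'a :: field mat" and h :: "nat \<Rightarrow> nat"
  assumes B: "B \<in> carrier_mat q q" and diag: "\<And>b. b < q \<Longrightarrow> B $$ (b, b) \<noteq> 0"
    and h: "\<And>b c. b < q \<Longrightarrow> c < q \<Longrightarrow> B $$ (b, c) \<noteq> 0 \<Longrightarrow> b = c \<or> h b < h c"
  shows "det B \<noteq> 0"
proof
  assume "det B = 0"
  then obtain v where v: "v \<in> carrier_vec q" "v \<noteq> 0\<^sub>v q" "B *\<^sub>v v = 0\<^sub>v q"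
    using det_0_iff_vec_prod_zero_field[OF B] by blast
  let ?S = "{b. b < q \<and> v $ b \<noteq> 0}"
  have "?S \<noteq> {}"
  proof
    assume "?S = {}"
    then have "v = 0\<^sub>v q" using v(1) by (intro eq_vecI) auto
    then show False using v(2) by blast
  qed
  moreover have "finite ?S" by simp
  \<comment> \<open>At an index of maximal \<open>h\<close> in the support of a kernel vector all
    off-diagonal terms of the row vanish, so the diagonal entry would have to be zero.\<close>
  ultimately obtain b where b: "b \<in> ?S" "Max (h ` ?S) = h b"
    using Max_in[of "h ` ?S"] by blast
  have max: "h c \<le> h b" if "c \<in> ?S" for c
    using that unfolding b(2)[symmetric] by (intro Max_ge) auto
  have "(B *\<^sub>v v) $ b = (\<Sum>c<q. B $$ (b, c) * v $ c)"
    using b(1) v(1) B by (simp add: scalar_prod_def lessThan_atLeast0)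
  also have "\<dots> = (\<Sum>c\<in>{b}. B $$ (b, c) * v $ c)"
  proof (intro sum.mono_neutral_right ballI)
    fix c assume c: "c \<in> {..<q} - {b}"
    show "B $$ (b, c) * v $ c = 0"
    proof (rule ccontr)
      assume "B $$ (b, c) * v $ c \<noteq> 0"
      then have "h b < h c" "c \<in> ?S" using h[of b c] b(1) c by auto
      then show False using max[of c] by simp
    qed
  qed (use b(1) in auto)
  finally show False using v(3) b(1) diag[of b] by simp
qed

text \<open>The columns in \<open>T\<close> factor through a space of dimension
  \<open>card S\<close>, so they are dependent; a dependence among them, extended by zero, is a
  kernel vector.\<close>

lemma det_rank_deficient:
  fixes B :: "'a :: field mat"
  assumes B: "B \<in> carrier_mat q q" and T: "T \<subseteq> {..<q}" and S: "finite S" "card S < card T"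
    and BXY: "\<And>a b. a < q \<Longrightarrow> b \<in> T \<Longrightarrow> B $$ (a, b) = (\<Sum>s\<in>S. X a s * Y s b)"
  shows "det B = 0"
proof -
  have fT: "finite T" using T finite_subset by blast
  obtain u where u: "\<exists>b\<in>T. u b \<noteq> 0" "\<forall>s\<in>S. (\<Sum>b\<in>T. Y s b * u b) = 0"
    using homogeneous_system[OF S(1) fT S(2)] by blast
  define v where "v = vec q (\<lambda>b. if b \<in> T then u b else 0)"
  have v: "v \<in> carrier_vec q" by (simp add: v_def)
  obtain b where b: "b \<in> T" "u b \<noteq> 0" using u(1) by blast
  have "v $ b \<noteq> 0" using b T by (auto simp: v_def)
  then have v0: "v \<noteq> 0\<^sub>v q" using b T by auto
  have "(B *\<^sub>v v) $ a = 0" if a: "a < q" for a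
  proof -
    have "(B *\<^sub>v v) $ a = (\<Sum>b<q. B $$ (a, b) * v $ b)"
      using a v B by (simp add: scalar_prod_def lessThan_atLeast0)
    also have "\<dots> = (\<Sum>b\<in>T. B $$ (a, b) * u b)"
      using T by (intro sum.mono_neutral_cong_right) (auto simp: v_def)
    also have "\<dots> = (\<Sum>b\<in>T. \<Sum>s\<in>S. X a s * (Y s b * u b))"
      using BXY[OF a] by (intro sum.cong refl) (simp add: sum_distrib_right mult.assoc)
    also have "\<dots> = (\<Sum>s\<in>S. X a s * (\<Sum>b\<in>T. Y s b * u b))"
      by (subst sum.swap) (simp add: sum_distrib_left)
    also have "\<dots> = 0" using u(2) by simp
    finally show ?thesis .
  qed
  then have "B *\<^sub>v v = 0\<^sub>v q" using B by (intro eq_vecI) auto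
  then show ?thesis using det_0_iff_vec_prod_zero_field[OF B] v v0 by blast
qed

section \<open>Minors indexed by letters\<close>

lemma cell_coordsE:
  assumes P: "P \<in> cell k w" and w: "set w \<subseteq> {..<k}" and B: "B \<in> coords k (length w) P"
  obtains L A c where "L \<in> lower_unitriangular k" "A \<in> C_hat k w" "\<forall>j<length w. c j \<noteq> 0"
    "\<forall>i<k. \<forall>j<length w. B $$ (i, j) = c j * (\<Sum>t<k. L $$ (i, t) * A $$ (t, j))"
proof -
  obtain L A where L: "L \<in> lower_unitriangular k" and A: "A \<in> C_hat k w"
    and PLA: "P = lines_of k (length w) (L * A)" using P by (auto simp: cell_def)
  obtain c where c: "\<And>j. j < length w \<Longrightarrow> c j \<noteq> 0"
    and Bc: "\<And>i j. i < k \<Longrightarrow> j < length w \<Longrightarrow> B $$ (i, j) = c j * (L * A) $$ (i, j)"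
    using coords_scale[OF cell_coords[OF L A w] B[unfolded PLA]] by metis
  have "A \<in> carrier_mat k (length w)" using A by (simp add: mem_C_hat)
  note entry = mat_mult_entry[OF lower_unitriangular_carrier[OF L] this]
  show ?thesis using that[of L A c] L A c Bc by (simp add: entry)
qed

text \<open>Rows and columns are both indexed by the letters in \<open>xs\<close>, with
  \<open>K\<close> assigning a column to each letter. If \<open>w ! K b = b\<close>, the ones of the
  pattern of \<open>w\<close> fall on the diagonal.\<close>

definition letter_minor :: "nat list \<Rightarrow> (nat \<Rightarrow> nat) \<Rightarrow> complex mat \<Rightarrow> complex" where
  "letter_minor xs K B = det (mat (length xs) (length xs) (\<lambda>(a, b). B $$ (xs ! a, K (xs ! b))))"

lemma mhom_letter_minor:
  assumes "set xs \<subseteq> {..<k}" "\<And>a. a \<in> set xs \<Longrightarrow> K a < n"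
  shows "\<exists>d. mhom k n d (letter_minor xs K)"
proof -
  have "mhom k n (\<lambda>j. card {i. i < length xs \<and> K (xs ! i) = j})
    (\<lambda>B. det (mat (length xs) (length xs) (\<lambda>(a, b). B $$ (xs ! a, K (xs ! b)))))"
    by (rule mhom_minor) (auto intro: nth_less[OF assms(1)] assms(2))
  then show ?thesis unfolding letter_minor_def[abs_def] by blast
qed

text \<open>The chosen columns of the pattern are supported on \<open>xs\<close>, so the minor is a
  product of a minor of \<open>L\<close> and a scaled minor of \<open>A\<close> with no further
  Cauchy-Binet terms. The first is triangular for the order of the letters, the second for the order
  of their first occurrences.\<close>

lemma letter_minor_nonzero:
  assumes P: "P \<in> cell k w" and w: "set w \<subseteq> {..<k}" and B: "B \<in> coords k (length w) P"
    and xs: "distinct xs" "set xs \<subseteq> {..<k}"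
    and K: "\<And>b. b \<in> set xs \<Longrightarrow> K b < length w \<and> w ! K b = b"
    and supp: "\<And>b t. b \<in> set xs \<Longrightarrow> star_pos w t (K b) \<Longrightarrow> t \<in> set xs"
  shows "letter_minor xs K B \<noteq> 0"
proof -
  obtain L A c where L: "L \<in> lower_unitriangular k" and A: "A \<in> C_hat k w" and c: "\<forall>j<length w. c j \<noteq> 0"
    and BLA: "\<forall>i<k. \<forall>j<length w. B $$ (i, j) = c j * (\<Sum>t<k. L $$ (i, t) * A $$ (t, j))"
    by (rule cell_coordsE[OF P w B])
  let ?q = "length xs"
  define X where "X = mat ?q ?q (\<lambda>(a, b). L $$ (xs ! a, xs ! b))"
  define Y where "Y = mat ?q ?q (\<lambda>(a, b). c (K (xs ! b)) * A $$ (xs ! a, K (xs ! b)))"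
  have lt: "xs ! a < k" if "a < ?q" for a by (rule nth_less[OF xs(2) that])
  have "det X \<noteq> 0"
  proof (rule det_acyclic_nonzero[where q = ?q and h = "\<lambda>a. k - xs ! a"])
    show "X $$ (b, b) \<noteq> 0" if "b < ?q" for b
      using that lt L by (simp add: X_def lower_unitriangular_def)
    fix b c' assume *: "b < ?q" "c' < ?q" "X $$ (b, c') \<noteq> 0"
    then have "\<not> xs ! b < xs ! c'" using L lt by (auto simp: X_def lower_unitriangular_def)
    moreover have "b = c'" if "xs ! b = xs ! c'"
      using that xs(1) * by (simp add: nth_eq_iff_index_eq)
    ultimately show "b = c' \<or> k - xs ! b < k - xs ! c'" using lt[of b] * by force
  qed (simp add: X_def)
  moreover have "det Y \<noteq> 0"
  \<comment> \<open>A star in row \<open>t\<close> of a column with letter \<open>b\<close> forces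
    the first \<open>t\<close> before the first \<open>b\<close>, whether or not the column is
    initial.\<close>
  proof (rule det_acyclic_nonzero[where q = ?q and h = "\<lambda>a. first_index w (xs ! a)"])
    show "Y $$ (b, b) \<noteq> 0" if b: "b < ?q" for b
    proof -
      have "A $$ (xs ! b, K (xs ! b)) = 1"
        using C_hat_one[OF A, of "K (xs ! b)"] K[of "xs ! b"] b lt by simp
      then show ?thesis using c K[of "xs ! b"] b by (simp add: Y_def)
    qed
    fix b c' assume *: "b < ?q" "c' < ?q" "Y $$ (b, c') \<noteq> 0"
    then have "A $$ (xs ! b, K (xs ! c')) \<noteq> 0" by (auto simp: Y_def)
    then have "xs ! b = xs ! c' \<or> star_pos w (xs ! b) (K (xs ! c'))"
      using C_hat_nonzero[OF A, of "K (xs ! c')" "xs ! b"] K[of "xs ! c'"] * lt by auto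
    then show "b = c' \<or> first_index w (xs ! b) < first_index w (xs ! c')"
      using xs(1) * K[of "xs ! c'"] by (auto simp: nth_eq_iff_index_eq star_pos_def)
  qed (simp add: Y_def)
  moreover have "mat ?q ?q (\<lambda>(a, b). B $$ (xs ! a, K (xs ! b))) = X * Y"
  proof (rule eq_matI)
    fix a b assume ab: "a < dim_row (X * Y)" "b < dim_col (X * Y)"
    then have ab: "a < ?q" "b < ?q" by (auto simp: X_def Y_def)
    have Kb: "K (xs ! b) < length w" "w ! K (xs ! b) = xs ! b" using K[of "xs ! b"] ab by auto
    have "(\<Sum>t<k. L $$ (xs ! a, t) * A $$ (t, K (xs ! b))) =
        (\<Sum>t\<in>set xs. L $$ (xs ! a, t) * A $$ (t, K (xs ! b)))"
    proof (intro sum.mono_neutral_right ballI)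
      fix t assume t: "t \<in> {..<k} - set xs"
      have "A $$ (t, K (xs ! b)) = 0"
        using C_hat_nonzero[OF A Kb(1), of t] t Kb(2) supp[of "xs ! b" t] nth_mem[OF ab(2)] by auto
      then show "L $$ (xs ! a, t) * A $$ (t, K (xs ! b)) = 0" by simp
    qed (use xs in auto)
    also have "\<dots> = (\<Sum>s<?q. L $$ (xs ! a, xs ! s) * A $$ (xs ! s, K (xs ! b)))"
      by (rule sum.reindex_bij_betw[OF bij_betw_nth[OF xs(1) refl refl], symmetric])
    finally have "B $$ (xs ! a, K (xs ! b)) =
        c (K (xs ! b)) * (\<Sum>s<?q. L $$ (xs ! a, xs ! s) * A $$ (xs ! s, K (xs ! b)))"
      using BLA lt[OF ab(1)] Kb(1) by simp
    also have "\<dots> = (\<Sum>s<?q. X $$ (a, s) * Y $$ (s, b))"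
      using ab by (simp add: X_def Y_def sum_distrib_left mult_ac)
    also have "\<dots> = (X * Y) $$ (a, b)"
      by (rule mat_mult_entry[symmetric]) (use ab in \<open>auto simp: X_def Y_def\<close>)
    finally show "mat ?q ?q (\<lambda>(a, b). B $$ (xs ! a, K (xs ! b))) $$ (a, b) = (X * Y) $$ (a, b)"
      using ab by simp
  qed (auto simp: X_def Y_def)
  ultimately show ?thesis
    using det_mult[of X ?q Y] by (simp add: letter_minor_def X_def Y_def)
qed

text \<open>Since \<open>L\<close> is lower triangular, row \<open>a\<close> of the product sees
  only the rows \<open>t \<le> a\<close> of the pattern. If these lie in \<open>S\<close> for all
  columns of \<open>T\<close>, the columns of \<open>T\<close> factor through \<open>card S\<close>
  dimensions.\<close>

lemma letter_minor_zero:
  assumes P: "P \<in> cell k w" and w: "set w \<subseteq> {..<k}" and B: "B \<in> coords k (length w) P"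
    and xs: "distinct xs" "set xs \<subseteq> {..<k}" and K: "\<And>b. b \<in> set xs \<Longrightarrow> K b < length w"
    and T: "T \<subseteq> set xs" and S: "S \<subseteq> {..<k}" "card S < card T"
    and supp: "\<And>a b t. a \<in> set xs \<Longrightarrow> b \<in> T \<Longrightarrow> t \<le> a \<Longrightarrow> t = w ! K b \<or> star_pos w t (K b) \<Longrightarrow> t \<in> S"
  shows "letter_minor xs K B = 0"
proof -
  obtain L A c where L: "L \<in> lower_unitriangular k" and A: "A \<in> C_hat k w"
    and BLA: "\<forall>i<k. \<forall>j<length w. B $$ (i, j) = c j * (\<Sum>t<k. L $$ (i, t) * A $$ (t, j))"
    by (rule cell_coordsE[OF P w B])
  let ?q = "length xs" and ?T = "{b. b < length xs \<and> xs ! b \<in> T}"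
  have lt: "xs ! a < k" if "a < ?q" for a by (rule nth_less[OF xs(2) that])
  have "(!) xs ` ?T = T" using T by (auto simp: in_set_conv_nth image_iff) (metis in_set_conv_nth subsetD)
  moreover have "inj_on ((!) xs) ?T" using xs(1) by (auto simp: inj_on_def nth_eq_iff_index_eq)
  ultimately have cT: "card ?T = card T" using card_image by fastforce
  have fS: "finite S" using S(1) finite_subset by blast
  show ?thesis unfolding letter_minor_def
  proof (rule det_rank_deficient[where T = ?T and S = S and X = "\<lambda>a t. L $$ (xs ! a, t)"
        and Y = "\<lambda>t b. c (K (xs ! b)) * A $$ (t, K (xs ! b))"])
    fix a b assume a: "a < ?q" and b: "b \<in> ?T"
    have Kb: "K (xs ! b) < length w" using K[of "xs ! b"] b by auto
    have "(\<Sum>t<k. L $$ (xs ! a, t) * A $$ (t, K (xs ! b))) =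
        (\<Sum>t\<in>S. L $$ (xs ! a, t) * A $$ (t, K (xs ! b)))"
    proof (intro sum.mono_neutral_right ballI)
      fix t assume t: "t \<in> {..<k} - S"
      show "L $$ (xs ! a, t) * A $$ (t, K (xs ! b)) = 0"
      proof (cases "t \<le> xs ! a")
        case True
        then have "A $$ (t, K (xs ! b)) = 0"
          using supp[of "xs ! a" "xs ! b" t] C_hat_nonzero[OF A Kb, of t] t a b by auto
        then show ?thesis by simp
      next
        case False
        then have "L $$ (xs ! a, t) = 0" using L lt[OF a] t by (simp add: lower_unitriangular_def)
        then show ?thesis by simp
      qed
    qed (use S in auto)
    then have "B $$ (xs ! a, K (xs ! b)) =
        c (K (xs ! b)) * (\<Sum>t\<in>S. L $$ (xs ! a, t) * A $$ (t, K (xs ! b)))"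
      using BLA lt[OF a] Kb by simp
    then show "mat ?q ?q (\<lambda>(a, b). B $$ (xs ! a, K (xs ! b))) $$ (a, b) =
        (\<Sum>t\<in>S. L $$ (xs ! a, t) * (c (K (xs ! b)) * A $$ (t, K (xs ! b))))"
      using a b by (simp add: sum_distrib_left mult_ac)
  qed (use S(2) fS cT in auto)
qed

text \<open>An asymmetric relation: \<open>C\<close> is meant to precede \<open>C'\<close>. The
  function must be nonzero at every point of \<open>C'\<close>, which gives disjointness and an open
  neighbourhood of all of \<open>C'\<close> that avoids \<open>C\<close>.\<close>

definition separated :: "nat \<Rightarrow> nat \<Rightarrow> (nat \<Rightarrow> complex vec set) set \<Rightarrow> (nat \<Rightarrow> complex vec set) set \<Rightarrow> bool" where
  "separated k n C C' \<longleftrightarrow> (\<exists>d f. mhom k n d f \<and> (\<forall>P\<in>C. \<forall>B\<in>coords k n P. f B = 0) \<and>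
     (\<forall>P\<in>C'. \<forall>B\<in>coords k n P. f B \<noteq> 0))"

lemma separated_by_letter_minor:
  assumes "set xs \<subseteq> {..<k}" "\<And>a. a \<in> set xs \<Longrightarrow> K a < n"
    "\<And>P B. P \<in> C \<Longrightarrow> B \<in> coords k n P \<Longrightarrow> letter_minor xs K B = 0"
    "\<And>P B. P \<in> C' \<Longrightarrow> B \<in> coords k n P \<Longrightarrow> letter_minor xs K B \<noteq> 0"
  shows "separated k n C C'"
proof -
  obtain d where "mhom k n d (letter_minor xs K)"
    using mhom_letter_minor[of xs k K n, OF assms(1,2)] by blast
  then show ?thesis using assms(3,4) unfolding separated_def by blast
qed

text \<open>On the cell of \<open>w\<close> the top \<open>i\<close> rows of the first \<open>p\<close> columns have rank
  \<open>card (set (take p w) \<inter> {..<i})\<close>.\<close>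

lemma separated_by_corner_rank:
  assumes w: "length w = n" "set w \<subseteq> {..<k}" and w': "length w' = n" "set w' \<subseteq> {..<k}"
    and less: "card (set (take p w) \<inter> {..<i}) < card (set (take p w') \<inter> {..<i})"
  shows "separated k n (cell k w) (cell k w')"
proof (rule separated_by_letter_minor)
  let ?S = "set (take p w) \<inter> {..<i}" and ?S' = "set (take p w') \<inter> {..<i}"
  \<comment> \<open>Rows are the letters counted by the larger rank, columns their first occurrences
    in \<open>w'\<close>. These columns are initial, so their stars lie at smaller letters seen
    earlier, hence again in \<open>?S'\<close>.\<close>
  let ?xs = "sorted_list_of_set ?S'" and ?K = "first_index w'"
  have K: "b \<in> set w'" "?K b < p" "?K b < n" "w' ! ?K b = b" if "b \<in> ?S'" for b
    using that first_index[of b w'] w'(1) by (auto simp: set_take_iff)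
  have S'k: "?S' \<subseteq> {..<k}" using w'(2) set_take_subset[of p w'] by blast
  then show "set ?xs \<subseteq> {..<k}" by simp
  show "?K a < n" if "a \<in> set ?xs" for a using that K by simp
  show "letter_minor ?xs ?K B \<noteq> 0" if "P \<in> cell k w'" "B \<in> coords k n P" for P B
  proof (rule letter_minor_nonzero[of P k w' B])
    fix b t assume b: "b \<in> set ?xs" and t: "star_pos w' t (?K b)"
    have b': "b \<in> ?S'" using b by simp
    have "t \<in> set w'" "?K t < ?K b" "t < b"
      using t unfolding star_pos_def K(4)[OF b'] by simp_all
    then have "t \<in> ?S'" using b' K(2)[OF b'] by (simp add: set_take_iff)
    then show "t \<in> set ?xs" by simp
  qed (use that w' K S'k in simp_all)
  show "letter_minor ?xs ?K B = 0" if "P \<in> cell k w" "B \<in> coords k n P" for P B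
  proof (rule letter_minor_zero[of P k w B _ _ ?S' ?S])
    fix a b t assume a: "a \<in> set ?xs" and b: "b \<in> ?S'" and t: "t \<le> a" "t = w ! ?K b \<or> star_pos w t (?K b)"
    have Kb: "?K b < p" "?K b < length w" using K[OF b] w(1) by auto
    have "t \<in> set (take p w)"
      using t(2) Kb(1) first_index_le[OF Kb(2)] nth_mem[OF Kb(2)] unfolding set_take_iff star_pos_def by force
    then show "t \<in> ?S" using t(1) a by auto
  next
    show "?S \<subseteq> {..<k}" using w(2) set_take_subset[of p w] by blast
  qed (use that w K S'k less in simp_all)
qed

text \<open>The minor takes the initial columns of \<open>w'\<close>, with column \<open>first_index w' (w' ! j)\<close> replaced by
  column \<open>j\<close>. On the cell of \<open>w'\<close> they still form a basis, whereas on the cell of \<open>w\<close> column \<open>j\<close>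
  is a combination of strictly earlier columns.\<close>

lemma separated_by_first_index:
  assumes w: "length w = n" "set w = {..<k}" and w': "length w' = n" "set w' = {..<k}"
    and j: "j < n" and less: "first_index w (w ! j) < first_index w' (w' ! j)"
    and eq: "\<And>p. card (set (take p w)) = card (set (take p w'))"
  shows "separated k n (cell k w) (cell k w')"
proof (rule separated_by_letter_minor)
  let ?b = "w' ! j"
  let ?q = "first_index w' ?b" and ?K = "(first_index w')(w' ! j := j)"
  have b: "?b \<in> set w'" using j w'(1) by simp
  have K: "?K a < n \<and> w' ! ?K a = a" if "a < k" for a
    using that first_index[of a w'] w' j by auto
  show "set [0..<k] \<subseteq> {..<k}" by auto
  show "?K a < n" if "a \<in> set [0..<k]" for a using that K by simp
  show "letter_minor [0..<k] ?K B \<noteq> 0" if "P \<in> cell k w'" "B \<in> coords k n P" for P B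
  proof (rule letter_minor_nonzero[of P k w' B])
    show "t \<in> set [0..<k]" if "star_pos w' t (?K b)" for b t
      using that w'(2) by (auto simp: star_pos_def)
  qed (use that w' K in auto)
  show "letter_minor [0..<k] ?K B = 0" if "P \<in> cell k w" "B \<in> coords k n P" for P B
  \<comment> \<open>On the cell of \<open>w\<close> all columns chosen for these letters involve
    only letters seen before position \<open>?q\<close>: column \<open>j\<close> by the assumed
    inequality, the others because they stand before \<open>?q\<close>. As the prefixes of length
    \<open>?q\<close> have equally many letters, this is one column too many.\<close>
  proof (rule letter_minor_zero[of P k w B _ _ "insert ?b (set (take ?q w'))" "set (take ?q w)"])
    fix a b t assume b: "b \<in> insert ?b (set (take ?q w'))" and t: "t = w ! ?K b \<or> star_pos w t (?K b)"
    have Kb: "?K b < length w" using K[of b] b w w' set_take_subset[of ?q w'] nth_mem[of j w'] j by auto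
    have "first_index w (w ! ?K b) < ?q"
    proof (cases "b = ?b")
      case True
      then show ?thesis using less by simp
    next
      case False
      then have "?K b < ?q" using b by (auto simp: set_take_iff)
      then show ?thesis using first_index_le[OF Kb] by simp
    qed
    then show "t \<in> set (take ?q w)"
      using t nth_mem[OF Kb] by (auto simp: set_take_iff star_pos_def)
  next
    have "?b \<notin> set (take ?q w')" by (simp add: set_take_iff)
    then show "card (set (take ?q w)) < card (insert ?b (set (take ?q w')))" by (simp add: eq)
  qed (use that w w' K b set_take_subset[of ?q w] set_take_subset[of ?q w'] in auto)
qed

section \<open>Each cell is an affine space\<close>

locale surjective_word =
  fixes k n :: nat and w :: "nat list"
  assumes length_w: "length w = n" and set_w: "set w = {..<k}"
begin

text \<open>A left summand is an entry of the unitriangular factor, a right one a star of the pattern.\<close>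

definition free_entries :: "(nat \<times> nat + nat \<times> nat) set" where
  "free_entries = Inl ` {(i, j). j < i \<and> i < k} \<union> Inr ` {(i, j). i < k \<and> j < n \<and> star_pos w i j}"

definition m :: nat where "m = card free_entries"

definition entry :: "nat \<Rightarrow> nat \<times> nat + nat \<times> nat" where
  "entry = (SOME e. bij_betw e {..<m} free_entries)"

definition pos :: "nat \<times> nat + nat \<times> nat \<Rightarrow> nat" where
  "pos = inv_into {..<m} entry"

lemma bij_entry: "bij_betw entry {..<m} free_entries"
proof -
  have "finite free_entries"
  proof -
    have "{(i, j). j < i \<and> i < k} \<subseteq> {..<k} \<times> {..<k}" by auto
    moreover have "{(i, j). i < k \<and> j < n \<and> star_pos w i j} \<subseteq> {..<k} \<times> {..<n}" by auto
    ultimately show ?thesis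
      unfolding free_entries_def by (intro finite_UnI finite_imageI) (auto intro: finite_subset)
  qed
  then have "\<exists>e. bij_betw e {..<m} free_entries"
    unfolding m_def using ex_bij_betw_nat_finite by (simp add: lessThan_atLeast0)
  then show ?thesis unfolding entry_def by (rule someI_ex)
qed

lemma pos_less: "v \<in> free_entries \<Longrightarrow> pos v < m"
  using bij_betw_inv_into[OF bij_entry] unfolding pos_def bij_betw_def by blast

lemma entry_pos: "v \<in> free_entries \<Longrightarrow> entry (pos v) = v"
  unfolding pos_def using bij_betw_inv_into_right[OF bij_entry] .

lemma pos_entry: "i < m \<Longrightarrow> pos (entry i) = i"
  unfolding pos_def using bij_betw_inv_into_left[OF bij_entry] by simp

lemma entry_mem: "i < m \<Longrightarrow> entry i \<in> free_entries"
  using bij_betwE[OF bij_entry] by simp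

section \<open>Parametrization of the cell by its free entries\<close>

definition lower :: "complex vec \<Rightarrow> complex mat" where
  "lower x = mat k k (\<lambda>(i, j). if i = j then 1 else if j < i then x $ pos (Inl (i, j)) else 0)"

definition pattern :: "complex vec \<Rightarrow> complex mat" where
  "pattern x = mat k n (\<lambda>(i, j). if i = w ! j then 1 else if star_pos w i j then x $ pos (Inr (i, j)) else 0)"

definition point :: "complex vec \<Rightarrow> (nat \<Rightarrow> complex vec set)" where
  "point x = lines_of k n (lower x * pattern x)"

lemma lower_unitriangular: "lower x \<in> lower_unitriangular k"
  by (auto simp: lower_def lower_unitriangular_def)

lemma pattern_C_hat: "pattern x \<in> C_hat k w"
  by (auto simp: pattern_def mem_C_hat length_w)

lemma lower_pattern_carrier: "lower x \<in> carrier_mat k k" "pattern x \<in> carrier_mat k n"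
  by (auto simp: lower_def pattern_def)

lemma point_coords: "lower x * pattern x \<in> coords k n (point x)"
  using cell_coords[OF lower_unitriangular pattern_C_hat, of x x] set_w
  by (simp add: length_w point_def)

lemma cell_eq: "cell k w = point ` carrier_vec m"
proof
  show "point ` carrier_vec m \<subseteq> cell k w"
    using lower_unitriangular pattern_C_hat unfolding cell_def point_def length_w by blast
  show "cell k w \<subseteq> point ` carrier_vec m"
  proof
    fix P assume "P \<in> cell k w"
    then obtain L A where L: "L \<in> lower_unitriangular k" and A: "A \<in> C_hat k w"
      and P: "P = lines_of k n (L * A)" by (auto simp: cell_def length_w)
    define x where "x = vec m (\<lambda>i. case entry i of Inl ij \<Rightarrow> L $$ ij | Inr ij \<Rightarrow> A $$ ij)"
    have x: "x $ pos v = (case v of Inl ij \<Rightarrow> L $$ ij | Inr ij \<Rightarrow> A $$ ij)" if "v \<in> free_entries" for v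
      using that by (simp add: x_def pos_less entry_pos)
    have "lower x = L"
      using L by (intro eq_matI) (auto simp: lower_def lower_unitriangular_def x free_entries_def)
    moreover have "pattern x = A"
      using A by (intro eq_matI) (auto simp: pattern_def mem_C_hat length_w x free_entries_def)
    ultimately have "P = point x" by (simp add: P point_def)
    moreover have "x \<in> carrier_vec m" by (simp add: x_def)
    ultimately show "P \<in> point ` carrier_vec m" by blast
  qed
qed

lemma polyfun_lower:
  assumes "i < k" "j < k"
  shows "polyfun m (\<lambda>x. lower x $$ (i, j))"
proof (cases "j < i")
  case True
  then have "pos (Inl (i, j)) < m" using assms by (intro pos_less) (simp add: free_entries_def)
  then show ?thesis using True assms polyfun_coord by (simp add: lower_def)
next
  case False
  then show ?thesis using assms polyfun_const by (cases "i = j") (simp_all add: lower_def)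
qed

lemma polyfun_pattern:
  assumes "i < k" "j < n"
  shows "polyfun m (\<lambda>x. pattern x $$ (i, j))"
proof (cases "star_pos w i j")
  case True
  then have "pos (Inr (i, j)) < m" using assms by (intro pos_less) (simp add: free_entries_def)
  then show ?thesis using True assms polyfun_coord star_pos_neq[OF True] by (simp add: pattern_def)
next
  case False
  then show ?thesis using assms polyfun_const by (cases "i = w ! j") (simp_all add: pattern_def)
qed

lemma polyfun_lower_pattern:
  assumes "i < k" "j < n"
  shows "polyfun m (\<lambda>x. (lower x * pattern x) $$ (i, j))"
  unfolding mat_mult_entry[OF lower_pattern_carrier assms]
  by (intro polyfun_sum polyfun_mult polyfun_lower polyfun_pattern assms) simp_all

text \<open>Indexed by the parameter \<open>x\<close> and not by the point: \<open>point\<close> is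
  not yet known to be injective, and the formulas over \<open>params\<close> are what proves it. All
  coordinate matrices are included because the formulas must hold for each of them.\<close>

abbreviation params :: "(complex vec \<times> complex mat) set" where
  "params \<equiv> Sigma (carrier_vec m) (\<lambda>x. coords k n (point x))"

definition scale :: "complex vec \<times> complex mat \<Rightarrow> nat \<Rightarrow> complex" where
  "scale p = (SOME c. (\<forall>j<n. c j \<noteq> 0) \<and>
     (\<forall>i<k. \<forall>j<n. snd p $$ (i, j) = c j * (lower (fst p) * pattern (fst p)) $$ (i, j)))"

text \<open>The entries of the product \<open>A D\<close>, where \<open>D\<close> is the diagonal
  matrix of the column scalars. Unlike \<open>A\<close> they come out of the recursion directly,
  with degree 1 in column \<open>j\<close>.\<close>

definition scaled_pattern :: "complex vec \<times> complex mat \<Rightarrow> nat \<Rightarrow> nat \<Rightarrow> complex" where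
  "scaled_pattern p i j = scale p j * pattern (fst p) $$ (i, j)"

lemma scale:
  assumes "p \<in> params"
  shows "j < n \<Longrightarrow> scale p j \<noteq> 0"
    "i < k \<Longrightarrow> j < n \<Longrightarrow> snd p $$ (i, j) = scale p j * (lower (fst p) * pattern (fst p)) $$ (i, j)"
proof -
  have "snd p \<in> coords k n (point (fst p))" using assms by auto
  from coords_scale[OF point_coords this] obtain c where
    "\<And>j. j < n \<Longrightarrow> c j \<noteq> 0"
    "\<And>i j. i < k \<Longrightarrow> j < n \<Longrightarrow> snd p $$ (i, j) = c j * (lower (fst p) * pattern (fst p)) $$ (i, j)"
    by metis
  then have "\<exists>c. (\<forall>j<n. c j \<noteq> 0) \<and>
     (\<forall>i<k. \<forall>j<n. snd p $$ (i, j) = c j * (lower (fst p) * pattern (fst p)) $$ (i, j))" by blast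
  from someI_ex[OF this] show "j < n \<Longrightarrow> scale p j \<noteq> 0"
    "i < k \<Longrightarrow> j < n \<Longrightarrow> snd p $$ (i, j) = scale p j * (lower (fst p) * pattern (fst p)) $$ (i, j)"
    unfolding scale_def by blast+
qed

lemma coords_entry:
  assumes p: "p \<in> params" and i: "i < k" and j: "j < n"
  shows "snd p $$ (i, j) = scaled_pattern p i j + (\<Sum>t<i. lower (fst p) $$ (i, t) * scaled_pattern p t j)"
proof -
  have "snd p $$ (i, j) = (\<Sum>t<k. lower (fst p) $$ (i, t) * scaled_pattern p t j)"
    unfolding scale(2)[OF p i j] mat_mult_entry[OF lower_pattern_carrier i j]
    by (simp add: scaled_pattern_def sum_distrib_left mult_ac)
  also have "\<dots> = (\<Sum>t\<in>insert i {..<i}. lower (fst p) $$ (i, t) * scaled_pattern p t j)"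
    using i by (intro sum.mono_neutral_right) (auto simp: lower_def)
  also have "\<dots> = scaled_pattern p i j + (\<Sum>t<i. lower (fst p) $$ (i, t) * scaled_pattern p t j)"
    using i by (simp add: lower_def)
  finally show ?thesis .
qed

lemma scaled_pattern_letter:
  assumes "p \<in> params" "j < n"
  shows "scaled_pattern p (w ! j) j = scale p j"
  using assms nth_less[of w k j] by (simp add: scaled_pattern_def pattern_def length_w set_w)

text \<open>In an initial column the pattern has its last nonzero entry in row \<open>a\<close>, so the LDU recursion
  can be solved for \<open>lower x $$ (i, a)\<close>.\<close>

lemma coords_entry_initial:
  assumes p: "p \<in> params" and a: "a < i" and i: "i < k"
  shows "snd p $$ (i, first_index w a) = lower (fst p) $$ (i, a) * scaled_pattern p a (first_index w a) +
    (\<Sum>t<a. lower (fst p) $$ (i, t) * scaled_pattern p t (first_index w a))"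
proof -
  let ?j = "first_index w a"
  have j: "?j < n" "w ! ?j = a" using first_index[of a w] a i by (auto simp: set_w length_w)
  have zero: "scaled_pattern p t ?j = 0" if "a < t" "t < k" for t
    using that j by (simp add: scaled_pattern_def pattern_def star_pos_def)
  have "(\<Sum>t<i. lower (fst p) $$ (i, t) * scaled_pattern p t ?j) =
      (\<Sum>t\<in>insert a {..<a}. lower (fst p) $$ (i, t) * scaled_pattern p t ?j)"
    using a i by (intro sum.mono_neutral_right ballI) (auto simp: zero)
  then show ?thesis
    unfolding coords_entry[OF p i j(1)] using zero[OF a i] by simp
qed

abbreviation unit_degree :: "nat \<Rightarrow> nat \<Rightarrow> int" where
  "unit_degree j \<equiv> \<lambda>l. if l = j then 1 else 0"

text \<open>Row \<open>i\<close> is solved from the rows above it. Every letter \<open>a < i\<close>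
  occurs and so has an initial column, from which entry \<open>(i, a)\<close> of
  \<open>lower\<close> is found for increasing \<open>a\<close>; after that, row \<open>i\<close> of
  the scaled pattern follows by subtraction. The pivot for \<open>a\<close> is a column scalar,
  hence nonzero.\<close>

lemma hrat_factors:
  assumes "i < k"
  shows "(\<forall>a<i. hrat k n params snd (\<lambda>_. 0) (\<lambda>p. lower (fst p) $$ (i, a))) \<and>
    (\<forall>j<n. hrat k n params snd (unit_degree j) (\<lambda>p. scaled_pattern p i j))"
  using assms
proof (induction i rule: less_induct)
  case (less i)
  note IH = less.IH and \<open>i < k\<close>
  have prod: "hrat k n params snd (unit_degree j) (\<lambda>p. lower (fst p) $$ (i, t) * scaled_pattern p t j)"
    if "hrat k n params snd (\<lambda>_. 0) (\<lambda>p. lower (fst p) $$ (i, t))" "t < i" "j < n" for t j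
  proof -
    have "hrat k n params snd (unit_degree j) (\<lambda>p. scaled_pattern p t j)"
      using IH[of t] \<open>i < k\<close> that by auto
    from hrat_mult[OF that(1) this] show ?thesis by simp
  qed
  have L: "hrat k n params snd (\<lambda>_. 0) (\<lambda>p. lower (fst p) $$ (i, a))" if "a < i" for a
    using that
  proof (induction a rule: less_induct)
    case (less a)
    let ?j = "first_index w a"
    have a: "a \<in> set w" using less.prems \<open>i < k\<close> by (simp add: set_w)
    have j: "?j < n" "w ! ?j = a" using first_index[OF a] by (auto simp: length_w)
    let ?S = "\<lambda>p. \<Sum>t<a. lower (fst p) $$ (i, t) * scaled_pattern p t ?j"
    have S: "hrat k n params snd (unit_degree ?j) ?S"
      using less j(1) by (intro hrat_sum prod) auto
    have N: "hrat k n params snd (unit_degree ?j) (\<lambda>p. scaled_pattern p a ?j)"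
      using IH[OF less.prems] less.prems \<open>i < k\<close> j(1) by auto
    have N0: "scaled_pattern p a ?j \<noteq> 0" if "p \<in> params" for p
      using scaled_pattern_letter[OF that j(1)] scale(1)[OF that j(1)] j(2) by simp
    \<comment> \<open>Numerator and pivot both have degree 1 in the initial column of
      \<open>a\<close>, so the quotient has degree 0.\<close>
    have "hrat k n params snd (\<lambda>l. unit_degree ?j l - unit_degree ?j l)
        (\<lambda>p. (snd p $$ (i, ?j) - ?S p) / scaled_pattern p a ?j)"
      by (rule hrat_divide[OF hrat_diff[OF hrat_entry[OF \<open>i < k\<close> j(1)] S] N N0])
    then show ?case
    proof (rule hrat_cong)
      fix p assume p: "p \<in> params"
      show "(snd p $$ (i, ?j) - ?S p) / scaled_pattern p a ?j = lower (fst p) $$ (i, a)"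
        unfolding coords_entry_initial[OF p less.prems \<open>i < k\<close>] using N0[OF p] by simp
    qed simp
  qed
  have "hrat k n params snd (unit_degree j) (\<lambda>p. scaled_pattern p i j)" if j: "j < n" for j
  proof -
    let ?S = "\<lambda>p. \<Sum>t<i. lower (fst p) $$ (i, t) * scaled_pattern p t j"
    have S: "hrat k n params snd (unit_degree j) ?S"
      using L j by (intro hrat_sum prod) auto
    show ?thesis
    proof (rule hrat_cong[OF hrat_diff[OF hrat_entry[OF \<open>i < k\<close> j] S]])
      fix p assume p: "p \<in> params"
      show "snd p $$ (i, j) - ?S p = scaled_pattern p i j"
        unfolding coords_entry[OF p \<open>i < k\<close> j] by simp
    qed simp
  qed
  with L show ?case by blast
qed

lemma hrat_coordinate:
  assumes v: "v < m"
  shows "hrat k n params snd (\<lambda>_. 0) (\<lambda>p. fst p $ v)"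
proof -
  consider i j where "entry v = Inl (i, j)" "j < i" "i < k"
    | i j where "entry v = Inr (i, j)" "i < k" "j < n" "star_pos w i j"
    using entry_mem[OF v] by (auto simp: free_entries_def)
  then show ?thesis
  proof cases
    case 1
    have "fst p $ v = lower (fst p) $$ (i, j)" for p :: "complex vec \<times> complex mat"
      using 1 pos_entry[OF v] by (simp add: lower_def)
    then show ?thesis using hrat_factors[OF 1(3)] 1(2) by simp
  next
    case 2
    have wj: "w ! j < k" using nth_less[of w k j] 2(3) by (simp add: set_w length_w)
    have N0: "scaled_pattern p (w ! j) j \<noteq> 0" if "p \<in> params" for p
      using scaled_pattern_letter[OF that 2(3)] scale(1)[OF that 2(3)] by simp
    \<comment> \<open>The pattern is 1 in row \<open>w ! j\<close>, so this division removes the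
      column scalar.\<close>
    have "hrat k n params snd (\<lambda>l. unit_degree j l - unit_degree j l)
        (\<lambda>p. scaled_pattern p i j / scaled_pattern p (w ! j) j)"
      using hrat_factors[OF 2(2)] hrat_factors[OF wj] 2(3) by (intro hrat_divide N0) auto
    then show ?thesis
    proof (rule hrat_cong)
      fix p assume p: "p \<in> params"
      have "fst p $ v = pattern (fst p) $$ (i, j)"
        using 2 pos_entry[OF v] star_pos_neq[OF 2(4)] by (simp add: pattern_def)
      then show "scaled_pattern p i j / scaled_pattern p (w ! j) j = fst p $ v"
        using scale(1)[OF p 2(3)] scaled_pattern_letter[OF p 2(3)] by (simp add: scaled_pattern_def)
    qed simp
  qed
qed

text \<open>Equal points share a coordinate matrix, and each parameter is the same quotient
  evaluated at it.\<close>

lemma inj_point: "inj_on point (carrier_vec m)"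
proof (rule inj_onI)
  fix x y assume xy: "x \<in> carrier_vec m" "y \<in> carrier_vec m" "point x = point y"
  define B where "B = lower x * pattern x"
  have p: "(x, B) \<in> params" "(y, B) \<in> params" using xy point_coords[of x] by (auto simp: B_def)
  have "x $ v = y $ v" if v: "v < m" for v
  proof -
    obtain d g h where "\<forall>p\<in>params. h (snd p) \<noteq> 0 \<and> fst p $ v = g (snd p) / h (snd p)"
      by (rule hrat0E[OF hrat_coordinate[OF v]])
    from bspec[OF this p(1)] bspec[OF this p(2)] show ?thesis by simp
  qed
  then show "x = y" using xy by (intro eq_vecI) auto
qed

lemma isomorphic_cell:
  assumes X: "cell k w \<subseteq> X" "X \<subseteq> mproj_points k n"
  shows "isomorphic (subvariety (subvariety (mproj k n) X) (cell k w)) (affine_space m)"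
proof -
  let ?\<phi> = "inv_into (carrier_vec m) point"
  have \<phi>: "?\<phi> P \<in> carrier_vec m" "point (?\<phi> P) = P" if "P \<in> cell k w" for P
    using that unfolding cell_eq by (auto intro: inv_into_into f_inv_into_f)
  have "hrat k n (Sigma (cell k w) (coords k n)) snd (\<lambda>_. 0) (\<lambda>(P, A). ?\<phi> P $ v)" if v: "v < m" for v
  proof -
    obtain d g h where gh: "mhom k n d g" "mhom k n d h"
      and eq: "\<forall>p\<in>params. h (snd p) \<noteq> 0 \<and> fst p $ v = g (snd p) / h (snd p)"
      by (rule hrat0E[OF hrat_coordinate[OF v]])
    have "h A \<noteq> 0 \<and> ?\<phi> P $ v = g A / h A" if "P \<in> cell k w" "A \<in> coords k n P" for P A
      using bspec[OF eq, of "(?\<phi> P, A)"] that \<phi> by auto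
    then show ?thesis by (intro hratI[OF gh]) auto
  qed
  then interpret affine_chart k n m X "cell k w" point ?\<phi> "\<lambda>x. lower x * pattern x"
    using X \<phi> inj_point point_coords polyfun_lower_pattern
    by unfold_locales (auto simp: cell_eq)
  show ?thesis by (rule isomorphic_affine)
qed

end

section \<open>Ordering the cells\<close>

lemma lexicographic_enumeration:
  fixes f g :: "'a \<Rightarrow> nat"
  assumes "finite W"
  obtains xs where "distinct xs" "set xs = W"
    "\<forall>j<length xs. \<forall>i<j. f (xs ! i) < f (xs ! j) \<or> f (xs ! i) = f (xs ! j) \<and> g (xs ! i) \<le> g (xs ! j)"
proof -
  \<comment> \<open>\<open>N\<close> exceeds every value of \<open>g\<close> on \<open>W\<close>, so
    sorting by \<open>f x * N + g x\<close> is lexicographic.\<close>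
  define N where "N = Suc (Max (g ` W))"
  obtain ys where ys: "set ys = W" "distinct ys" using finite_distinct_list[OF assms] by blast
  define key where "key = (\<lambda>x. f x * N + g x)"
  define xs where "xs = sort_key key ys"
  have xs: "distinct xs" "set xs = W" using ys by (simp_all add: xs_def)
  have sorted: "sorted (map key xs)" by (simp add: xs_def)
  have "f (xs ! i) < f (xs ! j) \<or> f (xs ! i) = f (xs ! j) \<and> g (xs ! i) \<le> g (xs ! j)"
    if ij: "i < j" "j < length xs" for i j
  proof -
    have le: "key (xs ! i) \<le> key (xs ! j)"
      using sorted_nth_mono[OF sorted, of i j] ij by simp
    have "xs ! j \<in> W" using xs(2) ij nth_mem by blast
    then have gN: "g (xs ! j) < N" using assms by (simp add: N_def le_imp_less_Suc)
    have "\<not> f (xs ! j) < f (xs ! i)"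
    proof
      assume "f (xs ! j) < f (xs ! i)"
      then have "Suc (f (xs ! j)) * N \<le> f (xs ! i) * N" by (intro mult_le_mono1) simp
      then show False using le gN by (simp add: key_def)
    qed
    moreover have "g (xs ! i) \<le> g (xs ! j)" if "f (xs ! i) = f (xs ! j)"
      using le that by (simp add: key_def)
    ultimately show ?thesis by linarith
  qed
  then show ?thesis using that xs by blast
qed

text \<open>Closedness only needs the pairwise separation: the part of \<open>X\<close> outside the first cells is the
  locus where, for each of them, one of its separating functions does not vanish.\<close>

lemma affine_paving_if_separated:
  assumes X: "X \<subseteq> mproj_points k n" "X = \<Union> (set Cs)"
    and sep: "\<And>i j. i < j \<Longrightarrow> j < length Cs \<Longrightarrow> separated k n (Cs ! i) (Cs ! j)"
    and iso: "\<And>C. C \<in> set Cs \<Longrightarrow> \<exists>m. isomorphic (subvariety (subvariety (mproj k n) X) C) (affine_space m)"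
  shows "affine_paving (subvariety (mproj k n) X) Cs"
proof -
  define sepfun where "sepfun i j f \<longleftrightarrow> (\<exists>d. mhom k n d f) \<and>
     (\<forall>P\<in>Cs ! i. \<forall>B\<in>coords k n P. f B = 0) \<and> (\<forall>P\<in>Cs ! j. \<forall>B\<in>coords k n P. f B \<noteq> 0)" for i j f
  define f where "f i j = (SOME f. sepfun i j f)" for i j
  have "sepfun i j (f i j)" if "i < j" "j < length Cs" for i j
  proof -
    have "\<exists>f. sepfun i j f" using sep[OF that] unfolding sepfun_def separated_def by blast
    then show ?thesis unfolding f_def by (rule someI_ex)
  qed
  then have f: "\<exists>d. mhom k n d (f i j)" "\<And>P B. P \<in> Cs ! i \<Longrightarrow> B \<in> coords k n P \<Longrightarrow> f i j B = 0"
    "\<And>P B. P \<in> Cs ! j \<Longrightarrow> B \<in> coords k n P \<Longrightarrow> f i j B \<noteq> 0" if "i < j" "j < length Cs" for i j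
    using that unfolding sepfun_def by blast+
  have mem: "P \<in> mproj_points k n" if "P \<in> Cs ! i" "i < length Cs" for P i
    using that(1) nth_mem[OF that(2)] X by blast
  have disjoint: "Cs ! i \<inter> Cs ! j = {}" if ij: "i < j" "j < length Cs" for i j
  proof (rule ccontr)
    assume "Cs ! i \<inter> Cs ! j \<noteq> {}"
    then obtain P where P: "P \<in> Cs ! i" "P \<in> Cs ! j" by blast
    obtain B where "B \<in> coords k n P" using coords_nonempty mem[OF P(2) ij(2)] by blast
    then show False using f(2,3)[OF ij] P by blast
  qed
  have closed: "closedin (subtopology (mproj_topology k n) X) (\<Union>j\<le>i. Cs ! j)" if i: "i < length Cs" for i
  proof -
    define D where "D l j = {P \<in> mproj_points k n. \<forall>B\<in>coords k n P. f l j B \<noteq> 0}" for l j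
    \<comment> \<open>For each \<open>l\<close> the union runs over all \<open>j > l\<close>, not
      only \<open>j > i\<close>: every \<open>f l j\<close> vanishes on cell \<open>l\<close>, which
      suffices to exclude it, and a point of a cell beyond \<open>i\<close> lies in the
      corresponding set for each \<open>l \<le> i\<close>.\<close>
    define O' where "O' = (\<Inter>l\<in>{..i}. \<Union>j\<in>{l<..<length Cs}. D l j)"
    have "openin (mproj_topology k n) (D l j)" if lj: "l < j" "j < length Cs" for l j
    proof -
      obtain d where "mhom k n d (f l j)" using f(1)[OF lj] by blast
      then show ?thesis unfolding D_def by (rule openin_mproj_nonvanishing1)
    qed
    then have "openin (mproj_topology k n) O'"
      unfolding O'_def by (intro openin_INT2 openin_Union) auto
    moreover have "X - (\<Union>j\<le>i. Cs ! j) = O' \<inter> X"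
    proof
      show "X - (\<Union>j\<le>i. Cs ! j) \<subseteq> O' \<inter> X"
      proof
        fix P assume P: "P \<in> X - (\<Union>j\<le>i. Cs ! j)"
        then have PX: "P \<in> X" and Pi: "\<And>j. j \<le> i \<Longrightarrow> P \<notin> Cs ! j" by simp_all
        obtain C where "C \<in> set Cs" "P \<in> C" using PX unfolding X(2) by (rule UnionE)
        then obtain j where j: "j < length Cs" "P \<in> Cs ! j" unfolding in_set_conv_nth by blast
        have "i < j" using Pi[of j] j(2) not_le by blast
        then have "P \<in> D l j" if "l \<le> i" for l
          using f(3)[of l j P] \<open>i < j\<close> j that mem[OF j(2,1)] unfolding D_def by simp
        then have "P \<in> (\<Union>j\<in>{l<..<length Cs}. D l j)" if "l \<le> i" for l
          using that j(1) \<open>i < j\<close> by (intro UN_I[of j]) simp_all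
        then show "P \<in> O' \<inter> X" using PX unfolding O'_def by simp
      qed
      show "O' \<inter> X \<subseteq> X - (\<Union>j\<le>i. Cs ! j)"
      proof
        fix P assume P: "P \<in> O' \<inter> X"
        have "P \<notin> Cs ! l" if l: "l \<le> i" for l
        proof
          assume Pl: "P \<in> Cs ! l"
          have "P \<in> (\<Union>j\<in>{l<..<length Cs}. D l j)" using P l unfolding O'_def by blast
          then obtain j where j: "l < j" "j < length Cs" "P \<in> D l j" by auto
          have "P \<in> mproj_points k n" using mem[OF Pl] l i by simp
          then obtain B where "B \<in> coords k n P" using coords_nonempty by blast
          then show False using f(2)[OF j(1,2) Pl] j(3) unfolding D_def by blast
        qed
        then show "P \<in> X - (\<Union>j\<le>i. Cs ! j)" using P by blast
      qed
    qed
    ultimately have "openin (subtopology (mproj_topology k n) X) (X - (\<Union>j\<le>i. Cs ! j))"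
      unfolding openin_subtopology by blast
    moreover have "topspace (subtopology (mproj_topology k n) X) = X"
      using X(1) by (simp add: topspace_mproj_topology Int_absorb1)
    moreover have "Cs ! j \<subseteq> X" if "j \<le> i" for j
      unfolding X(2) using that i by (intro Union_upper nth_mem) simp
    ultimately show ?thesis unfolding closedin_def by (metis UN_least atMost_iff)
  qed
  show ?thesis
    unfolding affine_paving_def
  proof (intro conjI allI impI)
    show "\<Union> (set Cs) = topspace (zariski (subvariety (mproj k n) X))"
      using X(1) unfolding X(2)[symmetric]
      by (simp add: zariski_subvariety mproj_def topspace_mproj_topology Int_absorb1)
    show "Cs ! i \<inter> Cs ! j = {}" if "i < length Cs" "j < length Cs" "i \<noteq> j" for i j
      using disjoint[of i j] disjoint[of j i] that by (cases "i < j") auto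
    show "closedin (zariski (subvariety (mproj k n) X)) (\<Union>j\<le>i. Cs ! j)" if "i < length Cs" for i
      using closed[OF that] by (simp add: zariski_subvariety mproj_def)
    show "\<exists>m. isomorphic (subvariety (subvariety (mproj k n) X) (Cs ! i)) (affine_space m)"
      if "i < length Cs" for i
      using iso[OF nth_mem[OF that]] .
  qed
qed

definition letter_rank :: "nat list \<Rightarrow> nat \<Rightarrow> nat \<Rightarrow> nat" where
  "letter_rank w i p = card (set (take p w) \<inter> {..<i})"

text \<open>The difference of the values at \<open>Suc i\<close> and \<open>i\<close> is 1 or 0
  according to whether the letter \<open>i\<close> occurs in the prefix.\<close>

lemma initial_letters_determined:
  assumes "\<And>i. letter_rank w i p = letter_rank w' i p"
  shows "set (take p w) = set (take p w')"
proof -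
  have step: "letter_rank w (Suc i) p = letter_rank w i p + (if i \<in> set (take p w) then 1 else 0)" for w i
    by (auto simp: letter_rank_def lessThan_Suc)
  have "i \<in> set (take p w) \<longleftrightarrow> i \<in> set (take p w')" for i
    using step[of w i] step[of w' i] assms[of i] assms[of "Suc i"] by (auto split: if_splits)
  then show ?thesis by blast
qed

text \<open>The letter at \<open>j\<close> is the one that is new at its first occurrence
  \<open>q\<close>, and \<open>q\<close> is the same for both words. The prefix sets just before and
  just after \<open>q\<close> identify it.\<close>

lemma word_determined:
  assumes len: "length w = n" "length w' = n"
    and letters: "\<And>p. p \<le> n \<Longrightarrow> set (take p w) = set (take p w')"
    and first: "\<And>j. j < n \<Longrightarrow> first_index w (w ! j) = first_index w' (w' ! j)"
  shows "w = w'"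
proof (rule nth_equalityI)
  show "length w = length w'" using len by simp
  fix j assume "j < length w"
  then have j: "j < n" using len by simp
  define q where "q = first_index w (w ! j)"
  have q: "q \<le> j" "w ! q = w ! j" "w' ! q = w' ! j" "w ! j \<notin> set (take q w)" "w' ! j \<notin> set (take q w')"
    using first_index_le[of j w] first_index[of "w ! j" w] first_index[of "w' ! j" w'] first[OF j] j len
    by (auto simp: q_def set_take_iff)
  have "set (take (Suc q) w) = insert (w ! j) (set (take q w))"
       "set (take (Suc q) w') = insert (w' ! j) (set (take q w'))"
    using q j len by (simp_all add: take_Suc_conv_app_nth)
  then show "w ! j = w' ! j"
    using letters[of q] letters[of "Suc q"] q j by auto
qed

theorem proposition3p2:
  fixes r k n :: nat
  assumes "r \<le> k" and "k \<le> n" and "1 \<le> k"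
  shows "induces_affine_paving (X_variety n k r) (words n k r) (cell k)"
proof -
  define \<kappa>1 where "\<kappa>1 w = (\<Sum>p\<le>n. card (set (take p w)))" for w :: "nat list"
  define \<kappa>2 where "\<kappa>2 w = (\<Sum>j<n. first_index w (w ! j)) + (\<Sum>p\<le>n. \<Sum>i\<le>k. letter_rank w i p)" for w
  have "words n k r \<subseteq> {w. set w \<subseteq> {..<k} \<and> length w = n}" by (auto simp: words_def)
  then have "finite (words n k r)" using finite_lists_length_eq[of "{..<k}" n] finite_subset by blast
  then obtain ws where ws: "distinct ws" "set ws = words n k r"
    and ord: "\<forall>j<length ws. \<forall>i<j.
      \<kappa>1 (ws ! i) < \<kappa>1 (ws ! j) \<or> \<kappa>1 (ws ! i) = \<kappa>1 (ws ! j) \<and> \<kappa>2 (ws ! i) \<le> \<kappa>2 (ws ! j)"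
    by (rule lexicographic_enumeration[of "words n k r" \<kappa>1 \<kappa>2])
  have sep: "separated k n (cell k w) (cell k w')"
    if w: "w \<in> words n k r" and w': "w' \<in> words n k r" and neq: "w \<noteq> w'"
      and ord: "\<kappa>1 w < \<kappa>1 w' \<or> \<kappa>1 w = \<kappa>1 w' \<and> \<kappa>2 w \<le> \<kappa>2 w'" for w w'
  proof (rule ccontr)
    assume nsep: "\<not> ?thesis"
    note lw = words_props[OF w] and lw' = words_props[OF w']
    \<comment> \<open>Without separation every quantity of \<open>w'\<close> is bounded by that of
      \<open>w\<close>. The order gives the reverse inequality for the sums, so the summands agree
      one by one and the two words coincide.\<close>
    have rank: "letter_rank w' i p \<le> letter_rank w i p" for i p
      using nsep separated_by_corner_rank[of w n k w' p i] lw lw' by (auto simp: letter_rank_def not_less[symmetric])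
    \<comment> \<open>The corner with all \<open>k\<close> rows is the full block of initial
      columns, so the first level of the order is governed by corner ranks too.\<close>
    have rank_k: "letter_rank v k p = card (set (take p v))" if "set v = {..<k}" for v p
      using that set_take_subset[of p v] by (auto simp: letter_rank_def Int_absorb2)
    have card_le: "card (set (take p w')) \<le> card (set (take p w))" for p
      using rank[of k p] rank_k lw(2) lw'(2) by simp
    then have "\<kappa>1 w' \<le> \<kappa>1 w" unfolding \<kappa>1_def by (intro sum_mono)
    \<comment> \<open>Equality at the first level makes the ranks of all initial sets of columns
      agree, as \<open>separated_by_first_index\<close> requires.\<close>
    then have eq1: "\<kappa>1 w' = \<kappa>1 w" and le2: "\<kappa>2 w \<le> \<kappa>2 w'" using ord by auto
    have card_n: "card (set (take p w)) = card (set (take p w'))" if "p \<le> n" for p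
      using sum_mono_inv[OF eq1[unfolded \<kappa>1_def] card_le] that by simp
    have card_eq: "card (set (take p w)) = card (set (take p w'))" for p
      using card_n[of p] lw lw' by (cases "p \<le> n") auto
    have first: "first_index w' (w' ! j) \<le> first_index w (w ! j)" if "j < n" for j
      using nsep separated_by_first_index[OF lw(1,2) lw'(1,2) that _ card_eq] by (auto simp: not_less[symmetric])
    let ?F = "\<lambda>v. \<Sum>j<n. first_index v (v ! j)" and ?R = "\<lambda>v. \<Sum>p\<le>n. \<Sum>i\<le>k. letter_rank v i p"
    have F: "?F w' \<le> ?F w" using first by (intro sum_mono) auto
    have R: "?R w' \<le> ?R w" by (intro sum_mono rank)
    have Feq: "?F w' = ?F w" and Req: "?R w' = ?R w" using F R le2 unfolding \<kappa>2_def by linarith+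
    have first_eq: "first_index w' (w' ! j) = first_index w (w ! j)" if "j < n" for j
      using sum_mono_inv[OF Feq first] that by simp
    have "(\<Sum>i\<le>k. letter_rank w' i p) = (\<Sum>i\<le>k. letter_rank w i p)" if "p \<le> n" for p
      by (rule sum_mono_inv[OF Req]) (use that rank in \<open>auto intro: sum_mono\<close>)
    then have rank_eq: "letter_rank w' i p = letter_rank w i p" if "p \<le> n" "i \<le> k" for p i
      by (rule sum_mono_inv) (use that rank in auto)
    have "letter_rank w' i p = letter_rank w i p" if p: "p \<le> n" for p i
    proof (cases "i \<le> k")
      case False
      \<comment> \<open>Beyond \<open>k\<close> there are no further letters, so the bounded range
        of the sum already covers every \<open>i\<close>.\<close>
      then have "letter_rank v i p = letter_rank v k p" if "set v = {..<k}" for v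
        using that set_take_subset[of p v] by (auto simp: letter_rank_def intro!: arg_cong[of _ _ card])
      then show ?thesis using rank_eq[OF p order_refl] lw lw' by simp
    qed (rule rank_eq[OF p])
    then have "w = w'"
      using lw lw' first_eq by (intro word_determined initial_letters_determined) auto
    then show False using neq by simp
  qed
  have X: "X_points n k r = (\<Union>w\<in>words n k r. cell k w)"
    using assms by (intro X_points_eq_Union_cells) simp
  have "affine_paving (X_variety n k r) (map (cell k) ws)"
    unfolding X_variety_def
  proof (rule affine_paving_if_separated)
    show "X_points n k r \<subseteq> mproj_points k n" by (rule X_points_subset)
    show "X_points n k r = \<Union> (set (map (cell k) ws))" using X ws(2) by simp
    fix i j assume ij: "i < j" "j < length (map (cell k) ws)"
    have "separated k n (cell k (ws ! i)) (cell k (ws ! j))"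
    proof (rule sep)
      show "ws ! i \<in> words n k r" "ws ! j \<in> words n k r" using ij nth_mem ws(2) by auto
      show "ws ! i \<noteq> ws ! j" using ij nth_eq_iff_index_eq[OF ws(1), of i j] by simp
    qed (use ij ord in simp)
    then show "separated k n (map (cell k) ws ! i) (map (cell k) ws ! j)" using ij by simp
  next
    fix C assume "C \<in> set (map (cell k) ws)"
    then obtain w where w: "w \<in> words n k r" "C = cell k w" using ws(2) by auto
    interpret surjective_word k n w using words_props[OF w(1)] by unfold_locales
    show "\<exists>m. isomorphic (subvariety (subvariety (mproj k n) (X_points n k r)) C) (affine_space m)"
      unfolding w(2)
    proof (intro exI[of _ m] isomorphic_cell X_points_subset)
      show "cell k w \<subseteq> X_points n k r" unfolding X using w(1) by blast
    qed
  qed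
  then show ?thesis unfolding induces_affine_paving_def using ws by blast
qed

end
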